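(* Let $1\le p,q\le\infty$ and let $f\in\mathcal{S}'(\mathbb{R}^d)$ be such that its Wigner distribution satisfies $Wf\in M^{p,q}(\mathbb{R}^{2d})$. Then $Q^n f\in M^{p,q}(\mathbb{R}^{2d})$ for every $n\in\mathbb{N}_+=\{1,2,\dots\}$, where $Q^n f$ is the Born--Jordan distribution of order $n$ of $f$.
   Context: Write $x\omega=x\cdot\omega$ for the scalar product in $\mathbb{R}^d$. The Wigner distribution of $f$ is $Wf(x,\omega)=\int_{\mathbb{R}^d} f(x+\frac y2)\overline{f(x-\frac y2)}e^{-2\pi i y\omega}\,dy$, $(x,\omega)\in\mathbb{R}^{2d}$, extended to $f\in\mathcal{S}'(\mathbb{R}^d)$ in the usual distributional sense (a linear change of variables in $f\otimes\overline f$ followed by a partial Fourier transform), so that $Wf\in\mathcal{S}'(\mathbb{R}^{2d})$. The symplectic form is $\sigma((x,\omega),(\zeta_1,\zeta_2))=\omega\cdot\zeta_1-x\cdot\zeta_2$, and the symplectic Fourier transform on $\mathbb{R}^{2d}$ is $\mathcal{F}_\sigma F(\zeta)=\int_{\mathbb{R}^{2d}}e^{-2\pi i\sigma(\zeta,z)}F(z)\,dz$ (extended to tempered distributions); it is an involution. Let $\mathrm{sinc}(t)=\frac{\sin(\pi t)}{\pi t}$ for $t\ne0$, $\mathrm{sinc}(0)=1$, and $\Theta^n(x,\omega)=\mathrm{sinc}^n(x\cdot\omega)$ on $\mathbb{R}^{2d}$. The Born--Jordan distribution of order $n$ is $Q^nf=Wf*\mathcal{F}_\sigma(\Theta^n)$;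 equivalently, $Q^n f$ is the tempered distribution with $\mathcal{F}_\sigma(Q^nf)=\Theta^n\cdot\mathcal{F}_\sigma(Wf)$ (the product makes sense since $\Theta^n$ is smooth with all derivatives of at most polynomial growth). Modulation spaces: for a fixed $g\in\mathcal{S}(\mathbb{R}^m)\setminus\{0\}$, let $V_gF(x,\omega)=\int_{\mathbb{R}^m}F(y)\overline{g(y-x)}e^{-2\pi i y\omega}\,dy$. $M^{p,q}(\mathbb{R}^m)$ is the space of $F\in\mathcal{S}'(\mathbb{R}^m)$ with $\|F\|_{M^{p,q}}=\big(\int(\int|V_gF(x,\omega)|^p\,dx)^{q/p}d\omega\big)^{1/q}<\infty$ (usual modification if $p=\infty$ or $q=\infty$); different $g$ give equivalent norms. *)

theory Defs
  imports "HOL-Analysis.Analysis" "HOL-Probability.Essential_Supremum"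
begin

section \<open>Schwartz functions and tempered distributions\<close>

definition partial_deriv :: "'a::euclidean_space \<Rightarrow> ('a \<Rightarrow> complex) \<Rightarrow> 'a \<Rightarrow> complex" where
  "partial_deriv b \<phi> = (\<lambda>x. frechet_derivative \<phi> (at x) b)"

text \<open>Multi-indices are represented by lists of coordinate directions:
  the list \<open>[b\<^sub>1, \<dots>, b\<^sub>m]\<close> over \<open>Basis\<close> stands for the differential operator that is the
  composition of the partial derivatives in the directions \<open>b\<^sub>1, \<dots>, b\<^sub>m\<close>.\<close>

definition partial_derivs :: "'a::euclidean_space list \<Rightarrow> ('a \<Rightarrow> complex) \<Rightarrow> 'a \<Rightarrow> complex" where
  "partial_derivs bs \<phi> = foldr partial_deriv bs \<phi>"

definition smooth :: "('a::euclidean_space \<Rightarrow> complex) \<Rightarrow> bool" where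
  "smooth \<phi> \<longleftrightarrow> (\<forall>bs\<in>lists Basis. \<forall>x. partial_derivs bs \<phi> differentiable at x)"

definition schwartz :: "('a::euclidean_space \<Rightarrow> complex) set" where
  "schwartz = {\<phi>. smooth \<phi> \<and>
     (\<forall>k. \<forall>bs\<in>lists Basis. bounded (range (\<lambda>x. (1 + norm x) ^ k *\<^sub>R partial_derivs bs \<phi> x)))}"

definition schwartz_seminorm :: "nat \<Rightarrow> nat \<Rightarrow> ('a::euclidean_space \<Rightarrow> complex) \<Rightarrow> real" where
  "schwartz_seminorm k m \<phi> =
     (SUP (x, bs) \<in> UNIV \<times> {bs \<in> lists Basis. length bs \<le> m}.
        (1 + norm x) ^ k * norm (partial_derivs bs \<phi> x))"

type_synonym 'a functional = "('a \<Rightarrow> complex) \<Rightarrow> complex"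

text \<open>A tempered distribution is a complex-linear functional on the Schwartz space that is
  continuous, i.e. dominated by one of the (increasing) defining seminorms. HOL functions are
  total, so functionals take the value 0 off the Schwartz space; hence equality of distributions
  is equality of functionals. The pairing is bilinear: a function \<open>F\<close> corresponds to
  \<open>\<phi> \<mapsto> \<integral> F(x) \<phi>(x) dx\<close>, without conjugation.\<close>

definition tempered_distributions :: "'a::euclidean_space functional set" where
  "tempered_distributions = {T.
     (\<forall>\<phi>. \<phi> \<notin> schwartz \<longrightarrow> T \<phi> = 0) \<and>
     (\<forall>\<phi>\<in>schwartz. \<forall>\<psi>\<in>schwartz. \<forall>a b. T (\<lambda>x. a * \<phi> x + b * \<psi> x) = a * T \<phi> + b * T \<psi>) \<and>
     (\<exists>k m C. \<forall>\<phi>\<in>schwartz. norm (T \<phi>) \<le> C * schwartz_seminorm k m \<phi>)}"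

text \<open>Extension by duality: the functional \<open>\<phi> \<mapsto> \<langle>T, A \<phi>\<rangle>\<close>.\<close>

definition dual_op ::
  "(('a::euclidean_space \<Rightarrow> complex) \<Rightarrow> ('b::euclidean_space \<Rightarrow> complex)) \<Rightarrow>
   'b functional \<Rightarrow> 'a functional" where
  "dual_op A T = (\<lambda>\<phi>. if \<phi> \<in> schwartz then T (A \<phi>) else 0)"

definition mult_dist ::
  "('a::euclidean_space \<Rightarrow> complex) \<Rightarrow> 'a functional \<Rightarrow> 'a functional" where
  "mult_dist \<theta> = dual_op (\<lambda>\<phi> x. \<theta> x * \<phi> x)"

definition cnj_dist :: "'a::euclidean_space functional \<Rightarrow> 'a functional" where
  "cnj_dist T = (\<lambda>\<phi>. cnj (T (\<lambda>x. cnj (\<phi> x))))"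

definition tensor_dist ::
  "'a::euclidean_space functional \<Rightarrow> 'b::euclidean_space functional \<Rightarrow> ('a \<times> 'b) functional" where
  "tensor_dist S T = (\<lambda>\<Phi>. if \<Phi> \<in> schwartz then S (\<lambda>x. T (\<lambda>y. \<Phi> (x, y))) else 0)"

section \<open>The Wigner distribution\<close>

text \<open>The distributional form of \<open>F \<mapsto> ((x, y) \<mapsto> F (x + y/2, x - y/2))\<close>. The linear map
  \<open>(x, y) \<mapsto> (x + y/2, x - y/2)\<close> has determinant of absolute value 1 and inverse
  \<open>(u, v) \<mapsto> ((u + v)/2, u - v)\<close>, which therefore acts on the test function.\<close>

definition wigner_coords ::
  "('a::euclidean_space \<times> 'a) functional \<Rightarrow> ('a \<times> 'a) functional" where
  "wigner_coords = dual_op (\<lambda>\<Phi> (u, v). \<Phi> ((1/2) *\<^sub>R (u + v), u - v))"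

text \<open>Fourier transform in the second variable; its kernel is symmetric, so it is its own
  transpose.\<close>

definition partial_fourier ::
  "('a::euclidean_space \<times> 'a \<Rightarrow> complex) \<Rightarrow> 'a \<times> 'a \<Rightarrow> complex" where
  "partial_fourier F = (\<lambda>(x, \<omega>). \<integral>y. F (x, y) * cis (- 2 * pi * (y \<bullet> \<omega>)) \<partial>lborel)"

definition partial_fourier_dist ::
  "('a::euclidean_space \<times> 'a) functional \<Rightarrow> ('a \<times> 'a) functional" where
  "partial_fourier_dist = dual_op partial_fourier"

definition wigner :: "'a::euclidean_space functional \<Rightarrow> ('a \<times> 'a) functional" where
  "wigner f = partial_fourier_dist (wigner_coords (tensor_dist f (cnj_dist f)))"

section \<open>The symplectic Fourier transform and Born--Jordan distributions\<close>

definition sympl_form :: "'a::euclidean_space \<times> 'a \<Rightarrow> 'a \<times> 'a \<Rightarrow> real" where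
  "sympl_form = (\<lambda>(x, \<omega>) (\<zeta>1, \<zeta>2). \<omega> \<bullet> \<zeta>1 - x \<bullet> \<zeta>2)"

definition sympl_fourier ::
  "('a::euclidean_space \<times> 'a \<Rightarrow> complex) \<Rightarrow> 'a \<times> 'a \<Rightarrow> complex" where
  "sympl_fourier F = (\<lambda>\<zeta>. \<integral>z. cis (- 2 * pi * sympl_form \<zeta> z) * F z \<partial>lborel)"

text \<open>The symplectic form is antisymmetric, so the transpose of the symplectic Fourier transform
  with respect to the bilinear pairing is its composition with the reflection.\<close>

definition sympl_fourier_dist ::
  "('a::euclidean_space \<times> 'a) functional \<Rightarrow> ('a \<times> 'a) functional" where
  "sympl_fourier_dist = dual_op (\<lambda>\<Phi> z. sympl_fourier \<Phi> (- z))"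

text \<open>The normalised cardinal sine; \<open>sinc\<close> in HOL-Probability is the unnormalised one.\<close>

definition nsinc :: "real \<Rightarrow> real" where
  "nsinc t = (if t = 0 then 1 else sin (pi * t) / (pi * t))"

definition Theta :: "'a::euclidean_space \<times> 'a \<Rightarrow> complex" where
  "Theta = (\<lambda>(x, \<omega>). complex_of_real (nsinc (x \<bullet> \<omega>)))"

definition born_jordan ::
  "nat \<Rightarrow> 'a::euclidean_space functional \<Rightarrow> ('a \<times> 'a) functional" where
  "born_jordan n f = (THE Q. Q \<in> tempered_distributions \<and>
     sympl_fourier_dist Q = mult_dist (\<lambda>z. Theta z ^ n) (sympl_fourier_dist (wigner f)))"

section \<open>Modulation spaces\<close>

definition stft ::
  "('a::euclidean_space \<Rightarrow> complex) \<Rightarrow> 'a functional \<Rightarrow> 'a \<Rightarrow> 'a \<Rightarrow> complex" where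
  "stft g F x \<omega> = F (\<lambda>y. cnj (g (y - x)) * cis (- 2 * pi * (y \<bullet> \<omega>)))"

definition ennreal_powr :: "ennreal \<Rightarrow> real \<Rightarrow> ennreal" where
  "ennreal_powr x r = (if x = \<infinity> then \<infinity> else ennreal (enn2real x powr r))"

text \<open>Meant for exponents in \<open>[1, \<infinity>]\<close>, so that \<open>ennreal_powr\<close> is applied with positive real
  exponents only.\<close>

definition Lp_norm :: "ennreal \<Rightarrow> ('a::euclidean_space \<Rightarrow> ennreal) \<Rightarrow> ennreal" where
  "Lp_norm p h =
     (if p = \<infinity> then esssup lborel h
      else ennreal_powr (\<integral>\<^sup>+x. ennreal_powr (h x) (enn2real p) \<partial>lborel) (1 / enn2real p))"

definition modulation_norm ::
  "('a::euclidean_space \<Rightarrow> complex) \<Rightarrow> ennreal \<Rightarrow> ennreal \<Rightarrow> 'a functional \<Rightarrow> ennreal" where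
  "modulation_norm g p q F =
     Lp_norm q (\<lambda>\<omega>. Lp_norm p (\<lambda>x. ennreal (norm (stft g F x \<omega>))))"

definition modulation_space ::
  "('a::euclidean_space \<Rightarrow> complex) \<Rightarrow> ennreal \<Rightarrow> ennreal \<Rightarrow> 'a functional set" where
  "modulation_space g p q = {F \<in> tempered_distributions. modulation_norm g p q F < \<infinity>}"

end

theory Submission
  imports Defs
begin

text \<open>Only the temperedness of \<open>W = wigner f\<close> matters, and since \<open>Theta\<close> enters as a power it
  suffices to treat one factor: the transpose of \<open>bj_op \<phi> = sympl_fourier (Theta * sympl_fourier \<phi>)\<close>
  has to preserve the modulation space. As \<open>Theta (x, \<omega>)\<close> is the integral of the chirps
  \<open>cis (2 * pi * s * (x \<bullet> \<omega>))\<close> over \<open>\<bar>s\<bar> \<le> 1/2\<close>, and a translated chirp is the same chirp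
  times a plane wave, the matrix of \<open>bj_op\<close> with respect to time-frequency shifts of the window is
  bounded by an average over \<open>s\<close> of rapidly decreasing convolution kernels, composed with the shear
  \<open>(z, w) \<mapsto> (z + s * swap w, w)\<close>. For fixed \<open>w\<close> the shear is a translation in \<open>z\<close>, so it does not
  change the inner \<open>L\<^sup>p\<close> norm. The reproducing formula of the short-time Fourier transform, applied
  to tempered distributions, turns the kernel bound into a pointwise bound for the transform of the
  Born--Jordan distribution, and Minkowski's inequality concludes.\<close>

section \<open>Smooth functions and their jets\<close>

text \<open>\<open>Theta\<close> is not uniformly continuous: near (x, 0) it drops from 1 to 0 over
  a distance of order 1/|x|. So it is not the Fourier transform of a finite measure, and Young's
  inequality does not apply to a convolution with its transform. Pieces of \<open>Theta\<close> cut
  out by a translated Schwartz window do have transforms with uniformly bounded integrals, but these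
  spread along the points \<open>s *\<^sub>R prod.swap w\<close>, a segment of unbounded length.
  This is harmless only because the segment depends on the output frequency \<open>w\<close> alone
  and displaces the position, over which the inner norm is taken. A tempered distribution is known
  only through one seminorm bound, so pulling it into an integral of time-frequency shifts requires
  convergence in every Schwartz seminorm. Hence the estimates below bound all derivatives up to an
  order at once, with constants uniform in functions and parameters. One window serves for analysis
  and synthesis, so the final bound is in the given norm.\<close>

lemma partial_deriv_eqI: "(\<phi> has_derivative \<phi>') (at x) \<Longrightarrow> partial_deriv b \<phi> x = \<phi>' b"
  unfolding partial_deriv_def by (metis frechet_derivative_at)

lemma has_derivative_frechet:
  "\<phi> differentiable at x \<Longrightarrow> (\<phi> has_derivative frechet_derivative \<phi> (at x)) (at x)"
  by (simp add: frechet_derivative_works)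

lemma frechet_derivative_Basis_sum:
  assumes "\<phi> differentiable at x"
  shows "frechet_derivative \<phi> (at x) h = (\<Sum>b\<in>Basis. (h \<bullet> b) *\<^sub>R partial_deriv b \<phi> x)"
proof -
  have "linear (frechet_derivative \<phi> (at x))"
    using assms linear_frechet_derivative by blast
  then have "frechet_derivative \<phi> (at x) (\<Sum>b\<in>Basis. (h \<bullet> b) *\<^sub>R b)
      = (\<Sum>b\<in>Basis. (h \<bullet> b) *\<^sub>R frechet_derivative \<phi> (at x) b)"
    by (simp add: linear_sum linear_scale)
  then show ?thesis by (simp add: euclidean_representation partial_deriv_def)
qed

text \<open>The operator nearest to the function is the last entry of the list. The third rule peels
  a list from that end and replaces the function by one of its derivatives, which is what the
  inductions over reversed lists use.\<close>

lemma partial_derivs_simps [simp]: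
  "partial_derivs [] \<phi> = \<phi>"
  "partial_derivs (b # bs) \<phi> = partial_deriv b (partial_derivs bs \<phi>)"
  "partial_derivs (bs @ [b]) \<phi> = partial_derivs bs (partial_deriv b \<phi>)"
  by (simp_all add: partial_derivs_def)

lemma smooth_differentiable: "smooth \<phi> \<Longrightarrow> \<phi> differentiable at x"
  unfolding smooth_def by (metis lists.Nil partial_derivs_simps(1))

lemma smooth_partial_deriv: "smooth \<phi> \<Longrightarrow> b \<in> Basis \<Longrightarrow> smooth (partial_deriv b \<phi>)"
  unfolding smooth_def
  by (metis Cons_in_lists_iff append_in_lists_conv lists.Nil partial_derivs_simps(3))

lemma smooth_continuous_on: "smooth \<phi> \<Longrightarrow> continuous_on A \<phi>"
  by (simp add: continuous_at_imp_continuous_on differentiable_imp_continuous_within smooth_differentiable)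

lemma smooth_measurable: "smooth \<phi> \<Longrightarrow> \<phi> \<in> borel_measurable borel"
  by (simp add: borel_measurable_continuous_onI smooth_continuous_on)

text \<open>A stratification of \<open>smooth\<close> by order. The derivative of a product is a sum
  of products, and that of a linear substitution a combination of substitutions, so closure is
  proved by induction on the order with the functions arbitrary. Level \<open>m\<close> grants
  \<open>m + 1\<close> derivatives, since level 0 already asks for differentiability.\<close>

fun differentiable_upto :: "nat \<Rightarrow> ('a::euclidean_space \<Rightarrow> complex) \<Rightarrow> bool" where
  "differentiable_upto 0 \<phi> \<longleftrightarrow> (\<forall>x. \<phi> differentiable at x)"
| "differentiable_upto (Suc m) \<phi> \<longleftrightarrow>
     (\<forall>x. \<phi> differentiable at x) \<and> (\<forall>b\<in>Basis. differentiable_upto m (partial_deriv b \<phi>))"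

lemma differentiable_upto_Suc: "differentiable_upto (Suc m) \<phi> \<Longrightarrow> differentiable_upto m \<phi>"
  by (induction m arbitrary: \<phi>) auto

lemma smooth_iff_differentiable_upto: "smooth \<phi> \<longleftrightarrow> (\<forall>m. differentiable_upto m \<phi>)"
proof
  show "smooth \<phi> \<Longrightarrow> \<forall>m. differentiable_upto m \<phi>"
  proof
    fix m show "smooth \<phi> \<Longrightarrow> differentiable_upto m \<phi>"
      by (induction m arbitrary: \<phi>) (auto simp: smooth_differentiable smooth_partial_deriv)
  qed
  assume *: "\<forall>m. differentiable_upto m \<phi>"
  have "differentiable_upto (length bs) \<phi> \<Longrightarrow> partial_derivs bs \<phi> differentiable at x"
    if "bs \<in> lists Basis" for bs x
    using that by (induction bs arbitrary: \<phi> rule: rev_induct) auto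
  then show "smooth \<phi>" using * by (simp add: smooth_def)
qed

text \<open>For a class that is closed under partial derivatives the induction on the order is done
  here once and for all. Translates, conjugates, plane waves, chirps and parameter integrals below
  form such classes.\<close>

lemma smooth_coinduct:
  assumes "P \<phi>"
    and "\<And>\<phi> x. P \<phi> \<Longrightarrow> \<phi> differentiable at x"
    and "\<And>\<phi> b. P \<phi> \<Longrightarrow> b \<in> Basis \<Longrightarrow> P (partial_deriv b \<phi>)"
  shows "smooth \<phi>"
proof -
  have "differentiable_upto m \<phi>" for m
    using assms(1) by (induction m arbitrary: \<phi>) (auto simp: assms(2,3))
  then show ?thesis by (simp add: smooth_iff_differentiable_upto)
qed

section \<open>Sums, products and constants\<close>

lemma partial_deriv_add:
  assumes "\<And>x. \<phi> differentiable at x" "\<And>x. \<psi> differentiable at x"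
  shows "partial_deriv b (\<lambda>x. \<phi> x + \<psi> x) = (\<lambda>x. partial_deriv b \<phi> x + partial_deriv b \<psi> x)"
proof
  fix x
  have "((\<lambda>x. \<phi> x + \<psi> x) has_derivative
      (\<lambda>h. frechet_derivative \<phi> (at x) h + frechet_derivative \<psi> (at x) h)) (at x)"
    by (intro has_derivative_add has_derivative_frechet assms)
  from partial_deriv_eqI[OF this]
  show "partial_deriv b (\<lambda>x. \<phi> x + \<psi> x) x = partial_deriv b \<phi> x + partial_deriv b \<psi> x"
    by (simp add: partial_deriv_def)
qed

lemma partial_deriv_mult:
  assumes "\<And>x. \<phi> differentiable at x" "\<And>x. \<psi> differentiable at x"
  shows "partial_deriv b (\<lambda>x. \<phi> x * \<psi> x) =
    (\<lambda>x. partial_deriv b \<phi> x * \<psi> x + \<phi> x * partial_deriv b \<psi> x)"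
proof
  fix x
  have "((\<lambda>x. \<phi> x * \<psi> x) has_derivative
      (\<lambda>h. \<phi> x * frechet_derivative \<psi> (at x) h + frechet_derivative \<phi> (at x) h * \<psi> x)) (at x)"
    by (intro has_derivative_mult has_derivative_frechet assms)
  from partial_deriv_eqI[OF this]
  show "partial_deriv b (\<lambda>x. \<phi> x * \<psi> x) x = partial_deriv b \<phi> x * \<psi> x + \<phi> x * partial_deriv b \<psi> x"
    by (simp add: partial_deriv_def)
qed

lemma partial_deriv_const [simp]: "partial_deriv b (\<lambda>x. c) = (\<lambda>x. 0)"
  by (rule ext) (simp add: partial_deriv_eqI[OF has_derivative_const])

lemma partial_deriv_cmult:
  assumes "\<And>x. \<phi> differentiable at x"
  shows "partial_deriv b (\<lambda>x. c * \<phi> x) = (\<lambda>x. c * partial_deriv b \<phi> x)"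
  using partial_deriv_mult[OF _ assms, of "\<lambda>x. c" b] by simp

lemma differentiable_upto_const: "differentiable_upto m (\<lambda>x. c)"
  by (induction m arbitrary: c) auto

lemma differentiable_upto_add:
  "differentiable_upto m \<phi> \<Longrightarrow> differentiable_upto m \<psi> \<Longrightarrow> differentiable_upto m (\<lambda>x. \<phi> x + \<psi> x)"
  by (induction m arbitrary: \<phi> \<psi>) (auto simp: partial_deriv_add)

lemma differentiable_upto_mult:
  "differentiable_upto m \<phi> \<Longrightarrow> differentiable_upto m \<psi> \<Longrightarrow> differentiable_upto m (\<lambda>x. \<phi> x * \<psi> x)"
proof (induction m arbitrary: \<phi> \<psi>)
  case (Suc m)
  \<comment> \<open>The product rule pairs a derivative with an undifferentiated factor, which has
    to be lowered to level \<open>m\<close> as well.\<close>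
  have "differentiable_upto m \<phi>" "differentiable_upto m \<psi>"
    using Suc.prems differentiable_upto_Suc by blast+
  with Suc show ?case
    by (auto simp: partial_deriv_mult intro!: differentiable_upto_add)
qed auto

lemma smooth_const [simp]: "smooth (\<lambda>x. c)"
  and smooth_add: "smooth \<phi> \<Longrightarrow> smooth \<psi> \<Longrightarrow> smooth (\<lambda>x. \<phi> x + \<psi> x)"
  and smooth_mult: "smooth \<phi> \<Longrightarrow> smooth \<psi> \<Longrightarrow> smooth (\<lambda>x. \<phi> x * \<psi> x)"
  by (simp_all add: smooth_iff_differentiable_upto differentiable_upto_const
      differentiable_upto_add differentiable_upto_mult)

lemma smooth_cmult: "smooth \<phi> \<Longrightarrow> smooth (\<lambda>x. c * \<phi> x)"
  by (rule smooth_mult[OF smooth_const])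

lemma smooth_sum: "(\<And>i. i \<in> I \<Longrightarrow> smooth (u i)) \<Longrightarrow> smooth (\<lambda>x. \<Sum>i\<in>I. u i x)"
  by (induction I rule: infinite_finite_induct) (auto simp: smooth_add)

lemma smooth_diff: "smooth \<phi> \<Longrightarrow> smooth \<psi> \<Longrightarrow> smooth (\<lambda>x. \<phi> x - \<psi> x)"
  using smooth_add[OF _ smooth_cmult[of \<psi> "-1"], of \<phi>] by simp

text \<open>Unfolded, this has one term for each ordered list of at most \<open>m\<close>
  directions. The recursion differentiates the function first, so product, chain and integral
  estimates go by induction on \<open>m\<close>, with one real number per point in place of a family
  of multi-indices.\<close>

fun jet :: "nat \<Rightarrow> ('a::euclidean_space \<Rightarrow> complex) \<Rightarrow> 'a \<Rightarrow> real" where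
  "jet 0 \<phi> x = norm (\<phi> x)"
| "jet (Suc m) \<phi> x = norm (\<phi> x) + (\<Sum>b\<in>Basis. jet m (partial_deriv b \<phi>) x)"

lemma jet_nonneg [simp]: "0 \<le> jet m \<phi> x"
  by (induction m arbitrary: \<phi>) (auto intro!: add_nonneg_nonneg sum_nonneg)

lemma norm_le_jet: "norm (\<phi> x) \<le> jet m \<phi> x"
  by (cases m) (auto intro!: sum_nonneg)

lemma jet_partial_deriv_le: "b \<in> Basis \<Longrightarrow> jet m (partial_deriv b \<phi>) x \<le> jet (Suc m) \<phi> x"
  using member_le_sum[of b Basis "\<lambda>b. jet m (partial_deriv b \<phi>) x"] by (simp add: add_increasing)

lemma jet_le_Suc: "jet m \<phi> x \<le> jet (Suc m) \<phi> x"
proof (induction m arbitrary: \<phi>)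
  case (Suc m)
  then show ?case unfolding jet.simps(2)[of "Suc m"] jet.simps(2)[of m \<phi>]
    by (intro add_mono sum_mono order_refl)
qed (auto intro!: sum_nonneg)

lemma jet_mono: "m \<le> m' \<Longrightarrow> jet m \<phi> x \<le> jet m' \<phi> x"
  by (rule lift_Suc_mono_le[of "\<lambda>m. jet m \<phi> x"]) (rule jet_le_Suc)

lemma jet_cmult: "smooth \<phi> \<Longrightarrow> jet m (\<lambda>x. c * \<phi> x) x = norm c * jet m \<phi> x"
proof (induction m arbitrary: \<phi>)
  case (Suc m)
  then show ?case
    by (simp add: partial_deriv_cmult smooth_differentiable smooth_partial_deriv norm_mult
        sum_distrib_left distrib_left)
qed (simp add: norm_mult)

lemma jet_const: "jet m (\<lambda>x. c) x = norm c"
proof -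
  have "jet m (\<lambda>x. 0) x = 0" by (induction m) auto
  then show ?thesis by (cases m) auto
qed

lemma jet_add: "smooth \<phi> \<Longrightarrow> smooth \<psi> \<Longrightarrow> jet m (\<lambda>x. \<phi> x + \<psi> x) x \<le> jet m \<phi> x + jet m \<psi> x"
proof (induction m arbitrary: \<phi> \<psi>)
  case (Suc m)
  have "norm (\<phi> x + \<psi> x) + (\<Sum>b\<in>Basis. jet m (\<lambda>x. partial_deriv b \<phi> x + partial_deriv b \<psi> x) x)
    \<le> (norm (\<phi> x) + norm (\<psi> x)) + (\<Sum>b\<in>Basis. jet m (partial_deriv b \<phi>) x + jet m (partial_deriv b \<psi>) x)"
    by (intro add_mono norm_triangle_ineq sum_mono Suc.IH smooth_partial_deriv Suc.prems)
  then show ?case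
    using Suc.prems by (simp add: partial_deriv_add smooth_differentiable sum.distrib)
qed (simp add: norm_triangle_ineq)

lemma jet_sum:
  assumes "finite I" "\<And>i. i \<in> I \<Longrightarrow> smooth (u i)"
  shows "jet m (\<lambda>x. \<Sum>i\<in>I. u i x) x \<le> (\<Sum>i\<in>I. jet m (u i) x)"
  using assms
proof (induction I rule: finite_induct)
  case (insert i I)
  have "jet m (\<lambda>x. u i x + (\<Sum>i\<in>I. u i x)) x \<le> jet m (u i) x + jet m (\<lambda>x. \<Sum>i\<in>I. u i x) x"
    using insert by (intro jet_add smooth_sum) auto
  with insert show ?case by (simp add: insert.hyps)
qed (simp add: jet_const)

text \<open>The Leibniz rule with its coefficients absorbed in one constant. The constant is chosen
  before the functions and the point; this makes the later seminorm estimates uniform in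
  parameters.\<close>

lemma jet_mult:
  "\<exists>C\<ge>0. \<forall>\<phi> \<psi>::'a::euclidean_space \<Rightarrow> complex. \<forall>x. smooth \<phi> \<longrightarrow> smooth \<psi> \<longrightarrow>
     jet m (\<lambda>x. \<phi> x * \<psi> x) x \<le> C * (jet m \<phi> x * jet m \<psi> x)"
proof (induction m)
  case 0
  then show ?case by (intro exI[of _ 1]) (auto simp: norm_mult)
next
  case (Suc m)
  then obtain C where C: "C \<ge> 0" "\<And>\<phi> \<psi>::'a \<Rightarrow> complex. \<And>x. smooth \<phi> \<Longrightarrow> smooth \<psi> \<Longrightarrow>
     jet m (\<lambda>x. \<phi> x * \<psi> x) x \<le> C * (jet m \<phi> x * jet m \<psi> x)" by blast
  \<comment> \<open>One term for the product itself, and in each direction two products of lower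
    order, each at the price of the constant for order \<open>m\<close>.\<close>
  let ?C = "1 + real DIM('a) * (2 * C)"
  show ?case
  proof (intro exI[of _ ?C] conjI allI impI)
    show "?C \<ge> 0" using C(1) by simp
    fix \<phi> \<psi> :: "'a \<Rightarrow> complex" and x :: 'a
    assume sm: "smooth \<phi>" "smooth \<psi>"
    let ?P = "jet (Suc m) \<phi> x * jet (Suc m) \<psi> x"
    have "norm (\<phi> x * \<psi> x) \<le> ?P"
      unfolding norm_mult by (intro mult_mono norm_le_jet jet_nonneg norm_ge_zero)
    moreover have "jet m (\<lambda>x. partial_deriv b \<phi> x * \<psi> x + \<phi> x * partial_deriv b \<psi> x) x \<le> 2 * C * ?P"
      if b: "b \<in> Basis" for b
    proof -
      have "jet m (\<lambda>x. partial_deriv b \<phi> x * \<psi> x + \<phi> x * partial_deriv b \<psi> x) x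
        \<le> C * (jet m (partial_deriv b \<phi>) x * jet m \<psi> x) + C * (jet m \<phi> x * jet m (partial_deriv b \<psi>) x)"
        using sm b by (intro jet_add[THEN order_trans] add_mono C(2) smooth_mult smooth_partial_deriv)
      also have "\<dots> \<le> C * ?P + C * ?P"
        by (intro add_mono mult_left_mono mult_mono jet_partial_deriv_le jet_le_Suc C(1) b jet_nonneg)
      finally show ?thesis by simp
    qed
    then have "(\<Sum>b\<in>Basis. jet m (\<lambda>x. partial_deriv b \<phi> x * \<psi> x + \<phi> x * partial_deriv b \<psi> x) x)
        \<le> real DIM('a) * (2 * C * ?P)"
      by (intro sum_bounded_above) auto
    ultimately have "jet (Suc m) (\<lambda>x. \<phi> x * \<psi> x) x \<le> ?P + real DIM('a) * (2 * C * ?P)"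
      using sm by (simp only: jet.simps partial_deriv_mult smooth_differentiable)
    then show "jet (Suc m) (\<lambda>x. \<phi> x * \<psi> x) x \<le> ?C * ?P"
      by (simp only: distrib_right mult.assoc mult_1)
  qed
qed

section \<open>Linear substitutions, translations and conjugation\<close>

lemma differentiable_compose_linear:
  assumes "bounded_linear L" "\<And>x. \<phi> differentiable at x"
  shows "(\<lambda>x. \<phi> (L x)) differentiable at x"
  using differentiable_chain_at[OF bounded_linear_imp_differentiable[OF assms(1)] assms(2)]
  by (simp add: o_def)

lemma partial_deriv_compose_linear:
  fixes L :: "'a::euclidean_space \<Rightarrow> 'b::euclidean_space"
  assumes "bounded_linear L" "\<And>x. \<phi> differentiable at x"
  shows "partial_deriv b (\<lambda>x. \<phi> (L x)) =
    (\<lambda>x. \<Sum>c\<in>Basis. complex_of_real (L b \<bullet> c) * partial_deriv c \<phi> (L x))"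
proof
  fix x
  have "((\<lambda>x. \<phi> (L x)) has_derivative (\<lambda>h. frechet_derivative \<phi> (at (L x)) (L h))) (at x)"
    using diff_chain_at[OF bounded_linear_imp_has_derivative[OF assms(1)]
        has_derivative_frechet[OF assms(2)[of "L x"]]] by (simp add: o_def)
  from partial_deriv_eqI[OF this, of b]
  show "partial_deriv b (\<lambda>x. \<phi> (L x)) x = (\<Sum>c\<in>Basis. complex_of_real (L b \<bullet> c) * partial_deriv c \<phi> (L x))"
    by (simp add: frechet_derivative_Basis_sum[OF assms(2)] scaleR_conv_of_real)
qed

lemma differentiable_upto_sum:
  "(\<And>i. i \<in> I \<Longrightarrow> differentiable_upto m (u i)) \<Longrightarrow> differentiable_upto m (\<lambda>x. \<Sum>i\<in>I. u i x)"
  by (induction I rule: infinite_finite_induct)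
    (auto simp: differentiable_upto_add differentiable_upto_const)

lemma smooth_compose_linear:
  fixes L :: "'a::euclidean_space \<Rightarrow> 'b::euclidean_space"
  assumes L: "bounded_linear L" and "smooth \<phi>"
  shows "smooth (\<lambda>x. \<phi> (L x))"
proof -
  have "differentiable_upto m \<phi> \<Longrightarrow> differentiable_upto m (\<lambda>x. \<phi> (L x))" for m
  proof (induction m arbitrary: \<phi>)
    case (Suc m)
    then show ?case
      by (auto simp: partial_deriv_compose_linear[OF L] differentiable_compose_linear[OF L]
          intro!: differentiable_upto_sum differentiable_upto_mult differentiable_upto_const)
  qed (simp add: differentiable_compose_linear[OF L])
  then show ?thesis using assms(2) by (simp add: smooth_iff_differentiable_upto)
qed

text \<open>By the chain rule a derivative of the composition combines derivatives of the outer
  function with the matrix entries of \<open>L\<close> as coefficients; these entries make up the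
  constant.\<close>

lemma jet_compose_linear:
  fixes L :: "'a::euclidean_space \<Rightarrow> 'b::euclidean_space"
  assumes L: "bounded_linear L"
  shows "\<exists>C\<ge>0. \<forall>\<phi> x. smooth \<phi> \<longrightarrow> jet m (\<lambda>x. \<phi> (L x)) x \<le> C * jet m \<phi> (L x)"
proof (induction m)
  case 0
  then show ?case by (intro exI[of _ 1]) auto
next
  case (Suc m)
  then obtain C where C: "C \<ge> 0" "\<And>\<phi> x. smooth \<phi> \<Longrightarrow> jet m (\<lambda>x. \<phi> (L x)) x \<le> C * jet m \<phi> (L x)"
    by blast
  let ?S = "\<Sum>b\<in>(Basis::'a set). \<Sum>c\<in>(Basis::'b set). \<bar>L b \<bullet> c\<bar> * C"
  show ?case
  proof (intro exI[of _ "1 + ?S"] conjI allI impI)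
    show "0 \<le> 1 + ?S" using C(1) by (intro add_nonneg_nonneg sum_nonneg) auto
    fix \<phi> :: "'b \<Rightarrow> complex" and x assume sm: "smooth \<phi>"
    have "jet m (\<lambda>x. \<Sum>c\<in>Basis. complex_of_real (L b \<bullet> c) * partial_deriv c \<phi> (L x)) x
        \<le> (\<Sum>c\<in>Basis. \<bar>L b \<bullet> c\<bar> * C) * jet (Suc m) \<phi> (L x)" for b
    proof -
      have "jet m (\<lambda>x. \<Sum>c\<in>Basis. complex_of_real (L b \<bullet> c) * partial_deriv c \<phi> (L x)) x
        \<le> (\<Sum>c\<in>Basis. jet m (\<lambda>x. complex_of_real (L b \<bullet> c) * partial_deriv c \<phi> (L x)) x)"
        using sm by (intro jet_sum smooth_cmult smooth_compose_linear[OF L] smooth_partial_deriv) auto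
      also have "\<dots> = (\<Sum>c\<in>Basis. \<bar>L b \<bullet> c\<bar> * jet m (\<lambda>x. partial_deriv c \<phi> (L x)) x)"
        using sm by (intro sum.cong refl)
          (simp add: jet_cmult smooth_compose_linear[OF L] smooth_partial_deriv)
      also have "\<dots> \<le> (\<Sum>c\<in>Basis. \<bar>L b \<bullet> c\<bar> * (C * jet (Suc m) \<phi> (L x)))"
      proof (intro sum_mono mult_left_mono)
        fix c :: 'b assume c: "c \<in> Basis"
        have "jet m (\<lambda>x. partial_deriv c \<phi> (L x)) x \<le> C * jet m (partial_deriv c \<phi>) (L x)"
          using sm c by (intro C(2) smooth_partial_deriv)
        also have "\<dots> \<le> C * jet (Suc m) \<phi> (L x)"
          using c C(1) by (intro mult_left_mono jet_partial_deriv_le)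
        finally show "jet m (\<lambda>x. partial_deriv c \<phi> (L x)) x \<le> C * jet (Suc m) \<phi> (L x)" .
      qed simp
      finally show ?thesis by (simp add: sum_distrib_right mult.assoc)
    qed
    then have "(\<Sum>b\<in>Basis. jet m (\<lambda>x. \<Sum>c\<in>Basis. complex_of_real (L b \<bullet> c) * partial_deriv c \<phi> (L x)) x)
       \<le> ?S * jet (Suc m) \<phi> (L x)"
      unfolding sum_distrib_right[of "\<lambda>b. \<Sum>c\<in>(Basis::'b set). \<bar>L b \<bullet> c\<bar> * C"] by (intro sum_mono)
    moreover have "norm (\<phi> (L x)) \<le> jet (Suc m) \<phi> (L x)" by (rule norm_le_jet)
    ultimately show "jet (Suc m) (\<lambda>x. \<phi> (L x)) x \<le> (1 + ?S) * jet (Suc m) \<phi> (L x)"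
      using sm by (simp only: jet.simps(2)[of m "\<lambda>x. \<phi> (L x)"] partial_deriv_compose_linear[OF L]
          smooth_differentiable distrib_right mult_1 add_mono)
  qed
qed

lemma differentiable_translate:
  fixes \<phi> :: "'a::euclidean_space \<Rightarrow> complex"
  assumes "\<And>x. \<phi> differentiable at x"
  shows "(\<lambda>x. \<phi> (x - a)) differentiable at x"
  using differentiable_chain_at[of "\<lambda>x. x - a" x \<phi>] assms by (simp add: o_def)

lemma partial_deriv_translate:
  assumes "\<And>x. \<phi> differentiable at x"
  shows "partial_deriv b (\<lambda>x. \<phi> (x - a)) = (\<lambda>x. partial_deriv b \<phi> (x - a))"
proof
  fix x
  have "((\<lambda>x. x - a) has_derivative (\<lambda>h. h)) (at x)" by (auto intro!: derivative_eq_intros)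
  from diff_chain_at[OF this has_derivative_frechet[OF assms[of "x - a"]]]
  have "((\<lambda>x. \<phi> (x - a)) has_derivative (\<lambda>h. frechet_derivative \<phi> (at (x - a)) h)) (at x)"
    by (simp add: o_def)
  from partial_deriv_eqI[OF this, of b]
  show "partial_deriv b (\<lambda>x. \<phi> (x - a)) x = partial_deriv b \<phi> (x - a)"
    by (simp add: partial_deriv_def)
qed

lemma smooth_translate: "smooth \<phi> \<Longrightarrow> smooth (\<lambda>x. \<phi> (x - a))"
proof (rule smooth_coinduct[of "\<lambda>\<psi>. \<exists>\<phi>. smooth \<phi> \<and> \<psi> = (\<lambda>x. \<phi> (x - a))"])
  show "\<And>\<psi> x. \<exists>\<phi>. smooth \<phi> \<and> \<psi> = (\<lambda>x. \<phi> (x - a)) \<Longrightarrow> \<psi> differentiable at x"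
    using differentiable_translate smooth_differentiable by blast
  show "\<exists>\<phi>. smooth \<phi> \<and> \<psi> = (\<lambda>x. \<phi> (x - a)) \<Longrightarrow> b \<in> Basis \<Longrightarrow>
      \<exists>\<phi>. smooth \<phi> \<and> partial_deriv b \<psi> = (\<lambda>x. \<phi> (x - a))" for \<psi> b
    using partial_deriv_translate smooth_differentiable smooth_partial_deriv by blast
qed auto

lemma jet_translate: "smooth \<phi> \<Longrightarrow> jet m (\<lambda>x. \<phi> (x - a)) x = jet m \<phi> (x - a)"
  by (induction m arbitrary: \<phi>)
    (auto simp: partial_deriv_translate smooth_differentiable smooth_partial_deriv)

lemma differentiable_cnj: "(\<And>x. \<phi> differentiable at x) \<Longrightarrow> (\<lambda>x. cnj (\<phi> x)) differentiable at x"
  using differentiable_chain_at[OF _ bounded_linear_imp_differentiable[OF bounded_linear_cnj], of \<phi> x]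
  by (simp add: o_def)

lemma partial_deriv_cnj:
  assumes "\<And>x. \<phi> differentiable at x"
  shows "partial_deriv b (\<lambda>x. cnj (\<phi> x)) = (\<lambda>x. cnj (partial_deriv b \<phi> x))"
proof
  fix x
  have "((\<lambda>x. cnj (\<phi> x)) has_derivative (\<lambda>h. cnj (frechet_derivative \<phi> (at x) h))) (at x)"
    by (intro has_derivative_frechet has_derivative_cnj assms)
  from partial_deriv_eqI[OF this, of b]
  show "partial_deriv b (\<lambda>x. cnj (\<phi> x)) x = cnj (partial_deriv b \<phi> x)"
    by (simp add: partial_deriv_def)
qed

lemma smooth_cnj: "smooth \<phi> \<Longrightarrow> smooth (\<lambda>x. cnj (\<phi> x))"
proof (rule smooth_coinduct[of "\<lambda>\<psi>. \<exists>\<phi>. smooth \<phi> \<and> \<psi> = (\<lambda>x. cnj (\<phi> x))"])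
  show "\<And>\<psi> x. \<exists>\<phi>. smooth \<phi> \<and> \<psi> = (\<lambda>x. cnj (\<phi> x)) \<Longrightarrow> \<psi> differentiable at x"
    using differentiable_cnj smooth_differentiable by blast
  show "\<exists>\<phi>. smooth \<phi> \<and> \<psi> = (\<lambda>x. cnj (\<phi> x)) \<Longrightarrow> b \<in> Basis \<Longrightarrow>
      \<exists>\<phi>. smooth \<phi> \<and> partial_deriv b \<psi> = (\<lambda>x. cnj (\<phi> x))" for \<psi> b
    using partial_deriv_cnj smooth_differentiable smooth_partial_deriv by blast
qed auto

lemma jet_cnj: "smooth \<phi> \<Longrightarrow> jet m (\<lambda>x. cnj (\<phi> x)) x = jet m \<phi> x"
  by (induction m arbitrary: \<phi>)
    (auto simp: partial_deriv_cnj smooth_differentiable smooth_partial_deriv)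

section \<open>The Schwartz space\<close>

lemma partial_derivs_le_jet:
  "bs \<in> lists Basis \<Longrightarrow> length bs \<le> m \<Longrightarrow> norm (partial_derivs bs \<phi> x) \<le> jet m \<phi> x"
proof (induction bs arbitrary: \<phi> m rule: rev_induct)
  case (snoc b bs)
  then obtain m' where m: "m = Suc m'" by (cases m) auto
  have "norm (partial_derivs bs (partial_deriv b \<phi>) x) \<le> jet m' (partial_deriv b \<phi>) x"
    using snoc m by auto
  also have "\<dots> \<le> jet m \<phi> x" unfolding m using snoc.prems by (intro jet_partial_deriv_le) auto
  finally show ?case by simp
qed (simp add: norm_le_jet)

text \<open>In dimension d there are at most \<open>(1 + d) ^ m\<close> lists of at most
  \<open>m\<close> directions, which is where the factor comes from.\<close>

lemma jet_le_partial_derivs: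
  fixes \<phi> :: "'a::euclidean_space \<Rightarrow> complex"
  assumes "\<And>bs. bs \<in> lists Basis \<Longrightarrow> length bs \<le> m \<Longrightarrow> norm (partial_derivs bs \<phi> x) \<le> c"
  shows "jet m \<phi> x \<le> (1 + real DIM('a)) ^ m * c"
  using assms
proof (induction m arbitrary: \<phi>)
  case 0
  then show ?case using 0[of "[]"] by simp
next
  case (Suc m)
  have "norm (\<phi> x) \<le> c" using Suc.prems[of "[]"] by simp
  then have c: "0 \<le> c" by (meson norm_ge_zero order_trans)
  have "jet m (partial_deriv b \<phi>) x \<le> (1 + real DIM('a)) ^ m * c" if b: "b \<in> Basis" for b
  proof (rule Suc.IH)
    fix bs assume "bs \<in> lists (Basis::'a set)" "length bs \<le> m"
    then show "norm (partial_derivs bs (partial_deriv b \<phi>) x) \<le> c"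
      using Suc.prems[of "bs @ [b]"] b by simp
  qed
  then have "(\<Sum>b\<in>Basis. jet m (partial_deriv b \<phi>) x) \<le> real DIM('a) * ((1 + real DIM('a)) ^ m * c)"
    by (intro sum_bounded_above) auto
  moreover have "norm (\<phi> x) \<le> (1 + real DIM('a)) ^ m * c"
    using \<open>norm (\<phi> x) \<le> c\<close> c mult_right_mono[OF one_le_power[of "1 + real DIM('a)" m] c] by simp
  ultimately show ?case by (simp add: algebra_simps)
qed

lemma finite_multi_indices: "finite {bs \<in> lists (Basis::'a::euclidean_space set). length bs \<le> m}"
proof -
  have "{bs \<in> lists (Basis::'a set). length bs \<le> m} = {bs. set bs \<subseteq> Basis \<and> length bs \<le> m}"
    by auto
  then show ?thesis by (simp add: finite_lists_length_le)
qed

text \<open>The criterion behind the later membership proofs. The forward direction adds up the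
  bounds for the single multi-indices, of which only finitely many have length at most
  \<open>m\<close>.\<close>

lemma schwartz_iff:
  fixes \<phi> :: "'a::euclidean_space \<Rightarrow> complex"
  shows "\<phi> \<in> schwartz \<longleftrightarrow> smooth \<phi> \<and> (\<forall>k m. \<exists>c. \<forall>x. (1 + norm x) ^ k * jet m \<phi> x \<le> c)"
proof (intro iffI conjI allI)
  assume \<phi>: "\<phi> \<in> schwartz"
  then show "smooth \<phi>" by (simp add: schwartz_def)
  fix k m
  let ?M = "{bs \<in> lists (Basis::'a set). length bs \<le> m}"
  have "\<forall>bs\<in>?M. \<exists>c. \<forall>x. (1 + norm x) ^ k * norm (partial_derivs bs \<phi> x) \<le> c"
  proof
    fix bs assume "bs \<in> ?M"
    then have "bounded (range (\<lambda>x. (1 + norm x) ^ k *\<^sub>R partial_derivs bs \<phi> x))"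
      using \<phi> by (simp add: schwartz_def)
    then show "\<exists>c. \<forall>x. (1 + norm x) ^ k * norm (partial_derivs bs \<phi> x) \<le> c"
      by (auto simp: bounded_iff norm_power)
  qed
  then obtain c where c: "\<And>bs x. bs \<in> ?M \<Longrightarrow> (1 + norm x) ^ k * norm (partial_derivs bs \<phi> x) \<le> c bs"
    by metis
  have c0: "0 \<le> c bs" if "bs \<in> ?M" for bs
    by (rule order_trans[OF _ c[OF that, of 0]]) simp
  define d where "d = (\<Sum>bs\<in>?M. c bs)"
  have "(1 + norm x) ^ k * jet m \<phi> x \<le> (1 + real DIM('a)) ^ m * d" for x
  proof -
    have pos: "0 < (1 + norm x) ^ k" by (simp add: add_pos_nonneg)
    have "norm (partial_derivs bs \<phi> x) \<le> d / (1 + norm x) ^ k" if "bs \<in> lists Basis" "length bs \<le> m" for bs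
    proof -
      have bs: "bs \<in> ?M" using that by blast
      have "c bs \<le> d"
        unfolding d_def by (rule member_le_sum[OF bs _ finite_multi_indices]) (use c0 in blast)
      with c[OF bs, of x] have "(1 + norm x) ^ k * norm (partial_derivs bs \<phi> x) \<le> d" by (rule order_trans)
      then show ?thesis using pos by (simp add: pos_le_divide_eq mult.commute)
    qed
    then have "jet m \<phi> x \<le> (1 + real DIM('a)) ^ m * (d / (1 + norm x) ^ k)"
      by (rule jet_le_partial_derivs)
    then show ?thesis using pos by (simp add: pos_le_divide_eq mult.commute)
  qed
  then show "\<exists>c. \<forall>x. (1 + norm x) ^ k * jet m \<phi> x \<le> c" by blast
next
  assume *: "smooth \<phi> \<and> (\<forall>k m. \<exists>c. \<forall>x. (1 + norm x) ^ k * jet m \<phi> x \<le> c)"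
  have "bounded (range (\<lambda>x. (1 + norm x) ^ k *\<^sub>R partial_derivs bs \<phi> x))" if bs: "bs \<in> lists Basis" for k bs
  proof -
    from * obtain c where c: "\<And>x. (1 + norm x) ^ k * jet (length bs) \<phi> x \<le> c" by blast
    have "norm ((1 + norm x) ^ k *\<^sub>R partial_derivs bs \<phi> x) \<le> c" for x
    proof -
      have "(1 + norm x) ^ k * norm (partial_derivs bs \<phi> x) \<le> (1 + norm x) ^ k * jet (length bs) \<phi> x"
        using bs by (intro mult_left_mono partial_derivs_le_jet) auto
      with c[of x] show ?thesis by (simp add: norm_power)
    qed
    then show ?thesis by (auto simp: bounded_iff)
  qed
  with * show "\<phi> \<in> schwartz" by (simp add: schwartz_def)
qed

lemma schwartz_smooth: "\<phi> \<in> schwartz \<Longrightarrow> smooth \<phi>"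
  by (simp add: schwartz_def)

text \<open>Equivalent to \<open>schwartz_seminorm\<close> up to the factor
  \<open>(1 + real DIM('a)) ^ m\<close>, but a supremum over the point alone, so that pointwise jet
  estimates pass to it directly. The supremum is a real one and is informative only for bounded
  sets, as it is for Schwartz functions.\<close>

definition jet_seminorm :: "nat \<Rightarrow> nat \<Rightarrow> ('a::euclidean_space \<Rightarrow> complex) \<Rightarrow> real" where
  "jet_seminorm k m \<phi> = (SUP x. (1 + norm x) ^ k * jet m \<phi> x)"

lemma jet_seminorm_upper:
  assumes "\<phi> \<in> schwartz" shows "(1 + norm x) ^ k * jet m \<phi> x \<le> jet_seminorm k m \<phi>"
  unfolding jet_seminorm_def
  by (rule cSUP_upper) (use assms in \<open>auto simp: schwartz_iff bdd_above_def\<close>)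

lemma jet_seminorm_least:
  "(\<And>x. (1 + norm x) ^ k * jet m \<phi> x \<le> c) \<Longrightarrow> jet_seminorm k m \<phi> \<le> c"
  unfolding jet_seminorm_def by (rule cSUP_least) auto

lemma jet_seminorm_nonneg: "\<phi> \<in> schwartz \<Longrightarrow> 0 \<le> jet_seminorm k m \<phi>"
  by (rule order_trans[OF _ jet_seminorm_upper[of _ 0]]) auto

lemma weight_pos [simp]: "0 < (1 + norm (x::'a::real_normed_vector)) ^ k"
  by (simp add: add_pos_nonneg)

lemma weight_nonneg [simp]: "0 \<le> (1 + norm (x::'a::real_normed_vector)) ^ k"
  by simp

lemma jet_decay:
  assumes "\<phi> \<in> schwartz" shows "jet m \<phi> x \<le> jet_seminorm k m \<phi> / (1 + norm x) ^ k"
  using jet_seminorm_upper[OF assms, of x k m]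
  by (simp add: pos_le_divide_eq mult.commute)

lemma jet_seminorm_mono:
  assumes "\<phi> \<in> schwartz" "k \<le> k'" "m \<le> m'"
  shows "jet_seminorm k m \<phi> \<le> jet_seminorm k' m' \<phi>"
proof (rule jet_seminorm_least)
  fix x
  have "(1 + norm x) ^ k * jet m \<phi> x \<le> (1 + norm x) ^ k' * jet m' \<phi> x"
    using assms by (intro mult_mono power_increasing jet_mono) auto
  also have "\<dots> \<le> jet_seminorm k' m' \<phi>" by (rule jet_seminorm_upper[OF assms(1)])
  finally show "(1 + norm x) ^ k * jet m \<phi> x \<le> jet_seminorm k' m' \<phi>" .
qed

lemma schwartz_seminorm_le_jet_seminorm:
  assumes "\<phi> \<in> schwartz" shows "schwartz_seminorm k m \<phi> \<le> jet_seminorm k m \<phi>"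
  unfolding schwartz_seminorm_def
proof (rule cSUP_least)
  show "UNIV \<times> {bs \<in> lists Basis. length bs \<le> m} \<noteq> {}" by (auto intro: exI[of _ "[]"])
  fix z :: "'a \<times> 'a list" assume "z \<in> UNIV \<times> {bs \<in> lists Basis. length bs \<le> m}"
  then obtain x bs where z: "z = (x, bs)" "bs \<in> lists Basis" "length bs \<le> m" by (cases z) auto
  have "(1 + norm x) ^ k * norm (partial_derivs bs \<phi> x) \<le> (1 + norm x) ^ k * jet m \<phi> x"
    using z by (intro mult_left_mono partial_derivs_le_jet) auto
  also have "\<dots> \<le> jet_seminorm k m \<phi>" by (rule jet_seminorm_upper[OF assms])
  finally show "(case z of (x, bs) \<Rightarrow> (1 + norm x) ^ k * norm (partial_derivs bs \<phi> x)) \<le> jet_seminorm k m \<phi>"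
    by (simp add: z)
qed

lemma jet_seminorm_le_schwartz_seminorm:
  fixes \<phi> :: "'a::euclidean_space \<Rightarrow> complex"
  assumes "\<phi> \<in> schwartz"
  shows "jet_seminorm k m \<phi> \<le> (1 + real DIM('a)) ^ m * schwartz_seminorm k m \<phi>"
proof (rule jet_seminorm_least)
  fix x :: 'a
  let ?I = "(UNIV :: 'a set) \<times> {bs \<in> lists (Basis::'a set). length bs \<le> m}"
  let ?f = "\<lambda>(x::'a, bs). (1 + norm x) ^ k * norm (partial_derivs bs \<phi> x)"
  \<comment> \<open>The supremum is real-valued, so boundedness has to be known before a single term
    can be compared with it.\<close>
  have bdd: "bdd_above (?f ` ?I)"
  proof (rule bdd_aboveI2)
    fix z assume "z \<in> ?I"
    then obtain x bs where z: "z = (x, bs)" "bs \<in> lists Basis" "length bs \<le> m" by (cases z) auto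
    have "(1 + norm x) ^ k * norm (partial_derivs bs \<phi> x) \<le> (1 + norm x) ^ k * jet m \<phi> x"
      using z by (intro mult_left_mono partial_derivs_le_jet) auto
    also have "\<dots> \<le> jet_seminorm k m \<phi>" by (rule jet_seminorm_upper[OF assms])
    finally show "?f z \<le> jet_seminorm k m \<phi>" by (simp add: z)
  qed
  have "norm (partial_derivs bs \<phi> x) \<le> schwartz_seminorm k m \<phi> / (1 + norm x) ^ k"
    if "bs \<in> lists Basis" "length bs \<le> m" for bs
  proof -
    have "(1 + norm x) ^ k * norm (partial_derivs bs \<phi> x) \<le> schwartz_seminorm k m \<phi>"
      unfolding schwartz_seminorm_def using that cSUP_upper[OF _ bdd, of "(x, bs)"] by auto
    then show ?thesis by (simp add: pos_le_divide_eq mult.commute)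
  qed
  from jet_le_partial_derivs[OF this]
  show "(1 + norm x) ^ k * jet m \<phi> x \<le> (1 + real DIM('a)) ^ m * schwartz_seminorm k m \<phi>"
    by (simp add: pos_le_divide_eq mult.commute)
qed

lemma tempered_bound:
  assumes "T \<in> tempered_distributions"
  obtains k m C where "C \<ge> 0" "\<And>\<phi>. \<phi> \<in> schwartz \<Longrightarrow> norm (T \<phi>) \<le> C * jet_seminorm k m \<phi>"
proof -
  from assms obtain k m C where C: "\<And>\<phi>. \<phi> \<in> schwartz \<Longrightarrow> norm (T \<phi>) \<le> C * schwartz_seminorm k m \<phi>"
    unfolding tempered_distributions_def by blast
  have "norm (T \<phi>) \<le> \<bar>C\<bar> * jet_seminorm k m \<phi>" if \<phi>: "\<phi> \<in> schwartz" for \<phi>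
  proof -
    \<comment> \<open>The definition puts no sign on \<open>C\<close>. Replacing it by its absolute
      value requires a nonnegative seminorm, and nonnegativity is inherited from
      \<open>jet_seminorm\<close> through the comparison.\<close>
    have s: "0 \<le> schwartz_seminorm k m \<phi>"
      by (rule mult_left_le_imp_le[of "(1 + real DIM('a)) ^ m"])
        (use order_trans[OF jet_seminorm_nonneg[OF \<phi>, of k m] jet_seminorm_le_schwartz_seminorm[OF \<phi>]] in \<open>simp_all add: add_pos_nonneg\<close>)
    have "norm (T \<phi>) \<le> C * schwartz_seminorm k m \<phi>" by (rule C[OF \<phi>])
    also have "\<dots> \<le> \<bar>C\<bar> * schwartz_seminorm k m \<phi>" using s by (intro mult_right_mono) auto
    also have "\<dots> \<le> \<bar>C\<bar> * jet_seminorm k m \<phi>"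
      by (intro mult_left_mono schwartz_seminorm_le_jet_seminorm \<phi>) auto
    finally show ?thesis .
  qed
  then show ?thesis using that[of "\<bar>C\<bar>"] by auto
qed

lemma temperedI:
  fixes T :: "'a::euclidean_space functional"
  assumes "\<And>\<phi>. \<phi> \<notin> schwartz \<Longrightarrow> T \<phi> = 0"
    and "\<And>\<phi> \<psi> a b. \<phi> \<in> schwartz \<Longrightarrow> \<psi> \<in> schwartz \<Longrightarrow> T (\<lambda>x. a * \<phi> x + b * \<psi> x) = a * T \<phi> + b * T \<psi>"
    and "C \<ge> 0" and "\<And>\<phi>. \<phi> \<in> schwartz \<Longrightarrow> norm (T \<phi>) \<le> C * jet_seminorm k m \<phi>"
  shows "T \<in> tempered_distributions"
proof -
  have "norm (T \<phi>) \<le> (C * (1 + real DIM('a)) ^ m) * schwartz_seminorm k m \<phi>" if \<phi>: "\<phi> \<in> schwartz" for \<phi>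
    using assms(4)[OF \<phi>] mult_left_mono[OF jet_seminorm_le_schwartz_seminorm[OF \<phi>, of k m] assms(3)]
    by (simp add: mult.assoc)
  then show ?thesis using assms(1,2) unfolding tempered_distributions_def by blast
qed

section \<open>Linear combinations of test functions\<close>

lemma tempered_linear:
  "T \<in> tempered_distributions \<Longrightarrow> \<phi> \<in> schwartz \<Longrightarrow> \<psi> \<in> schwartz \<Longrightarrow>
    T (\<lambda>x. a * \<phi> x + b * \<psi> x) = a * T \<phi> + b * T \<psi>"
  by (auto simp: tempered_distributions_def)

lemma schwartz_of_bound:
  assumes "smooth \<psi>" "\<And>k m x. (1 + norm x) ^ k * jet m \<psi> x \<le> c k m"
  shows "\<psi> \<in> schwartz"
  unfolding schwartz_iff using assms by blast

lemma schwartz_lincomb: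
  assumes "\<phi> \<in> schwartz" "\<psi> \<in> schwartz"
  shows "(\<lambda>x. a * \<phi> x + b * \<psi> x) \<in> schwartz"
    and "jet_seminorm k m (\<lambda>x. a * \<phi> x + b * \<psi> x) \<le> norm a * jet_seminorm k m \<phi> + norm b * jet_seminorm k m \<psi>"
proof -
  have sm: "smooth \<phi>" "smooth \<psi>" using assms by (simp_all add: schwartz_smooth)
  have *: "(1 + norm x) ^ k * jet m (\<lambda>x. a * \<phi> x + b * \<psi> x) x
      \<le> norm a * jet_seminorm k m \<phi> + norm b * jet_seminorm k m \<psi>" for k m x
  proof -
    have "(1 + norm x) ^ k * jet m (\<lambda>x. a * \<phi> x + b * \<psi> x) x
        \<le> (1 + norm x) ^ k * (norm a * jet m \<phi> x + norm b * jet m \<psi> x)"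
      using sm jet_add[OF smooth_cmult smooth_cmult, OF sm, of m a b x]
      by (intro mult_left_mono) (auto simp: jet_cmult)
    also have "\<dots> = norm a * ((1 + norm x) ^ k * jet m \<phi> x) + norm b * ((1 + norm x) ^ k * jet m \<psi> x)"
      by (simp add: algebra_simps)
    also have "\<dots> \<le> norm a * jet_seminorm k m \<phi> + norm b * jet_seminorm k m \<psi>"
      by (intro add_mono mult_left_mono jet_seminorm_upper assms) auto
    finally show ?thesis .
  qed
  show "(\<lambda>x. a * \<phi> x + b * \<psi> x) \<in> schwartz"
    by (rule schwartz_of_bound[OF smooth_add[OF smooth_cmult smooth_cmult] *]) (rule sm)+
  show "jet_seminorm k m (\<lambda>x. a * \<phi> x + b * \<psi> x) \<le> norm a * jet_seminorm k m \<phi> + norm b * jet_seminorm k m \<psi>"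
    by (rule jet_seminorm_least[OF *])
qed

lemma schwartz_zero [simp]: "(\<lambda>x. 0) \<in> schwartz"
  by (simp add: schwartz_iff jet_const exI[of _ 0])

lemma schwartz_cmult: "\<phi> \<in> schwartz \<Longrightarrow> (\<lambda>x. a * \<phi> x) \<in> schwartz"
  using schwartz_lincomb(1)[of \<phi> \<phi> a 0] by simp

lemma schwartz_add: "\<phi> \<in> schwartz \<Longrightarrow> \<psi> \<in> schwartz \<Longrightarrow> (\<lambda>x. \<phi> x + \<psi> x) \<in> schwartz"
  using schwartz_lincomb(1)[of \<phi> \<psi> 1 1] by simp

lemma schwartz_diff: "\<phi> \<in> schwartz \<Longrightarrow> \<psi> \<in> schwartz \<Longrightarrow> (\<lambda>x. \<phi> x - \<psi> x) \<in> schwartz"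
  using schwartz_lincomb(1)[of \<phi> \<psi> 1 "-1"] by simp

lemma schwartz_sum: "(\<And>i. i \<in> I \<Longrightarrow> u i \<in> schwartz) \<Longrightarrow> (\<lambda>x. \<Sum>i\<in>I. u i x) \<in> schwartz"
  by (induction I rule: infinite_finite_induct) (auto intro: schwartz_add)

lemma tempered_zero: "T \<in> tempered_distributions \<Longrightarrow> T (\<lambda>x. 0) = 0"
  using tempered_linear[of T "\<lambda>x. 0" "\<lambda>x. 0" 0 0] by simp

lemma tempered_cmult: "T \<in> tempered_distributions \<Longrightarrow> \<phi> \<in> schwartz \<Longrightarrow> T (\<lambda>x. a * \<phi> x) = a * T \<phi>"
  using tempered_linear[of T \<phi> \<phi> a 0] by simp

lemma tempered_diff:
  "T \<in> tempered_distributions \<Longrightarrow> \<phi> \<in> schwartz \<Longrightarrow> \<psi> \<in> schwartz \<Longrightarrow> T (\<lambda>x. \<phi> x - \<psi> x) = T \<phi> - T \<psi>"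
  using tempered_linear[of T \<phi> \<psi> 1 "-1"] by simp

lemma tempered_sum:
  assumes "T \<in> tempered_distributions" "\<And>i. i \<in> I \<Longrightarrow> u i \<in> schwartz"
  shows "T (\<lambda>x. \<Sum>i\<in>I. c i * u i x) = (\<Sum>i\<in>I. c i * T (u i))"
  using assms(2)
proof (induction I rule: infinite_finite_induct)
  case (insert i I)
  have "T (\<lambda>x. c i * u i x + 1 * (\<Sum>i\<in>I. c i * u i x)) = c i * T (u i) + 1 * T (\<lambda>x. \<Sum>i\<in>I. c i * u i x)"
    using insert by (intro tempered_linear assms(1) schwartz_sum schwartz_cmult) auto
  with insert show ?case by simp
qed (simp_all add: tempered_zero assms(1))

text \<open>Multiplication by a function whose jet grows like the power \<open>K\<close> of the
  weight costs \<open>K\<close> powers of decay and no derivatives. The constant is uniform in the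
  multiplier, so families such as linear forms, plane waves and chirps are treated at once.\<close>

lemma schwartz_multiplier:
  "\<exists>C\<ge>0. \<forall>\<theta> \<phi>::'a::euclidean_space \<Rightarrow> complex. \<forall>A K. smooth \<theta> \<longrightarrow> (\<forall>x. jet m \<theta> x \<le> A * (1 + norm x) ^ K) \<longrightarrow> \<phi> \<in> schwartz \<longrightarrow>
     (\<forall>x. (1 + norm x) ^ k * jet m (\<lambda>x. \<theta> x * \<phi> x) x \<le> C * A * jet_seminorm (k + K) m \<phi>)"
proof -
  obtain C where C: "C \<ge> 0" "\<And>\<phi> \<psi>::'a \<Rightarrow> complex. \<And>x. smooth \<phi> \<Longrightarrow> smooth \<psi> \<Longrightarrow>
     jet m (\<lambda>x. \<phi> x * \<psi> x) x \<le> C * (jet m \<phi> x * jet m \<psi> x)"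
    using jet_mult[of m, where 'a='a] by blast
  have "(1 + norm x) ^ k * jet m (\<lambda>x. \<theta> x * \<phi> x) x \<le> C * A * jet_seminorm (k + K) m \<phi>"
    if sm: "smooth \<theta>" and A: "\<And>x. jet m \<theta> x \<le> A * (1 + norm x) ^ K" and \<phi>: "\<phi> \<in> schwartz"
    for \<theta> \<phi> :: "'a \<Rightarrow> complex" and A K x
  proof -
    have "0 \<le> A" using order_trans[OF jet_nonneg A[of 0]] by simp
    have "(1 + norm x) ^ k * jet m (\<lambda>x. \<theta> x * \<phi> x) x \<le> (1 + norm x) ^ k * (C * (A * (1 + norm x) ^ K * jet m \<phi> x))"
      using C(2)[OF sm schwartz_smooth[OF \<phi>], of x]
      by (intro mult_left_mono order_trans[OF C(2)[OF sm schwartz_smooth[OF \<phi>], of x]] mult_right_mono A C(1)) auto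
    also have "\<dots> = C * A * ((1 + norm x) ^ (k + K) * jet m \<phi> x)" by (simp add: power_add algebra_simps)
    also have "\<dots> \<le> C * A * jet_seminorm (k + K) m \<phi>"
      using C(1) \<open>0 \<le> A\<close> by (intro mult_left_mono jet_seminorm_upper \<phi>) auto
    finally show ?thesis .
  qed
  then show ?thesis using C(1) by blast
qed

lemma schwartz_mult:
  fixes \<phi> \<psi> :: "'a::euclidean_space \<Rightarrow> complex"
  assumes "\<phi> \<in> schwartz" "\<psi> \<in> schwartz" shows "(\<lambda>x. \<phi> x * \<psi> x) \<in> schwartz"
  unfolding schwartz_iff
proof (intro conjI allI)
  show "smooth (\<lambda>x. \<phi> x * \<psi> x)" using assms by (intro smooth_mult schwartz_smooth)
  fix k m
  obtain C where C: "\<And>\<theta> \<phi>::'a \<Rightarrow> complex. \<And>A K x. smooth \<theta> \<Longrightarrow> (\<forall>x. jet m \<theta> x \<le> A * (1 + norm x) ^ K) \<Longrightarrow>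
      \<phi> \<in> schwartz \<Longrightarrow> (1 + norm x) ^ k * jet m (\<lambda>x. \<theta> x * \<phi> x) x \<le> C * A * jet_seminorm (k + K) m \<phi>"
    using schwartz_multiplier[of m k, where 'a='a] by blast
  have "jet m \<phi> x \<le> jet_seminorm 0 m \<phi> * (1 + norm x) ^ 0" for x
    using jet_seminorm_upper[OF assms(1), of x 0 m] by simp
  then show "\<exists>c. \<forall>x. (1 + norm x) ^ k * jet m (\<lambda>x. \<phi> x * \<psi> x) x \<le> c"
    using C[OF schwartz_smooth[OF assms(1)] _ assms(2), of _ 0] by blast
qed

text \<open>Peetre's inequality: the weight is submultiplicative, so a translation by
  \<open>a\<close> costs a power of \<open>1 + norm a\<close>.\<close>

lemma weight_translate: "1 + norm x \<le> (1 + norm (x - a)) * (1 + norm (a::'a::real_normed_vector))"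
proof -
  have "norm x \<le> norm (x - a) + norm a" using norm_triangle_sub[of x a] by linarith
  moreover have "0 \<le> norm a * norm (x - a)" by simp
  moreover have "(1 + norm (x - a)) * (1 + norm a) = 1 + norm (x - a) + norm a + norm a * norm (x - a)"
    by (simp add: algebra_simps)
  ultimately show ?thesis by linarith
qed

lemma schwartz_translate:
  assumes "\<phi> \<in> schwartz"
  shows "(\<lambda>x. \<phi> (x - a)) \<in> schwartz"
    and "jet_seminorm k m (\<lambda>x. \<phi> (x - a)) \<le> (1 + norm a) ^ k * jet_seminorm k m \<phi>"
proof -
  have *: "(1 + norm x) ^ k * jet m (\<lambda>x. \<phi> (x - a)) x \<le> (1 + norm a) ^ k * jet_seminorm k m \<phi>" for k m x
  proof -
    have "(1 + norm x) ^ k * jet m (\<lambda>x. \<phi> (x - a)) x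
        \<le> ((1 + norm (x - a)) * (1 + norm a)) ^ k * jet m \<phi> (x - a)"
      by (simp only: jet_translate[OF schwartz_smooth[OF assms]])
        (intro mult_right_mono power_mono weight_translate jet_nonneg add_nonneg_nonneg norm_ge_zero zero_le_one)
    also have "\<dots> = (1 + norm a) ^ k * ((1 + norm (x - a)) ^ k * jet m \<phi> (x - a))"
      by (simp add: power_mult_distrib)
    also have "\<dots> \<le> (1 + norm a) ^ k * jet_seminorm k m \<phi>"
      by (intro mult_left_mono jet_seminorm_upper assms) auto
    finally show ?thesis .
  qed
  show "(\<lambda>x. \<phi> (x - a)) \<in> schwartz"
    by (rule schwartz_of_bound[OF smooth_translate[OF schwartz_smooth[OF assms]] *])
  show "jet_seminorm k m (\<lambda>x. \<phi> (x - a)) \<le> (1 + norm a) ^ k * jet_seminorm k m \<phi>"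
    by (rule jet_seminorm_least[OF *])
qed

lemma schwartz_cnj: "\<phi> \<in> schwartz \<Longrightarrow> (\<lambda>x. cnj (\<phi> x)) \<in> schwartz"
  by (auto simp: schwartz_iff smooth_cnj jet_cnj)

lemma jet_seminorm_partial_deriv:
  assumes "\<phi> \<in> schwartz" "b \<in> Basis"
  shows "partial_deriv b \<phi> \<in> schwartz" "jet_seminorm k m (partial_deriv b \<phi>) \<le> jet_seminorm k (Suc m) \<phi>"
proof -
  have *: "(1 + norm x) ^ k * jet m (partial_deriv b \<phi>) x \<le> jet_seminorm k (Suc m) \<phi>" for k m x
    by (rule order_trans[OF mult_left_mono[OF jet_partial_deriv_le[OF assms(2)]] jet_seminorm_upper[OF assms(1)]]) auto
  show "partial_deriv b \<phi> \<in> schwartz"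
    by (rule schwartz_of_bound[OF smooth_partial_deriv[OF schwartz_smooth[OF assms(1)] assms(2)] *])
  show "jet_seminorm k m (partial_deriv b \<phi>) \<le> jet_seminorm k (Suc m) \<phi>"
    by (rule jet_seminorm_least[OF *])
qed

text \<open>An isometry preserves the weight, so only the chain rule contributes a constant. The
  maps in view are the reflection and the symplectic rotation.\<close>

lemma schwartz_compose_isometry:
  fixes L :: "'a::euclidean_space \<Rightarrow> 'b::euclidean_space"
  assumes L: "bounded_linear L" and iso: "\<And>x. norm (L x) = norm x"
  shows "\<exists>C\<ge>0. \<forall>\<phi>\<in>schwartz. jet_seminorm k m (\<lambda>x. \<phi> (L x)) \<le> C * jet_seminorm k m \<phi>"
    and "\<phi> \<in> schwartz \<Longrightarrow> (\<lambda>x. \<phi> (L x)) \<in> schwartz"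
proof -
  have *: "\<exists>C\<ge>0. \<forall>\<phi>\<in>schwartz. \<forall>x. (1 + norm x) ^ k * jet m (\<lambda>x. \<phi> (L x)) x \<le> C * jet_seminorm k m \<phi>" for k m
  proof -
    obtain C where C: "C \<ge> 0" "\<And>\<phi> x. smooth \<phi> \<Longrightarrow> jet m (\<lambda>x. \<phi> (L x)) x \<le> C * jet m \<phi> (L x)"
      using jet_compose_linear[OF L, of m] by blast
    have "(1 + norm x) ^ k * jet m (\<lambda>x. \<phi> (L x)) x \<le> C * jet_seminorm k m \<phi>" if \<phi>: "\<phi> \<in> schwartz" for \<phi> x
    proof -
      have "(1 + norm x) ^ k * jet m (\<lambda>x. \<phi> (L x)) x \<le> (1 + norm x) ^ k * (C * jet m \<phi> (L x))"
        by (intro mult_left_mono C(2) schwartz_smooth[OF \<phi>]) auto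
      also have "\<dots> = C * ((1 + norm (L x)) ^ k * jet m \<phi> (L x))" by (simp add: iso)
      also have "\<dots> \<le> C * jet_seminorm k m \<phi>" by (intro mult_left_mono jet_seminorm_upper \<phi> C(1))
      finally show ?thesis .
    qed
    then show ?thesis using C(1) by blast
  qed
  show "\<exists>C\<ge>0. \<forall>\<phi>\<in>schwartz. jet_seminorm k m (\<lambda>x. \<phi> (L x)) \<le> C * jet_seminorm k m \<phi>"
    using *[of k m] by (auto intro: jet_seminorm_least)
  show "\<phi> \<in> schwartz \<Longrightarrow> (\<lambda>x. \<phi> (L x)) \<in> schwartz"
    unfolding schwartz_iff[of "\<lambda>x. \<phi> (L x)"] using * smooth_compose_linear[OF L schwartz_smooth] by blast
qed

text \<open>Only the value and the constant first derivatives contribute, whatever \<open>m\<close>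
  is; hence a bound of degree one in the weight and linear in \<open>v\<close>.\<close>

lemma jet_linear_functional:
  "jet m (\<lambda>y::'a::euclidean_space. complex_of_real (y \<bullet> v)) x \<le> (1 + real DIM('a)) * norm v * (1 + norm x)"
  and smooth_linear_functional: "smooth (\<lambda>y::'a::euclidean_space. complex_of_real (y \<bullet> v))"
proof -
  have pd: "partial_deriv b (\<lambda>y::'a. complex_of_real (y \<bullet> v)) = (\<lambda>y. complex_of_real (b \<bullet> v))" for b
  proof
    fix x :: 'a
    have "((\<lambda>y::'a. complex_of_real (y \<bullet> v)) has_derivative (\<lambda>h. complex_of_real (h \<bullet> v))) (at x)"
      by (auto intro!: derivative_eq_intros)
    from partial_deriv_eqI[OF this] show "partial_deriv b (\<lambda>y::'a. complex_of_real (y \<bullet> v)) x = complex_of_real (b \<bullet> v)" .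
  qed
  have sum: "norm v * norm x + (\<Sum>b\<in>(Basis::'a set). \<bar>b \<bullet> v\<bar>) \<le> norm v * norm x + real DIM('a) * norm v"
    by (intro add_mono sum_bounded_above order_refl) (auto simp: inner_commute[of _ v] Basis_le_norm)
  have abs: "\<bar>x \<bullet> v\<bar> \<le> norm v * norm x" using Cauchy_Schwarz_ineq2[of x v] by (simp add: mult.commute)
  have nn: "0 \<le> real DIM('a) * norm v * norm x" "0 \<le> real DIM('a) * norm v" by simp_all
  have eq: "(1 + real DIM('a)) * norm v * (1 + norm x) =
      norm v + norm v * norm x + real DIM('a) * norm v + real DIM('a) * norm v * norm x"
    by (simp add: algebra_simps)
  show "jet m (\<lambda>y::'a. complex_of_real (y \<bullet> v)) x \<le> (1 + real DIM('a)) * norm v * (1 + norm x)"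
    unfolding eq
  proof (cases m)
    case 0
    then have "jet m (\<lambda>y::'a. complex_of_real (y \<bullet> v)) x = \<bar>x \<bullet> v\<bar>" by simp
    then show "jet m (\<lambda>y::'a. complex_of_real (y \<bullet> v)) x \<le>
        norm v + norm v * norm x + real DIM('a) * norm v + real DIM('a) * norm v * norm x"
      using abs nn norm_ge_zero[of v] by linarith
  next
    case (Suc m')
    then have "jet m (\<lambda>y::'a. complex_of_real (y \<bullet> v)) x = \<bar>x \<bullet> v\<bar> + (\<Sum>b\<in>(Basis::'a set). \<bar>b \<bullet> v\<bar>)"
      by (simp add: pd jet_const)
    then show "jet m (\<lambda>y::'a. complex_of_real (y \<bullet> v)) x \<le>
        norm v + norm v * norm x + real DIM('a) * norm v + real DIM('a) * norm v * norm x"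
      using sum abs nn norm_ge_zero[of v] by linarith
  qed
  have d: "(\<lambda>y::'a. complex_of_real (y \<bullet> v)) differentiable at x" for x
    by (intro bounded_linear_imp_differentiable bounded_linear_compose[OF bounded_linear_of_real bounded_linear_inner_left])
  show "smooth (\<lambda>y::'a. complex_of_real (y \<bullet> v))"
  proof (rule smooth_coinduct[of "\<lambda>\<psi>. \<psi> = (\<lambda>y. complex_of_real (y \<bullet> v)) \<or> (\<exists>c. \<psi> = (\<lambda>y. c))"])
    show "\<psi> = (\<lambda>y. complex_of_real (y \<bullet> v)) \<or> (\<exists>c. \<psi> = (\<lambda>y. c)) \<Longrightarrow> \<psi> differentiable at x" for \<psi> x
      using d by auto
  qed (auto simp: pd)
qed

lemma schwartz_mult_linear:
  "\<exists>C\<ge>0. \<forall>v::'a::euclidean_space. \<forall>\<phi>\<in>schwartz. (\<lambda>x. complex_of_real (x \<bullet> v) * \<phi> x) \<in> schwartz \<and>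
     jet_seminorm k m (\<lambda>x. complex_of_real (x \<bullet> v) * \<phi> x) \<le> C * norm v * jet_seminorm (Suc k) m \<phi>"
proof -
  have *: "\<exists>C\<ge>0. \<forall>v::'a. \<forall>\<phi>\<in>schwartz. \<forall>x. (1 + norm x) ^ k * jet m (\<lambda>x. complex_of_real (x \<bullet> v) * \<phi> x) x
      \<le> C * norm v * jet_seminorm (Suc k) m \<phi>" for k m
  proof -
    obtain C where C: "C \<ge> 0" "\<And>\<theta> \<phi>::'a \<Rightarrow> complex. \<And>A K x. smooth \<theta> \<Longrightarrow> (\<forall>x. jet m \<theta> x \<le> A * (1 + norm x) ^ K) \<Longrightarrow> \<phi> \<in> schwartz \<Longrightarrow>
     (1 + norm x) ^ k * jet m (\<lambda>x. \<theta> x * \<phi> x) x \<le> C * A * jet_seminorm (k + K) m \<phi>"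
      using schwartz_multiplier[of m k, where 'a='a] by blast
    have "(1 + norm x) ^ k * jet m (\<lambda>x. complex_of_real (x \<bullet> v) * \<phi> x) x
      \<le> (C * (1 + real DIM('a))) * norm v * jet_seminorm (Suc k) m \<phi>" if "\<phi> \<in> schwartz" for v x :: 'a and \<phi>
      using C(2)[OF smooth_linear_functional[of v], of "(1 + real DIM('a)) * norm v" 1, OF _ that]
        jet_linear_functional[of m v] by (simp add: mult.assoc)
    then show ?thesis using C(1) by (intro exI[of _ "C * (1 + real DIM('a))"]) auto
  qed
  have "(\<lambda>x. complex_of_real (x \<bullet> v) * \<phi> x) \<in> schwartz" if "\<phi> \<in> schwartz" for v :: 'a and \<phi>
    unfolding schwartz_iff[of "\<lambda>x. complex_of_real (x \<bullet> v) * \<phi> x"]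
    using * that smooth_mult[OF smooth_linear_functional schwartz_smooth] by blast
  moreover obtain C where "C \<ge> 0" "\<And>v::'a. \<And>\<phi> x. \<phi> \<in> schwartz \<Longrightarrow>
      (1 + norm x) ^ k * jet m (\<lambda>x. complex_of_real (x \<bullet> v) * \<phi> x) x \<le> C * norm v * jet_seminorm (Suc k) m \<phi>"
    using *[of k m] by blast
  ultimately show ?thesis by (intro exI[of _ C]) (auto intro: jet_seminorm_least)
qed

section \<open>Integrability of rapidly decreasing functions\<close>

text \<open>The point \<open>x\<close> lies in the ball of radius \<open>1 + n\<close>, where
  \<open>n\<close> is the integer part of its norm. The volume of the ball consumes
  \<open>DIM('a)\<close> powers of the weight, and the remaining two leave a convergent series. This
  explains the exponent \<open>DIM('a) + 2\<close> throughout.\<close>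

lemma nn_integral_weight_finite:
  "(\<integral>\<^sup>+x. ennreal (1 / (1 + norm (x::'a::euclidean_space)) ^ (DIM('a) + 2)) \<partial>lborel) < \<infinity>"
proof -
  let ?N = "DIM('a) + 2"
  let ?f = "\<lambda>n x. ennreal (1 / (1 + real n) ^ ?N) * indicator (ball (0::'a) (1 + real n)) x"
  have le_suminf: "h n \<le> suminf h" for h :: "nat \<Rightarrow> ennreal" and n
    using sum_le_suminf[OF summableI, of "{n}" h] by simp
  have le: "ennreal (1 / (1 + norm x) ^ ?N) \<le> (\<Sum>n. ?f n x)" for x :: 'a
  proof -
    define n where "n = nat \<lfloor>norm x\<rfloor>"
    have n: "real n \<le> norm x" "norm x < 1 + real n"
      unfolding n_def using floor_correct[of "norm x"] by (simp_all add: of_nat_nat add.commute)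
    have "1 / (1 + norm x) ^ ?N \<le> 1 / (1 + real n) ^ ?N"
      using n by (intro divide_left_mono power_mono) (auto intro!: mult_pos_pos zero_less_power add_pos_nonneg)
    then have "ennreal (1 / (1 + norm x) ^ ?N) \<le> ?f n x"
      using n by (simp add: dist_norm ennreal_leI)
    also have "\<dots> \<le> (\<Sum>n. ?f n x)"
      by (rule le_suminf)
    finally show ?thesis .
  qed
  have "(\<integral>\<^sup>+x. ennreal (1 / (1 + norm (x::'a)) ^ ?N) \<partial>lborel) \<le> (\<integral>\<^sup>+x. (\<Sum>n. ?f n x) \<partial>lborel)"
    by (intro nn_integral_mono le)
  also have "\<dots> = (\<Sum>n. \<integral>\<^sup>+x. ?f n x \<partial>lborel)"
    by (intro nn_integral_suminf borel_measurable_times_ennreal borel_measurable_indicator) auto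
  also have "\<dots> = (\<Sum>n. ennreal (unit_ball_vol (real DIM('a)) * (1 / (1 + real n) ^ 2)))"
  proof (intro suminf_cong)
    fix n
    have "(\<integral>\<^sup>+x. ?f n x \<partial>lborel) = ennreal (1 / (1 + real n) ^ ?N) * ennreal (unit_ball_vol (real DIM('a)) * (1 + real n) ^ DIM('a))"
      by (subst nn_integral_cmult_indicator) (auto simp: emeasure_ball)
    also have "\<dots> = ennreal (1 / (1 + real n) ^ ?N * (unit_ball_vol (real DIM('a)) * (1 + real n) ^ DIM('a)))"
      by (subst ennreal_mult) (auto intro!: mult_nonneg_nonneg)
    also have "1 / (1 + real n) ^ ?N * (unit_ball_vol (real DIM('a)) * (1 + real n) ^ DIM('a)) =
        unit_ball_vol (real DIM('a)) * (1 / (1 + real n) ^ 2)"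
      by (simp add: power_add power2_eq_square)
    finally show "(\<integral>\<^sup>+x. ?f n x \<partial>lborel) = ennreal (unit_ball_vol (real DIM('a)) * (1 / (1 + real n) ^ 2))" .
  qed
  also have "\<dots> < \<infinity>"
  proof -
    have "summable (\<lambda>n. inverse (real (Suc n) ^ 2))"
      using inverse_power_summable[of 2, where 'a=real] by (subst summable_Suc_iff) auto
    then have "summable (\<lambda>n. unit_ball_vol (real DIM('a)) * (1 / (1 + real n) ^ 2))"
      by (intro summable_mult) (simp add: divide_inverse add.commute)
    then show ?thesis by (subst suminf_ennreal2) auto
  qed
  finally show ?thesis .
qed

lemma integrable_weight:
  "integrable lborel (\<lambda>x::'a::euclidean_space. 1 / (1 + norm x) ^ (DIM('a) + 2))"
  using nn_integral_weight_finite[where 'a='a]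
  by (intro integrableI_bounded) (auto simp del: power_add power_Suc)

lemma integrable_decay:
  fixes f :: "'a::euclidean_space \<Rightarrow> 'b::{banach, second_countable_topology}"
  assumes "f \<in> borel_measurable borel"
    and "\<And>x. norm (f x) \<le> c / (1 + norm x) ^ (DIM('a) + 2)"
  shows "integrable lborel f"
proof (rule Bochner_Integration.integrable_bound)
  show "integrable lborel (\<lambda>x::'a. c * (1 / (1 + norm x) ^ (DIM('a) + 2)))"
    by (intro integrable_mult_right integrable_weight)
  have "norm (f x) \<le> norm (c * (1 / (1 + norm x) ^ (DIM('a) + 2)))" for x
    using assms(2)[of x] by (simp add: divide_inverse)
  then show "AE x in lborel. norm (f x) \<le> norm (c * (1 / (1 + norm x) ^ (DIM('a) + 2)))" by simp
qed (use assms(1) in simp)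

definition weight_integral :: "'a::euclidean_space itself \<Rightarrow> real" where
  "weight_integral _ = (\<integral>x. 1 / (1 + norm (x::'a)) ^ (DIM('a) + 2) \<partial>lborel)"

lemma weight_integral_nonneg: "0 \<le> weight_integral TYPE('a::euclidean_space)"
  unfolding weight_integral_def by (intro Bochner_Integration.integral_nonneg) auto

lemma norm_integral_decay:
  fixes f :: "'a::euclidean_space \<Rightarrow> 'b::{banach, second_countable_topology}"
  assumes "f \<in> borel_measurable borel"
    and "\<And>x. norm (f x) \<le> c / (1 + norm x) ^ (DIM('a) + 2)"
  shows "norm (\<integral>x. f x \<partial>lborel) \<le> weight_integral TYPE('a) * c"
proof -
  have "norm (\<integral>x. f x \<partial>lborel) \<le> (\<integral>x. norm (f x) \<partial>lborel)"
    by (intro integral_norm_bound)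
  also have "\<dots> \<le> (\<integral>x. c * (1 / (1 + norm (x::'a)) ^ (DIM('a) + 2)) \<partial>lborel)"
    using assms
    by (intro integral_mono integrable_norm integrable_decay[OF assms] integrable_mult_right integrable_weight) auto
  also have "\<dots> = weight_integral TYPE('a) * c"
    by (simp only: Bochner_Integration.integral_mult_right_zero weight_integral_def mult.commute)
  finally show ?thesis .
qed

lemma schwartz_measurable: "\<phi> \<in> schwartz \<Longrightarrow> \<phi> \<in> borel_measurable borel"
  by (simp add: schwartz_smooth smooth_measurable)

lemma schwartz_decay:
  "\<phi> \<in> schwartz \<Longrightarrow> norm (\<phi> x) \<le> jet_seminorm k 0 \<phi> / (1 + norm x) ^ k"
  using jet_decay[of \<phi> 0 x k] by (simp only: jet.simps)

lemma schwartz_integrable: "\<phi> \<in> schwartz \<Longrightarrow> integrable lborel \<phi>"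
  by (rule integrable_decay[OF schwartz_measurable schwartz_decay])

section \<open>Differentiation under the integral sign\<close>

lemma norm_frechet_derivative_le_jet:
  assumes "\<phi> differentiable at x"
  shows "norm (frechet_derivative \<phi> (at x) h) \<le> jet (Suc 0) \<phi> x * norm h"
proof -
  have "norm (frechet_derivative \<phi> (at x) h) \<le> (\<Sum>b\<in>Basis. norm ((h \<bullet> b) *\<^sub>R partial_deriv b \<phi> x))"
    unfolding frechet_derivative_Basis_sum[OF assms] by (rule norm_sum)
  also have "\<dots> \<le> (\<Sum>b\<in>Basis. norm h * norm (partial_deriv b \<phi> x))"
    by (intro sum_mono) (auto intro!: mult_right_mono Basis_le_norm)
  also have "\<dots> = norm h * (\<Sum>b\<in>Basis. norm (partial_deriv b \<phi> x))"
    by (simp add: sum_distrib_left)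
  also have "\<dots> \<le> norm h * jet (Suc 0) \<phi> x"
    by (intro mult_left_mono) auto
  also have "\<dots> = jet (Suc 0) \<phi> x * norm h" by (rule mult.commute)
  finally show ?thesis .
qed

lemma smooth_lipschitz_segment:
  assumes "smooth \<phi>" and "\<And>z. z \<in> closed_segment x y \<Longrightarrow> jet (Suc 0) \<phi> z \<le> B"
  shows "norm (\<phi> y - \<phi> x) \<le> B * norm (y - x)"
proof (rule differentiable_bound[OF convex_closed_segment])
  show "(\<phi> has_derivative frechet_derivative \<phi> (at z)) (at z within closed_segment x y)" for z
    by (rule has_derivative_at_withinI[OF has_derivative_frechet[OF smooth_differentiable[OF assms(1)]]])
  show "onorm (frechet_derivative \<phi> (at z)) \<le> B" if "z \<in> closed_segment x y" for z
  proof (rule onorm_le)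
    fix h
    show "norm (frechet_derivative \<phi> (at z) h) \<le> B * norm h"
      using norm_frechet_derivative_le_jet[OF smooth_differentiable[OF assms(1)], of z h]
        mult_right_mono[OF assms(2)[OF that] norm_ge_zero, of h] by linarith
  qed
qed auto

text \<open>The mean value inequality is applied to the function minus its linear part at
  \<open>x\<close>. The derivative of this difference is small along the segment by a second mean
  value inequality, now for the first partial derivatives.\<close>

lemma smooth_taylor_segment:
  fixes \<phi> :: "'a::euclidean_space \<Rightarrow> complex"
  assumes sm: "smooth \<phi>" and B: "\<And>z. z \<in> closed_segment x y \<Longrightarrow> jet 2 \<phi> z \<le> B"
  shows "norm (\<phi> y - \<phi> x - (\<Sum>b\<in>Basis. ((y - x) \<bullet> b) *\<^sub>R partial_deriv b \<phi> x)) \<le> real DIM('a) * B * norm (y - x) ^ 2"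
proof -
  define D where "D = (\<lambda>h. \<Sum>b\<in>Basis. (h \<bullet> b) *\<^sub>R partial_deriv b \<phi> x)"
  define w where "w = (\<lambda>z. \<phi> z - D z)"
  have D: "bounded_linear D" unfolding D_def
    by (intro bounded_linear_sum bounded_linear_compose[OF bounded_linear_scaleR_left bounded_linear_inner_left])
  have "0 \<le> B" using order_trans[OF jet_nonneg B[of x]] by simp
  have *: "norm (w y - w x) \<le> (real DIM('a) * B * norm (y - x)) * norm (y - x)"
  proof (rule differentiable_bound[OF convex_closed_segment])
    show "(w has_derivative (\<lambda>h. frechet_derivative \<phi> (at z) h - D h)) (at z within closed_segment x y)" for z
      unfolding w_def
      by (rule has_derivative_diff[OF has_derivative_at_withinI[OF has_derivative_frechet[OF smooth_differentiable[OF sm]]]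
            bounded_linear_imp_has_derivative[OF D]])
    fix z assume z: "z \<in> closed_segment x y"
    have "norm (partial_deriv b \<phi> z - partial_deriv b \<phi> x) \<le> B * norm (y - x)" if b: "b \<in> Basis" for b
    proof -
      have "norm (partial_deriv b \<phi> z - partial_deriv b \<phi> x) \<le> B * norm (z - x)"
      proof (rule smooth_lipschitz_segment[OF smooth_partial_deriv[OF sm b]])
        fix z' assume "z' \<in> closed_segment x z"
        then have z': "z' \<in> closed_segment x y" using z by (meson closed_segment_subset convex_closed_segment ends_in_segment(1) subsetD)
        show "jet (Suc 0) (partial_deriv b \<phi>) z' \<le> B"
          by (rule order_trans[OF jet_partial_deriv_le[OF b] B[unfolded numeral_2_eq_2, OF z']])
      qed
      also have "\<dots> \<le> B * norm (y - x)"
        using segment_bound1[OF z] \<open>0 \<le> B\<close> by (intro mult_left_mono) auto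
      finally show ?thesis .
    qed
    note pd = this
    show "onorm (\<lambda>h. frechet_derivative \<phi> (at z) h - D h) \<le> real DIM('a) * B * norm (y - x)"
    proof (rule onorm_le)
      fix h :: 'a
      have "frechet_derivative \<phi> (at z) h - D h = (\<Sum>b\<in>Basis. (h \<bullet> b) *\<^sub>R (partial_deriv b \<phi> z - partial_deriv b \<phi> x))"
        unfolding D_def frechet_derivative_Basis_sum[OF smooth_differentiable[OF sm]]
        by (simp add: sum_subtractf scaleR_diff_right)
      also have "norm \<dots> \<le> (\<Sum>b\<in>(Basis::'a set). norm h * (B * norm (y - x)))"
        by (intro sum_norm_le) (auto intro!: mult_mono Basis_le_norm pd)
      also have "\<dots> = real DIM('a) * B * norm (y - x) * norm h" by simp
      finally show "norm (frechet_derivative \<phi> (at z) h - D h) \<le> real DIM('a) * B * norm (y - x) * norm h" .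
    qed
  qed auto
  have "w y - w x = \<phi> y - \<phi> x - D (y - x)"
    unfolding w_def using bounded_linear.linear[OF D] by (simp add: linear_diff)
  with * show ?thesis by (simp add: D_def power2_eq_square mult.assoc)
qed

text \<open>The partial derivative is a limit of difference quotients, so that measurability in a
  parameter is inherited.\<close>

lemma partial_deriv_LIMSEQ:
  assumes "\<phi> differentiable at x" "b \<noteq> 0"
  shows "(\<lambda>n. complex_of_real (real (Suc n)) * (\<phi> (x + (1 / real (Suc n)) *\<^sub>R b) - \<phi> x)) \<longlonglongrightarrow> partial_deriv b \<phi> x"
proof -
  let ?D = "frechet_derivative \<phi> (at x)"
  have lin: "linear ?D" using assms(1) linear_frechet_derivative by blast
  let ?h = "\<lambda>n. (1 / real (Suc n)) *\<^sub>R b"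
  have "(\<lambda>n. 1 / real (Suc n)) \<longlonglongrightarrow> 0"
    using LIMSEQ_inverse_real_of_nat by (simp add: inverse_eq_divide)
  then have "?h \<longlonglongrightarrow> 0" using tendsto_scaleR[OF _ tendsto_const[of b]] by fastforce
  then have h: "filterlim ?h (at 0) sequentially" using assms(2) by (simp add: filterlim_at)
  have "((\<lambda>h. norm (\<phi> (x + h) - \<phi> x - ?D h) / norm h) \<longlongrightarrow> 0) (at 0)"
    using has_derivative_frechet[OF assms(1)] by (simp add: has_derivative_at)
  from filterlim_compose[OF this h]
  have "(\<lambda>n. norm b * (norm (\<phi> (x + ?h n) - \<phi> x - ?D (?h n)) / norm (?h n))) \<longlonglongrightarrow> 0"
    by (intro tendsto_mult_right_zero)
  also have "(\<lambda>n. norm b * (norm (\<phi> (x + ?h n) - \<phi> x - ?D (?h n)) / norm (?h n))) =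
      (\<lambda>n. norm (complex_of_real (real (Suc n)) * (\<phi> (x + ?h n) - \<phi> x) - ?D b))"
  proof
    fix n
    have "complex_of_real (real (Suc n)) * (\<phi> (x + ?h n) - \<phi> x) - ?D b =
        complex_of_real (real (Suc n)) * (\<phi> (x + ?h n) - \<phi> x - ?D (?h n))"
      by (simp add: linear_scale[OF lin] scaleR_conv_of_real field_simps del: of_nat_Suc)
    then show "norm b * (norm (\<phi> (x + ?h n) - \<phi> x - ?D (?h n)) / norm (?h n)) =
      norm (complex_of_real (real (Suc n)) * (\<phi> (x + ?h n) - \<phi> x) - ?D b)"
      using assms(2) by (simp add: norm_mult del: of_nat_Suc)
  qed
  finally show ?thesis
    unfolding partial_deriv_def by (rule LIM_zero_cancel[OF tendsto_norm_zero_cancel])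
qed

text \<open>The hypotheses for differentiating under the integral to every order, arranged so that
  the partial derivatives of a family form such a family again. The majorant is independent of the
  point, so that Taylor remainders along a segment can be integrated.\<close>

definition smooth_family :: "'p measure \<Rightarrow> ('p \<Rightarrow> 'a::euclidean_space \<Rightarrow> complex) \<Rightarrow> bool" where
  "smooth_family M u \<longleftrightarrow> (\<forall>t. smooth (u t)) \<and> (\<forall>x. (\<lambda>t. u t x) \<in> borel_measurable M) \<and>
     (\<forall>m. \<exists>G. integrable M G \<and> (\<forall>t x. jet m (u t) x \<le> G t))"

lemma smooth_family_partial_deriv:
  assumes "smooth_family M u" "b \<in> Basis"
  shows "smooth_family M (\<lambda>t. partial_deriv b (u t))"
proof -
  have sm: "\<And>t. smooth (u t)" and meas[measurable]: "\<And>x. (\<lambda>t. u t x) \<in> borel_measurable M"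
    using assms(1) by (auto simp: smooth_family_def)
  have "(\<lambda>t. partial_deriv b (u t) x) \<in> borel_measurable M" for x
  proof (rule borel_measurable_LIMSEQ_metric)
    show "(\<lambda>n. complex_of_real (real (Suc n)) * (u t (x + (1 / real (Suc n)) *\<^sub>R b) - u t x)) \<longlonglongrightarrow> partial_deriv b (u t) x" for t
      using assms(2) by (intro partial_deriv_LIMSEQ smooth_differentiable sm) auto
  qed measurable
  moreover have "\<exists>G. integrable M G \<and> (\<forall>t x. jet m (partial_deriv b (u t)) x \<le> G t)" for m
    using assms jet_partial_deriv_le[OF assms(2)] unfolding smooth_family_def by (meson order_trans)
  ultimately show ?thesis using sm assms(2) by (simp add: smooth_family_def smooth_partial_deriv)
qed

lemma smooth_family_integrable:
  assumes "smooth_family M u"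
  shows "integrable M (\<lambda>t. u t x)"
proof -
  obtain G where G: "integrable M G" "\<And>t. jet 0 (u t) x \<le> G t"
    using assms unfolding smooth_family_def by meson
  show ?thesis
  proof (rule Bochner_Integration.integrable_bound[OF G(1)])
    show "(\<lambda>t. u t x) \<in> borel_measurable M" using assms by (simp add: smooth_family_def)
    show "AE t in M. norm (u t x) \<le> norm (G t)"
      using G(2) by (intro AE_I2) (metis abs_ge_self jet.simps(1) order_trans real_norm_def)
  qed
qed

text \<open>The integrated Taylor remainder is at most the integral of a majorant of the
  second-order jets times the square of the increment, so differentiability follows from an explicit
  quadratic estimate.\<close>

lemma has_derivative_integral_smooth_family:
  fixes u :: "'p \<Rightarrow> 'a::euclidean_space \<Rightarrow> complex"
  assumes u: "smooth_family M u"
  shows "((\<lambda>x. \<integral>t. u t x \<partial>M) has_derivative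
    (\<lambda>h. \<Sum>b\<in>Basis. (h \<bullet> b) *\<^sub>R (\<integral>t. partial_deriv b (u t) x \<partial>M))) (at x)"
proof -
  obtain G where G: "integrable M G" "\<And>t x. jet 2 (u t) x \<le> G t"
    using u unfolding smooth_family_def by meson
  define D where "D = (\<lambda>h. \<Sum>b\<in>Basis. (h \<bullet> b) *\<^sub>R (\<integral>t. partial_deriv b (u t) x \<partial>M))"
  have int: "integrable M (\<lambda>t. u t y)" for y by (rule smooth_family_integrable[OF u])
  have intd: "integrable M (\<lambda>t. partial_deriv b (u t) x)" if "b \<in> Basis" for b
    by (rule smooth_family_integrable[OF smooth_family_partial_deriv[OF u that]])
  define K where "K = real DIM('a) * (\<integral>t. G t \<partial>M)"
  have est: "norm ((\<integral>t. u t y \<partial>M) - (\<integral>t. u t x \<partial>M) - D (y - x)) \<le> K * norm (y - x) ^ 2" for y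
  proof -
    let ?r = "\<lambda>t. u t y - u t x - (\<Sum>b\<in>Basis. ((y - x) \<bullet> b) *\<^sub>R partial_deriv b (u t) x)"
    let ?s = "\<lambda>t. \<Sum>b\<in>Basis. ((y - x) \<bullet> b) *\<^sub>R partial_deriv b (u t) x"
    have s: "integrable M ?s"
      by (intro Bochner_Integration.integrable_sum integrable_scaleR_right intd)
    have r: "integrable M ?r"
      by (intro Bochner_Integration.integrable_diff int s)
    have "(\<integral>t. ?s t \<partial>M) = D (y - x)"
      unfolding D_def
      by (subst Bochner_Integration.integral_sum) (auto intro!: integrable_scaleR_right intd)
    then have "(\<integral>t. u t y \<partial>M) - (\<integral>t. u t x \<partial>M) - D (y - x) = (\<integral>t. ?r t \<partial>M)"
      by (simp only: Bochner_Integration.integral_diff[OF Bochner_Integration.integrable_diff[OF int int] s]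
          Bochner_Integration.integral_diff[OF int int])
    also have "norm \<dots> \<le> (\<integral>t. norm (?r t) \<partial>M)" by (rule integral_norm_bound)
    also have "\<dots> \<le> (\<integral>t. real DIM('a) * G t * norm (y - x) ^ 2 \<partial>M)"
    proof (intro integral_mono integrable_norm r integrable_mult_left integrable_mult_right G(1))
      fix t show "norm (?r t) \<le> real DIM('a) * G t * norm (y - x) ^ 2"
        using u G(2) by (intro smooth_taylor_segment) (auto simp: smooth_family_def)
    qed
    also have "\<dots> = K * norm (y - x) ^ 2" by (simp add: K_def)
    finally show ?thesis .
  qed
  have "((\<lambda>x. \<integral>t. u t x \<partial>M) has_derivative D) (at x)"
  proof (rule has_derivativeI_sandwich[of 1])
    show "bounded_linear D" unfolding D_def
      by (intro bounded_linear_sum bounded_linear_compose[OF bounded_linear_scaleR_left bounded_linear_inner_left])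
    fix y assume "y \<noteq> x"
    then show "norm ((\<integral>t. u t y \<partial>M) - (\<integral>t. u t x \<partial>M) - D (y - x)) / norm (y - x) \<le> K * norm (y - x)"
      using est[of y] by (simp add: pos_divide_le_eq power2_eq_square mult.assoc)
  next
    have "((\<lambda>y. K * norm (y - x)) \<longlongrightarrow> K * norm (x - x)) (at x)" by (intro tendsto_intros)
    then show "((\<lambda>y. K * norm (y - x)) \<longlongrightarrow> 0) (at x)" by simp
  qed simp
  then show ?thesis by (simp add: D_def)
qed

lemma partial_deriv_integral:
  assumes "smooth_family M u" "b \<in> Basis"
  shows "partial_deriv b (\<lambda>x. \<integral>t. u t x \<partial>M) = (\<lambda>x. \<integral>t. partial_deriv b (u t) x \<partial>M)"
proof
  fix x
  have "partial_deriv b (\<lambda>x. \<integral>t. u t x \<partial>M) x =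
      (\<Sum>c\<in>Basis. (b \<bullet> c) *\<^sub>R (\<integral>t. partial_deriv c (u t) x \<partial>M))"
    by (rule partial_deriv_eqI[OF has_derivative_integral_smooth_family[OF assms(1)]])
  also have "\<dots> = (\<Sum>c\<in>Basis. if c = b then (\<integral>t. partial_deriv c (u t) x \<partial>M) else 0)"
    using assms(2) by (intro sum.cong) (auto simp: inner_Basis)
  finally show "partial_deriv b (\<lambda>x. \<integral>t. u t x \<partial>M) x = (\<integral>t. partial_deriv b (u t) x \<partial>M)"
    using assms(2) by simp
qed

lemma smooth_integral:
  assumes "smooth_family M u" shows "smooth (\<lambda>x. \<integral>t. u t x \<partial>M)"
proof (rule smooth_coinduct[of "\<lambda>\<psi>. \<exists>u. smooth_family M u \<and> \<psi> = (\<lambda>x. \<integral>t. u t x \<partial>M)"])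
  show "\<exists>u. smooth_family M u \<and> \<psi> = (\<lambda>x. \<integral>t. u t x \<partial>M) \<Longrightarrow> \<psi> differentiable at x" for \<psi> x
    using has_derivative_integral_smooth_family unfolding differentiable_def by blast
  show "\<exists>u. smooth_family M u \<and> \<psi> = (\<lambda>x. \<integral>t. u t x \<partial>M) \<Longrightarrow> b \<in> Basis \<Longrightarrow>
      \<exists>u. smooth_family M u \<and> partial_deriv b \<psi> = (\<lambda>x. \<integral>t. u t x \<partial>M)" for \<psi> b
    using partial_deriv_integral smooth_family_partial_deriv by blast
qed (use assms in blast)

lemma jet_measurable:
  "smooth_family M u \<Longrightarrow> (\<lambda>t. jet m (u t) x) \<in> borel_measurable M"
proof (induction m arbitrary: u)
  case (Suc m)
  have [measurable]: "(\<lambda>t. u t x) \<in> borel_measurable M" using Suc.prems by (simp add: smooth_family_def)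
  have [measurable]: "(\<lambda>t. jet m (partial_deriv b (u t)) x) \<in> borel_measurable M" if "b \<in> Basis" for b
    by (rule Suc.IH[OF smooth_family_partial_deriv[OF Suc.prems that]])
  show ?case by simp
next
  case 0
  then have [measurable]: "(\<lambda>t. u t x) \<in> borel_measurable M" by (simp add: smooth_family_def)
  show ?case by simp
qed

lemma jet_integrable:
  assumes "smooth_family M u" shows "integrable M (\<lambda>t. jet m (u t) x)"
proof -
  obtain G where G: "integrable M G" "\<And>t. jet m (u t) x \<le> G t"
    using assms unfolding smooth_family_def by meson
  show ?thesis
    by (rule Bochner_Integration.integrable_bound[OF G(1) jet_measurable[OF assms]])
      (use G(2) in \<open>auto intro!: AE_I2 order_trans[OF _ abs_ge_self]\<close>)
qed

text \<open>The triangle inequality for integrals, applied to each derivative after it has been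
  moved inside.\<close>

lemma jet_integral_le:
  "smooth_family M u \<Longrightarrow> jet m (\<lambda>x. \<integral>t. u t x \<partial>M) x \<le> (\<integral>t. jet m (u t) x \<partial>M)"
proof (induction m arbitrary: u)
  case 0
  then show ?case by simp
next
  case (Suc m)
  have "jet (Suc m) (\<lambda>x. \<integral>t. u t x \<partial>M) x =
      norm (\<integral>t. u t x \<partial>M) + (\<Sum>b\<in>Basis. jet m (\<lambda>x. \<integral>t. partial_deriv b (u t) x \<partial>M) x)"
    by (simp add: partial_deriv_integral[OF Suc.prems])
  also have "\<dots> \<le> (\<integral>t. norm (u t x) \<partial>M) + (\<Sum>b\<in>Basis. \<integral>t. jet m (partial_deriv b (u t)) x \<partial>M)"
    by (intro add_mono sum_mono integral_norm_bound Suc.IH smooth_family_partial_deriv Suc.prems)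
  also have "\<dots> = (\<integral>t. jet (Suc m) (u t) x \<partial>M)"
    by (simp add: Bochner_Integration.integral_add Bochner_Integration.integral_sum jet_integrable
        smooth_family_integrable smooth_family_partial_deriv Suc.prems)
  finally show ?case .
qed

section \<open>Plane waves\<close>

text \<open>The kernel of the Fourier transform including its sign. It is symmetric in its two
  arguments, and below either of them may play the frequency.\<close>

definition plane_wave :: "'a::euclidean_space \<Rightarrow> 'a \<Rightarrow> complex" where
  "plane_wave v y = cis (- 2 * pi * (y \<bullet> v))"

lemma plane_wave_commute: "plane_wave v y = plane_wave y v"
  by (simp add: plane_wave_def inner_commute)

lemma plane_wave_add: "plane_wave (u + v) y = plane_wave u y * plane_wave v y"
  by (simp add: plane_wave_def inner_add_right cis_mult algebra_simps)

lemma plane_wave_add_right: "plane_wave v (x + y) = plane_wave v x * plane_wave v y"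
  by (simp add: plane_wave_def inner_add_left cis_mult algebra_simps)

lemma plane_wave_minus: "plane_wave (- v) y = cnj (plane_wave v y)"
  by (simp add: plane_wave_def cis_cnj)

lemma plane_wave_zero [simp]: "plane_wave 0 y = 1"
  by (simp add: plane_wave_def)

lemma norm_plane_wave [simp]: "norm (plane_wave v y) = 1"
  by (simp add: plane_wave_def)

lemma plane_wave_has_derivative:
  "(plane_wave v has_derivative (\<lambda>h. - (2 * pi * \<i> * (h \<bullet> v)) * plane_wave v y)) (at y)"
  unfolding plane_wave_def[abs_def]
  by (auto intro!: derivative_eq_intros simp: scaleR_conv_of_real)

lemma partial_deriv_plane_wave:
  "partial_deriv b (plane_wave v) = (\<lambda>y. - (2 * pi * \<i> * (b \<bullet> v)) * plane_wave v y)"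
  by (rule ext, rule partial_deriv_eqI[OF plane_wave_has_derivative])

lemma continuous_plane_wave: "continuous_on A (\<lambda>z. plane_wave (f z) (g z))"
  if "continuous_on A f" "continuous_on A g"
  unfolding plane_wave_def using that by (intro continuous_intros)

lemma plane_wave_measurable [measurable]:
  fixes f g :: "'b \<Rightarrow> 'a::euclidean_space"
  assumes [measurable]: "f \<in> borel_measurable M" "g \<in> borel_measurable M"
  shows "(\<lambda>z. plane_wave (f z) (g z)) \<in> borel_measurable M"
proof -
  have [measurable]: "cis \<in> borel_measurable borel"
    by (intro borel_measurable_continuous_onI continuous_intros)
  show ?thesis unfolding plane_wave_def by measurable
qed

lemma smooth_plane_wave: "smooth (plane_wave v)"
proof (rule smooth_coinduct[of "\<lambda>\<psi>. \<exists>c. \<psi> = (\<lambda>y. c * plane_wave v y)"])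
  have d: "plane_wave v differentiable at x" for x
    using plane_wave_has_derivative unfolding differentiable_def by blast
  show "\<exists>c. \<psi> = (\<lambda>y. c * plane_wave v y) \<Longrightarrow> \<psi> differentiable at x" for \<psi> x
    using d by (auto intro!: differentiable_mult)
  show "\<exists>c. \<psi> = (\<lambda>y. c * plane_wave v y) \<Longrightarrow> \<exists>c. partial_deriv b \<psi> = (\<lambda>y. c * plane_wave v y)" for \<psi> b
  proof -
    assume "\<exists>c. \<psi> = (\<lambda>y. c * plane_wave v y)"
    then obtain c where "\<psi> = (\<lambda>y. c * plane_wave v y)" by blast
    then have "partial_deriv b \<psi> = (\<lambda>y. (c * - (2 * pi * \<i> * (b \<bullet> v))) * plane_wave v y)"
      using d by (simp add: partial_deriv_cmult partial_deriv_plane_wave mult.assoc)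
    then show ?thesis by blast
  qed
qed (auto intro: exI[of _ 1])

lemma partial_deriv_plane_wave_norm:
  fixes v :: "'a::euclidean_space"
  assumes "b \<in> Basis" shows "norm (- (2 * pi * \<i> * (b \<bullet> v))) \<le> 2 * pi * norm v"
  using assms Basis_le_norm[of b v] by (simp add: norm_mult inner_commute)

text \<open>Plane waves are eigenfunctions of the partial derivatives with eigenvalues of modulus at
  most \<open>2 * pi * norm v\<close>, so each order contributes a factor \<open>?A\<close>. The
  final form separates the dimension from the frequency.\<close>

lemma jet_plane_wave:
  fixes v :: "'a::euclidean_space"
  shows "jet m (plane_wave v) x \<le> (1 + 2 * pi * real DIM('a)) ^ m * (1 + norm v) ^ m"
proof -
  let ?A = "1 + real DIM('a) * (2 * pi * norm v)"
  have "jet m (plane_wave v) x \<le> ?A ^ m"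
  proof (induction m)
    case (Suc m)
    have "(\<Sum>b\<in>Basis. jet m (partial_deriv b (plane_wave v)) x) =
        (\<Sum>b\<in>Basis. norm (- (2 * pi * \<i> * (b \<bullet> v))) * jet m (plane_wave v) x)"
      by (simp only: partial_deriv_plane_wave jet_cmult[OF smooth_plane_wave])
    also have "\<dots> \<le> (\<Sum>b\<in>(Basis::'a set). 2 * pi * norm v * ?A ^ m)"
      by (intro sum_mono mult_mono partial_deriv_plane_wave_norm Suc.IH) auto
    also have "\<dots> = real DIM('a) * (2 * pi * norm v) * ?A ^ m" by simp
    finally have *: "(\<Sum>b\<in>Basis. jet m (partial_deriv b (plane_wave v)) x) \<le> real DIM('a) * (2 * pi * norm v) * ?A ^ m" .
    have "1 \<le> ?A ^ m" by (intro one_le_power) simp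
    moreover have "jet (Suc m) (plane_wave v) x = 1 + (\<Sum>b\<in>Basis. jet m (partial_deriv b (plane_wave v)) x)" by simp
    ultimately have "jet (Suc m) (plane_wave v) x \<le> ?A ^ m + real DIM('a) * (2 * pi * norm v) * ?A ^ m"
      using * by linarith
    then show ?case by (simp add: algebra_simps)
  qed simp
  also have "?A ^ m \<le> ((1 + 2 * pi * real DIM('a)) * (1 + norm v)) ^ m"
  proof (rule power_mono)
    have "0 \<le> 2 * pi * real DIM('a)" "0 \<le> norm v" by simp_all
    then show "?A \<le> (1 + 2 * pi * real DIM('a)) * (1 + norm v)"
      by (simp add: distrib_left distrib_right)
  qed simp
  finally show ?thesis by (simp add: power_mult_distrib)
qed

lemma cis_minus_one_le: "norm (cis t - 1) \<le> \<bar>t\<bar>"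
proof -
  have "norm (cis t - cis 0) \<le> 1 * norm (t - 0)"
  proof (rule differentiable_bound[OF convex_UNIV])
    show "(cis has_derivative (\<lambda>h. h *\<^sub>R (\<i> * cis x))) (at x within UNIV)" for x
      by (auto intro!: derivative_eq_intros)
    show "onorm (\<lambda>h. h *\<^sub>R (\<i> * cis x)) \<le> 1" for x
      by (rule onorm_le) (simp add: norm_mult)
  qed auto
  then show ?thesis by simp
qed

text \<open>The value is bounded by the phase, and every derivative removes the constant 1 and
  brings out a factor \<open>v\<close>; so the whole jet is small for small \<open>v\<close>, at the
  price of one power of the weight. This supplies the Lipschitz dependence of atoms on their
  frequency.\<close>

lemma jet_plane_wave_minus_one:
  fixes v :: "'a::euclidean_space"
  shows "jet m (\<lambda>y. plane_wave v y - 1) x \<le>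
    2 * pi * norm v * (1 + real DIM('a) * ((1 + 2 * pi * real DIM('a)) ^ m * (1 + norm v) ^ m)) * (1 + norm x)"
proof -
  define E where "E = real DIM('a) * ((1 + 2 * pi * real DIM('a)) ^ m * (1 + norm v) ^ m)"
  have E: "0 \<le> E" by (simp add: E_def)
  have 1: "norm (plane_wave v x - 1) \<le> 2 * pi * norm v * (1 + norm x)"
  proof -
    have "norm (plane_wave v x - 1) \<le> \<bar>- 2 * pi * (x \<bullet> v)\<bar>"
      unfolding plane_wave_def by (rule cis_minus_one_le)
    also have "\<dots> = 2 * pi * \<bar>x \<bullet> v\<bar>" by (simp add: abs_mult)
    also have "\<dots> \<le> 2 * pi * (norm x * norm v)" by (intro mult_left_mono Cauchy_Schwarz_ineq2) simp
    also have "\<dots> \<le> 2 * pi * norm v * (1 + norm x)" by (simp add: algebra_simps)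
    finally show ?thesis .
  qed
  have pd: "partial_deriv b (\<lambda>y. plane_wave v y - 1) = (\<lambda>y. - (2 * pi * \<i> * (b \<bullet> v)) * plane_wave v y)" for b
    using partial_deriv_add[of "plane_wave v" "\<lambda>_. - 1" b, OF smooth_differentiable[OF smooth_plane_wave]]
    by (simp add: partial_deriv_plane_wave)
  have 2: "jet m (\<lambda>y. plane_wave v y - 1) x \<le> norm (plane_wave v x - 1) + 2 * pi * norm v * E"
  proof (cases m)
    case (Suc m')
    have "(\<Sum>b\<in>Basis. jet m' (partial_deriv b (\<lambda>y. plane_wave v y - 1)) x) =
      (\<Sum>b\<in>Basis. norm (- (2 * pi * \<i> * (b \<bullet> v))) * jet m' (plane_wave v) x)"
      by (simp only: pd jet_cmult[OF smooth_plane_wave])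
    also have "\<dots> \<le> (\<Sum>b\<in>(Basis::'a set). 2 * pi * norm v * ((1 + 2 * pi * real DIM('a)) ^ m * (1 + norm v) ^ m))"
      using jet_plane_wave[of m v x] jet_mono[of m' m "plane_wave v" x] Suc
      by (intro sum_mono mult_mono partial_deriv_plane_wave_norm) auto
    also have "\<dots> = 2 * pi * norm v * E" by (simp add: E_def)
    finally show ?thesis using Suc by simp
  qed (simp add: E)
  have "2 * pi * norm v * E \<le> 2 * pi * norm v * (E * (1 + norm x))"
    using E by (intro mult_left_mono) (auto simp: algebra_simps)
  moreover have "2 * pi * norm v * (1 + E) * (1 + norm x) =
      2 * pi * norm v * (1 + norm x) + 2 * pi * norm v * (E * (1 + norm x))"
    by (simp add: algebra_simps)
  ultimately show ?thesis unfolding E_def[symmetric] using 1 2 by linarith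
qed

text \<open>A modulation costs powers of the frequency, one per derivative, and no decay.\<close>

lemma schwartz_plane_wave:
  "\<exists>C\<ge>0. \<forall>v::'a::euclidean_space. \<forall>\<phi>\<in>schwartz. (\<lambda>y. plane_wave v y * \<phi> y) \<in> schwartz \<and>
     jet_seminorm k m (\<lambda>y. plane_wave v y * \<phi> y) \<le> C * (1 + norm v) ^ m * jet_seminorm k m \<phi>"
proof -
  have *: "\<exists>C\<ge>0. \<forall>v::'a. \<forall>\<phi>\<in>schwartz. \<forall>x. (1 + norm x) ^ k * jet m (\<lambda>y. plane_wave v y * \<phi> y) x
      \<le> C * (1 + norm v) ^ m * jet_seminorm k m \<phi>" for k m
  proof -
    obtain C where C: "C \<ge> 0" "\<And>\<theta> \<phi>::'a \<Rightarrow> complex. \<And>A K x. smooth \<theta> \<Longrightarrow> (\<forall>x. jet m \<theta> x \<le> A * (1 + norm x) ^ K) \<Longrightarrow> \<phi> \<in> schwartz \<Longrightarrow>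
     (1 + norm x) ^ k * jet m (\<lambda>x. \<theta> x * \<phi> x) x \<le> C * A * jet_seminorm (k + K) m \<phi>"
      using schwartz_multiplier[of m k, where 'a='a] by blast
    let ?a = "(1 + 2 * pi * real DIM('a)) ^ m"
    have "(1 + norm x) ^ k * jet m (\<lambda>y. plane_wave v y * \<phi> y) x
      \<le> (C * ?a) * (1 + norm v) ^ m * jet_seminorm k m \<phi>" if "\<phi> \<in> schwartz" for v x :: 'a and \<phi>
      using C(2)[OF smooth_plane_wave[of v], of "?a * (1 + norm v) ^ m" 0, OF _ that]
        jet_plane_wave[of m v] by (simp add: mult.assoc)
    then show ?thesis using C(1) by (intro exI[of _ "C * ?a"]) auto
  qed
  have "(\<lambda>y. plane_wave v y * \<phi> y) \<in> schwartz" if "\<phi> \<in> schwartz" for v :: 'a and \<phi>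
    unfolding schwartz_iff[of "\<lambda>y. plane_wave v y * \<phi> y"]
    using * that smooth_mult[OF smooth_plane_wave schwartz_smooth] by blast
  moreover obtain C where "C \<ge> 0" "\<And>v::'a. \<And>\<phi> x. \<phi> \<in> schwartz \<Longrightarrow>
      (1 + norm x) ^ k * jet m (\<lambda>y. plane_wave v y * \<phi> y) x \<le> C * (1 + norm v) ^ m * jet_seminorm k m \<phi>"
    using *[of k m] by blast
  ultimately show ?thesis by (intro exI[of _ C]) (auto intro: jet_seminorm_least)
qed

lemma schwartz_mult_plane_wave: "\<phi> \<in> schwartz \<Longrightarrow> (\<lambda>y. plane_wave v y * \<phi> y) \<in> schwartz"
  using schwartz_plane_wave[of 0 0] by blast

section \<open>The Fourier transform on the Schwartz space\<close>

text \<open>The estimate under which the transpose of a linear operator maps tempered distributions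
  to tempered distributions.\<close>

definition schwartz_continuous ::
  "(('a::euclidean_space \<Rightarrow> complex) \<Rightarrow> ('b::euclidean_space \<Rightarrow> complex)) \<Rightarrow> bool" where
  "schwartz_continuous A \<longleftrightarrow> (\<forall>\<phi>\<in>schwartz. A \<phi> \<in> schwartz) \<and>
     (\<forall>k m. \<exists>k' m' C. C \<ge> 0 \<and> (\<forall>\<phi>\<in>schwartz. jet_seminorm k m (A \<phi>) \<le> C * jet_seminorm k' m' \<phi>))"

lemma schwartz_continuousD: "schwartz_continuous A \<Longrightarrow> \<phi> \<in> schwartz \<Longrightarrow> A \<phi> \<in> schwartz"
  by (simp add: schwartz_continuous_def)

lemma schwartz_continuous_bound:
  assumes "schwartz_continuous A"
  obtains k' m' C where "C \<ge> 0" "\<And>\<phi>. \<phi> \<in> schwartz \<Longrightarrow> jet_seminorm k m (A \<phi>) \<le> C * jet_seminorm k' m' \<phi>"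
  using assms unfolding schwartz_continuous_def by blast

lemma schwartz_continuous_compose:
  assumes A: "schwartz_continuous A" and B: "schwartz_continuous B"
  shows "schwartz_continuous (\<lambda>\<phi>. A (B \<phi>))"
  unfolding schwartz_continuous_def
proof (intro conjI ballI allI)
  show "A (B \<phi>) \<in> schwartz" if "\<phi> \<in> schwartz" for \<phi>
    using that A B by (simp add: schwartz_continuousD)
  fix k m
  obtain k' m' C where C: "C \<ge> 0" "\<And>\<phi>. \<phi> \<in> schwartz \<Longrightarrow> jet_seminorm k m (A \<phi>) \<le> C * jet_seminorm k' m' \<phi>"
    using schwartz_continuous_bound[OF A, of k m] by metis
  obtain k'' m'' C' where C': "C' \<ge> 0" "\<And>\<phi>. \<phi> \<in> schwartz \<Longrightarrow> jet_seminorm k' m' (B \<phi>) \<le> C' * jet_seminorm k'' m'' \<phi>"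
    using schwartz_continuous_bound[OF B, of k' m'] by metis
  have "jet_seminorm k m (A (B \<phi>)) \<le> (C * C') * jet_seminorm k'' m'' \<phi>" if "\<phi> \<in> schwartz" for \<phi>
    using order_trans[OF C(2)[OF schwartz_continuousD[OF B that]] mult_left_mono[OF C'(2)[OF that] C(1)]]
    by (simp add: mult.assoc)
  then show "\<exists>k' m' C. C \<ge> 0 \<and> (\<forall>\<phi>\<in>schwartz. jet_seminorm k m (A (B \<phi>)) \<le> C * jet_seminorm k' m' \<phi>)"
    using C(1) C'(1) by (intro exI[of _ k''] exI[of _ m''] exI[of _ "C * C'"]) auto
qed

definition fourier :: "('a::euclidean_space \<Rightarrow> complex) \<Rightarrow> 'a \<Rightarrow> complex" where
  "fourier \<phi> \<xi> = (\<integral>y. \<phi> y * plane_wave \<xi> y \<partial>lborel)"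

lemma fourier_eq: "fourier \<phi> = (\<lambda>\<xi>. \<integral>y. \<phi> y * plane_wave y \<xi> \<partial>lborel)"
  by (simp add: fourier_def fun_eq_iff plane_wave_commute)

text \<open>The space variable is the parameter here and the frequency is the variable, as in
  \<open>fourier_eq\<close>. A jet of order \<open>m\<close> of the wave grows like the power
  \<open>m\<close> of \<open>y\<close>, so \<open>m\<close> powers of decay are spent beyond the
  \<open>DIM('a) + 2\<close> that integrability takes.\<close>

lemma fourier_family:
  fixes \<phi> :: "'a::euclidean_space \<Rightarrow> complex"
  assumes "\<phi> \<in> schwartz"
  shows "smooth_family lborel (\<lambda>y \<xi>. \<phi> y * plane_wave y \<xi>)"
  unfolding smooth_family_def
proof (intro conjI allI)
  have [measurable]: "\<phi> \<in> borel_measurable borel" using assms by (rule schwartz_measurable)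
  show "smooth (\<lambda>\<xi>. \<phi> y * plane_wave y \<xi>)" for y by (intro smooth_cmult smooth_plane_wave)
  show "(\<lambda>y. \<phi> y * plane_wave y \<xi>) \<in> borel_measurable lborel" for \<xi> by measurable
  fix m
  let ?a = "(1 + 2 * pi * real DIM('a)) ^ m"
  show "\<exists>G. integrable lborel G \<and> (\<forall>y x. jet m (\<lambda>\<xi>. \<phi> y * plane_wave y \<xi>) x \<le> G y)"
  proof (intro exI[of _ "\<lambda>y. norm (\<phi> y) * (?a * (1 + norm y) ^ m)"] conjI allI)
    show "integrable lborel (\<lambda>y. norm (\<phi> y) * (?a * (1 + norm y) ^ m))"
    proof (rule integrable_decay)
      fix y :: 'a
      have "norm (\<phi> y) \<le> jet_seminorm (DIM('a) + 2 + m) 0 \<phi> / (1 + norm y) ^ (DIM('a) + 2 + m)"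
        by (rule schwartz_decay[OF assms])
      then have "norm (\<phi> y) * (?a * (1 + norm y) ^ m) \<le>
          jet_seminorm (DIM('a) + 2 + m) 0 \<phi> / (1 + norm y) ^ (DIM('a) + 2 + m) * (?a * (1 + norm y) ^ m)"
        by (intro mult_right_mono) auto
      also have "\<dots> = jet_seminorm (DIM('a) + 2 + m) 0 \<phi> * ?a / (1 + norm y) ^ (DIM('a) + 2)"
        by (simp only: power_add) (simp add: field_simps del: power_add power_Suc)
      finally show "norm (norm (\<phi> y) * (?a * (1 + norm y) ^ m)) \<le>
          jet_seminorm (DIM('a) + 2 + m) 0 \<phi> * ?a / (1 + norm y) ^ (DIM('a) + 2)"
        by (simp add: abs_mult)
    qed measurable
    show "jet m (\<lambda>\<xi>. \<phi> y * plane_wave y \<xi>) x \<le> norm (\<phi> y) * (?a * (1 + norm y) ^ m)" for y x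
      by (simp only: jet_cmult[OF smooth_plane_wave]) (intro mult_left_mono jet_plane_wave norm_ge_zero)
  qed
qed

lemma smooth_fourier: "\<phi> \<in> schwartz \<Longrightarrow> smooth (fourier \<phi>)"
  unfolding fourier_eq by (rule smooth_integral[OF fourier_family])

lemma partial_deriv_fourier:
  assumes "\<phi> \<in> schwartz" "b \<in> Basis"
  shows "partial_deriv b (fourier \<phi>) = fourier (\<lambda>y. - (2 * pi * \<i>) * (complex_of_real (y \<bullet> b) * \<phi> y))"
  unfolding fourier_eq partial_deriv_integral[OF fourier_family[OF assms(1)] assms(2)]
  by (simp add: partial_deriv_cmult smooth_differentiable[OF smooth_plane_wave] partial_deriv_plane_wave
      mult.commute mult.left_commute inner_commute[of b])

lemma integral_translate:
  fixes f :: "'a::euclidean_space \<Rightarrow> complex"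
  assumes "f \<in> borel_measurable borel"
  shows "(\<integral>x. f (x + a) \<partial>lborel) = (\<integral>x. f x \<partial>lborel)"
  using integral_distr[of "(+) a" lborel borel f] assms by (simp add: lborel_distr_plus add.commute)

text \<open>By translation invariance the integral of a difference quotient vanishes. Hence
  \<open>h\<close> times the integral is, up to sign, the integral of a Taylor remainder, which is
  of order \<open>h ^ 2\<close>; dividing by \<open>h\<close> and letting it tend to 0 leaves
  0.\<close>

lemma integral_partial_deriv:
  fixes \<psi> :: "'a::euclidean_space \<Rightarrow> complex"
  assumes "\<psi> \<in> schwartz" "b \<in> Basis"
  shows "(\<integral>y. partial_deriv b \<psi> y \<partial>lborel) = 0"
proof -
  define I where "I = (\<integral>y. partial_deriv b \<psi> y \<partial>lborel)"
  let ?N = "DIM('a) + 2"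
  define c where "c = real DIM('a) * (2 ^ ?N * jet_seminorm ?N 2 \<psi>)"
  have sm: "smooth \<psi>" by (rule schwartz_smooth[OF assms(1)])
  have int: "integrable lborel \<psi>" "integrable lborel (partial_deriv b \<psi>)"
    "integrable lborel (\<lambda>y. \<psi> (y + a))" for a
    using schwartz_integrable[OF assms(1)] schwartz_integrable[OF jet_seminorm_partial_deriv(1)[OF assms]]
      schwartz_integrable[OF schwartz_translate(1)[OF assms(1)], of "- a"] by simp_all
  have bound: "norm I \<le> (weight_integral TYPE('a) * c) * h" if h: "0 < h" "h \<le> 1" for h :: real
  proof -
    let ?r = "\<lambda>y. \<psi> (y + h *\<^sub>R b) - \<psi> y - h *\<^sub>R partial_deriv b \<psi> y"
    have nb: "norm b = 1" using assms(2) by simp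
    have "norm (?r y) \<le> (c * h ^ 2) / (1 + norm y) ^ ?N" for y
    proof -
      \<comment> \<open>Points of the segment lie within distance 1 of \<open>y\<close>, so the
        weight at \<open>y\<close> is at most twice the weight there.\<close>
      let ?B = "2 ^ ?N * jet_seminorm ?N 2 \<psi> / (1 + norm y) ^ ?N"
      have "norm (\<psi> (y + h *\<^sub>R b) - \<psi> y - (\<Sum>d\<in>Basis. ((y + h *\<^sub>R b - y) \<bullet> d) *\<^sub>R partial_deriv d \<psi> y))
          \<le> real DIM('a) * ?B * norm (y + h *\<^sub>R b - y) ^ 2"
      proof (rule smooth_taylor_segment[OF sm])
        fix z assume "z \<in> closed_segment y (y + h *\<^sub>R b)"
        then have "norm (y - z) \<le> 1" using segment_bound1[of z y "y + h *\<^sub>R b"] h nb by (simp add: norm_minus_commute)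
        then have "norm y \<le> norm z + 1"
          by (intro order_trans[OF norm_triangle_sub[of y z]] add_left_mono)
        then have "1 + norm y \<le> 2 * (1 + norm z)" using norm_ge_zero[of z] by argo
        then have "(1 + norm y) ^ ?N \<le> (2 * (1 + norm z)) ^ ?N" by (intro power_mono) auto
        then have "(1 + norm y) ^ ?N * jet 2 \<psi> z \<le> 2 ^ ?N * ((1 + norm z) ^ ?N * jet 2 \<psi> z)"
          by (simp only: power_mult_distrib mult.assoc[symmetric]) (intro mult_right_mono jet_nonneg)
        also have "\<dots> \<le> 2 ^ ?N * jet_seminorm ?N 2 \<psi>"
          by (intro mult_left_mono jet_seminorm_upper assms(1)) simp
        finally show "jet 2 \<psi> z \<le> ?B"
          by (simp only: pos_le_divide_eq weight_pos mult.commute)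
      qed
      moreover have "(\<Sum>d\<in>Basis. ((y + h *\<^sub>R b - y) \<bullet> d) *\<^sub>R partial_deriv d \<psi> y) = h *\<^sub>R partial_deriv b \<psi> y"
      proof -
        have "(\<Sum>d\<in>Basis. ((y + h *\<^sub>R b - y) \<bullet> d) *\<^sub>R partial_deriv d \<psi> y) =
            (\<Sum>d\<in>Basis. if d = b then h *\<^sub>R partial_deriv d \<psi> y else 0)"
          using assms(2) by (intro sum.cong) (auto simp: inner_Basis)
        then show ?thesis using assms(2) by simp
      qed
      ultimately show ?thesis using h nb by (simp add: c_def mult.assoc)
    qed
    then have "norm (\<integral>y. ?r y \<partial>lborel) \<le> weight_integral TYPE('a) * (c * h ^ 2)"
      using int by (intro norm_integral_decay) auto
    also have "(\<integral>y. ?r y \<partial>lborel) = - h *\<^sub>R I"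
      using int integral_translate[of \<psi> "h *\<^sub>R b"] schwartz_measurable[OF assms(1)]
      by (simp add: I_def)
    finally have "h * norm I \<le> h * (weight_integral TYPE('a) * c * h)"
      using h by (simp add: power2_eq_square algebra_simps)
    then show ?thesis using h by simp
  qed
  have "norm I \<le> (weight_integral TYPE('a) * c) * (1 / real (Suc n))" for n by (rule bound) auto
  moreover have "(\<lambda>n. (weight_integral TYPE('a) * c) * (1 / real (Suc n))) \<longlonglongrightarrow> 0"
    using LIMSEQ_inverse_real_of_nat by (intro tendsto_mult_right_zero) (simp add: inverse_eq_divide)
  ultimately have "norm I \<le> 0" using LIMSEQ_le_const by blast
  then show ?thesis by (simp add: I_def)
qed

text \<open>Integration by parts: the derivative of the product with the plane wave integrates to
  0.\<close>

lemma fourier_partial_deriv_aux: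
  assumes "\<phi> \<in> schwartz" "b \<in> Basis"
  shows "fourier (partial_deriv b \<phi>) \<xi> = 2 * pi * \<i> * (\<xi> \<bullet> b) * fourier \<phi> \<xi>"
proof -
  have sm: "smooth \<phi>" by (rule schwartz_smooth[OF assms(1)])
  have S: "(\<lambda>y. plane_wave \<xi> y * \<phi> y) \<in> schwartz" "(\<lambda>y. plane_wave \<xi> y * partial_deriv b \<phi> y) \<in> schwartz"
    by (intro schwartz_mult_plane_wave jet_seminorm_partial_deriv(1) assms)+
  have "partial_deriv b (\<lambda>y. plane_wave \<xi> y * \<phi> y) =
    (\<lambda>y. - (2 * pi * \<i> * (\<xi> \<bullet> b)) * (plane_wave \<xi> y * \<phi> y) + plane_wave \<xi> y * partial_deriv b \<phi> y)"
    by (subst partial_deriv_mult)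
      (simp_all add: smooth_differentiable[OF sm] smooth_differentiable[OF smooth_plane_wave] partial_deriv_plane_wave
        mult.assoc inner_commute)
  with integral_partial_deriv[OF S(1) assms(2)]
  have "(\<integral>y. - (2 * pi * \<i> * (\<xi> \<bullet> b)) * (plane_wave \<xi> y * \<phi> y) + plane_wave \<xi> y * partial_deriv b \<phi> y \<partial>lborel) = 0"
    by simp
  then have "- (2 * pi * \<i> * (\<xi> \<bullet> b)) * fourier \<phi> \<xi> + fourier (partial_deriv b \<phi>) \<xi> = 0"
    using S[THEN schwartz_integrable] unfolding fourier_def
    by (subst (asm) Bochner_Integration.integral_add) (simp_all add: mult.commute)
  then show ?thesis by simp
qed

text \<open>The norm of \<open>\<xi>\<close> is at most the sum of its coordinates in absolute
  value, and multiplying the transform by a coordinate amounts to differentiating the function, up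
  to the factor \<open>2 * pi\<close>, which exceeds 1. So each power costs one derivative, while
  the decay spent stays at \<open>DIM('a) + 2\<close>.\<close>

lemma fourier_decay:
  "\<exists>C\<ge>0. \<forall>\<phi>\<in>schwartz. \<forall>\<xi>::'a::euclidean_space. (1 + norm \<xi>) ^ k * norm (fourier \<phi> \<xi>) \<le> C * jet_seminorm (DIM('a) + 2) k \<phi>"
proof (induction k)
  case 0
  have "norm (fourier \<phi> \<xi>) \<le> weight_integral TYPE('a) * jet_seminorm (DIM('a) + 2) 0 \<phi>"
    if "\<phi> \<in> schwartz" for \<phi> and \<xi> :: 'a
    unfolding fourier_def
  proof (rule norm_integral_decay)
    have [measurable]: "\<phi> \<in> borel_measurable borel" using that by (rule schwartz_measurable)
    show "(\<lambda>y. \<phi> y * plane_wave \<xi> y) \<in> borel_measurable borel" by measurable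
    show "norm (\<phi> y * plane_wave \<xi> y) \<le> jet_seminorm (DIM('a) + 2) 0 \<phi> / (1 + norm y) ^ (DIM('a) + 2)" for y
      using schwartz_decay[OF that, of y "DIM('a) + 2"] by (simp only: norm_mult norm_plane_wave mult_1_right)
  qed
  then show ?case using weight_integral_nonneg[where 'a='a] by auto
next
  case (Suc k)
  let ?N = "DIM('a) + 2"
  from Suc obtain C where C: "C \<ge> 0" "\<And>\<phi> \<xi>::'a. \<phi> \<in> schwartz \<Longrightarrow>
      (1 + norm \<xi>) ^ k * norm (fourier \<phi> \<xi>) \<le> C * jet_seminorm ?N k \<phi>" by blast
  have "(1 + norm \<xi>) ^ Suc k * norm (fourier \<phi> \<xi>) \<le> ((1 + real DIM('a)) * C) * jet_seminorm ?N (Suc k) \<phi>"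
    if \<phi>: "\<phi> \<in> schwartz" for \<phi> and \<xi> :: 'a
  proof -
    have *: "\<bar>\<xi> \<bullet> b\<bar> * norm (fourier \<phi> \<xi>) \<le> norm (fourier (partial_deriv b \<phi>) \<xi>)" if "b \<in> Basis" for b
    proof -
      have "norm (fourier (partial_deriv b \<phi>) \<xi>) = (2 * pi) * (\<bar>\<xi> \<bullet> b\<bar> * norm (fourier \<phi> \<xi>))"
        by (simp add: fourier_partial_deriv_aux[OF \<phi> that] norm_mult)
      moreover have "1 * (\<bar>\<xi> \<bullet> b\<bar> * norm (fourier \<phi> \<xi>)) \<le> (2 * pi) * (\<bar>\<xi> \<bullet> b\<bar> * norm (fourier \<phi> \<xi>))"
        using pi_gt3 by (intro mult_right_mono) auto
      ultimately show ?thesis by simp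
    qed
    have "(1 + norm \<xi>) * norm (fourier \<phi> \<xi>) \<le> (1 + (\<Sum>b\<in>Basis. \<bar>\<xi> \<bullet> b\<bar>)) * norm (fourier \<phi> \<xi>)"
      by (intro mult_right_mono add_left_mono norm_le_l1) auto
    also have "\<dots> \<le> norm (fourier \<phi> \<xi>) + (\<Sum>b\<in>Basis. norm (fourier (partial_deriv b \<phi>) \<xi>))"
      using * by (simp add: distrib_right sum_distrib_right sum_mono)
    finally have "(1 + norm \<xi>) ^ Suc k * norm (fourier \<phi> \<xi>) \<le>
      (1 + norm \<xi>) ^ k * (norm (fourier \<phi> \<xi>) + (\<Sum>b\<in>Basis. norm (fourier (partial_deriv b \<phi>) \<xi>)))"
      unfolding power_Suc2 mult.assoc by (intro mult_left_mono) auto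
    also have "\<dots> = (1 + norm \<xi>) ^ k * norm (fourier \<phi> \<xi>) +
        (\<Sum>b\<in>Basis. (1 + norm \<xi>) ^ k * norm (fourier (partial_deriv b \<phi>) \<xi>))"
      by (simp add: distrib_left sum_distrib_left)
    also have "\<dots> \<le> C * jet_seminorm ?N (Suc k) \<phi> + (\<Sum>b\<in>(Basis::'a set). C * jet_seminorm ?N (Suc k) \<phi>)"
    proof (intro add_mono sum_mono)
      show "(1 + norm \<xi>) ^ k * norm (fourier \<phi> \<xi>) \<le> C * jet_seminorm ?N (Suc k) \<phi>"
        by (rule order_trans[OF C(2)[OF \<phi>]]) (intro mult_left_mono jet_seminorm_mono \<phi> C(1); simp)
      show "(1 + norm \<xi>) ^ k * norm (fourier (partial_deriv b \<phi>) \<xi>) \<le> C * jet_seminorm ?N (Suc k) \<phi>"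
        if b: "b \<in> Basis" for b
        by (rule order_trans[OF C(2)[OF jet_seminorm_partial_deriv(1)[OF \<phi> b]]])
          (intro mult_left_mono jet_seminorm_partial_deriv(2) \<phi> b C(1))
    qed
    also have "\<dots> = ((1 + real DIM('a)) * C) * jet_seminorm ?N (Suc k) \<phi>" by (simp add: algebra_simps)
    finally show ?thesis .
  qed
  then show ?case using C(1) by (intro exI[of _ "(1 + real DIM('a)) * C"]) auto
qed

text \<open>A derivative of the transform is the transform of the function times a linear form, so
  induction on \<open>m\<close> trades derivatives for decay until \<open>fourier_decay\<close>
  applies.\<close>

lemma jet_fourier:
  "\<exists>k' m' C. C \<ge> 0 \<and> (\<forall>\<phi>\<in>schwartz. \<forall>\<xi>::'a::euclidean_space.
     (1 + norm \<xi>) ^ k * jet m (fourier \<phi>) \<xi> \<le> C * jet_seminorm k' m' \<phi>)"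
proof (induction m)
  case 0
  then show ?case using fourier_decay[of k, where 'a='a] by auto
next
  case (Suc m)
  then obtain k' m' C where C: "C \<ge> 0" "\<And>\<phi> \<xi>::'a. \<phi> \<in> schwartz \<Longrightarrow>
      (1 + norm \<xi>) ^ k * jet m (fourier \<phi>) \<xi> \<le> C * jet_seminorm k' m' \<phi>" by blast
  obtain D where D: "D \<ge> 0" "\<And>v::'a. \<And>\<phi>. \<phi> \<in> schwartz \<Longrightarrow> (\<lambda>x. complex_of_real (x \<bullet> v) * \<phi> x) \<in> schwartz"
     "\<And>v::'a. \<And>\<phi>. \<phi> \<in> schwartz \<Longrightarrow> jet_seminorm k' m' (\<lambda>x. complex_of_real (x \<bullet> v) * \<phi> x) \<le> D * norm v * jet_seminorm (Suc k') m' \<phi>"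
    using schwartz_mult_linear[of k' m', where 'a='a] by blast
  obtain C0 where C0: "C0 \<ge> 0" "\<And>\<phi> \<xi>::'a. \<phi> \<in> schwartz \<Longrightarrow>
      (1 + norm \<xi>) ^ k * norm (fourier \<phi> \<xi>) \<le> C0 * jet_seminorm (DIM('a) + 2) k \<phi>"
    using fourier_decay[of k, where 'a='a] by blast
  define K M where "K = max (DIM('a) + 2) (Suc k')" and "M = max k m'"
  define E where "E = C0 + real DIM('a) * (C * (2 * pi * D))"
  have "(1 + norm \<xi>) ^ k * jet (Suc m) (fourier \<phi>) \<xi> \<le> E * jet_seminorm K M \<phi>"
    if \<phi>: "\<phi> \<in> schwartz" for \<phi> and \<xi> :: 'a
  proof -
    have 1: "(1 + norm \<xi>) ^ k * norm (fourier \<phi> \<xi>) \<le> C0 * jet_seminorm K M \<phi>"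
      by (rule order_trans[OF C0(2)[OF \<phi>]]) (intro mult_left_mono jet_seminorm_mono \<phi> C0(1); simp add: K_def M_def)
    have 2: "(1 + norm \<xi>) ^ k * jet m (partial_deriv b (fourier \<phi>)) \<xi> \<le> C * (2 * pi * D) * jet_seminorm K M \<phi>"
      if b: "b \<in> Basis" for b
    proof -
      let ?\<psi> = "\<lambda>y. complex_of_real (y \<bullet> b) * \<phi> y"
      have "(1 + norm \<xi>) ^ k * jet m (partial_deriv b (fourier \<phi>)) \<xi> \<le>
          C * jet_seminorm k' m' (\<lambda>y. - (2 * pi * \<i>) * ?\<psi> y)"
        unfolding partial_deriv_fourier[OF \<phi> b] by (intro C(2) schwartz_cmult D(2) \<phi>)
      also have "jet_seminorm k' m' (\<lambda>y. - (2 * pi * \<i>) * ?\<psi> y) \<le> 2 * pi * jet_seminorm k' m' ?\<psi>"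
        using schwartz_lincomb(2)[OF D(2)[OF \<phi>, of b] D(2)[OF \<phi>, of b], of k' m' "- (2 * pi * \<i>)" 0]
        by (simp add: norm_mult)
      also have "jet_seminorm k' m' ?\<psi> \<le> D * norm b * jet_seminorm (Suc k') m' \<phi>" by (rule D(3)[OF \<phi>])
      also have "\<dots> \<le> D * norm b * jet_seminorm K M \<phi>"
        using D(1) by (intro mult_left_mono jet_seminorm_mono \<phi>) (auto simp: K_def M_def)
      finally show ?thesis using b C(1) by (simp add: mult_left_mono mult.assoc)
    qed
    have "(1 + norm \<xi>) ^ k * jet (Suc m) (fourier \<phi>) \<xi> =
      (1 + norm \<xi>) ^ k * norm (fourier \<phi> \<xi>) + (\<Sum>b\<in>Basis. (1 + norm \<xi>) ^ k * jet m (partial_deriv b (fourier \<phi>)) \<xi>)"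
      by (simp add: distrib_left sum_distrib_left)
    also have "\<dots> \<le> C0 * jet_seminorm K M \<phi> + (\<Sum>b\<in>(Basis::'a set). C * (2 * pi * D) * jet_seminorm K M \<phi>)"
      by (intro add_mono sum_mono 1 2)
    also have "\<dots> = E * jet_seminorm K M \<phi>" by (simp add: E_def algebra_simps)
    finally show ?thesis .
  qed
  moreover have "E \<ge> 0" using C0(1) C(1) D(1) by (simp add: E_def)
  ultimately show ?case by blast
qed

lemma schwartz_continuous_fourier: "schwartz_continuous (fourier :: ('a::euclidean_space \<Rightarrow> complex) \<Rightarrow> _)"
  unfolding schwartz_continuous_def
proof (intro conjI ballI allI)
  fix \<phi> :: "'a \<Rightarrow> complex" assume "\<phi> \<in> schwartz"
  then show "fourier \<phi> \<in> schwartz"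
    unfolding schwartz_iff[of "fourier \<phi>"] using jet_fourier[where 'a='a] smooth_fourier by meson
next
  fix k m
  obtain k' m' C where "C \<ge> 0" "\<And>\<phi> \<xi>::'a. \<phi> \<in> schwartz \<Longrightarrow> (1 + norm \<xi>) ^ k * jet m (fourier \<phi>) \<xi> \<le> C * jet_seminorm k' m' \<phi>"
    using jet_fourier[of k m, where 'a='a] by blast
  then show "\<exists>k' m' C. C \<ge> 0 \<and> (\<forall>\<phi>::'a \<Rightarrow> complex\<in>schwartz. jet_seminorm k m (fourier \<phi>) \<le> C * jet_seminorm k' m' \<phi>)"
    by (intro exI[of _ k'] exI[of _ m'] exI[of _ C]) (auto intro: jet_seminorm_least)
qed

lemma fourier_schwartz: "\<phi> \<in> schwartz \<Longrightarrow> fourier \<phi> \<in> schwartz"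
  by (rule schwartz_continuousD[OF schwartz_continuous_fourier])

section \<open>Fubini and the inversion formula\<close>

lemma integrable_product_bound:
  fixes f :: "'a::euclidean_space \<Rightarrow> 'b::euclidean_space \<Rightarrow> complex"
  assumes [measurable]: "case_prod f \<in> borel_measurable (borel \<Otimes>\<^sub>M borel)"
    and AB: "integrable lborel A" "integrable lborel B"
    and bound: "\<And>x y. norm (f x y) \<le> A x * B y"
  shows "integrable (lborel \<Otimes>\<^sub>M lborel) (case_prod f)"
proof (rule Bochner_Integration.integrable_bound)
  have [measurable]: "A \<in> borel_measurable borel" "B \<in> borel_measurable borel"
    using AB by auto
  show "integrable (lborel \<Otimes>\<^sub>M lborel) (\<lambda>(x, y). A x * B y)"
  proof (rule lborel_pair.Fubini_integrable)
    have "(\<lambda>x. \<integral>y. norm (A x * B y) \<partial>lborel) = (\<lambda>x. \<bar>A x\<bar> * (\<integral>y. \<bar>B y\<bar> \<partial>lborel))"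
      by (simp add: abs_mult)
    then show "integrable lborel (\<lambda>x. \<integral>y. norm (case (x, y) of (x, y) \<Rightarrow> A x * B y) \<partial>lborel)"
      using AB by simp
    show "AE x in lborel. integrable lborel (\<lambda>y. case (x, y) of (x, y) \<Rightarrow> A x * B y)"
      using AB by simp
  qed measurable
  show "case_prod f \<in> borel_measurable (lborel \<Otimes>\<^sub>M lborel)" by simp
  show "AE z in lborel \<Otimes>\<^sub>M lborel. norm (case_prod f z) \<le> norm (case z of (x, y) \<Rightarrow> A x * B y)"
  proof (intro AE_I2)
    fix z
    show "norm (case_prod f z) \<le> norm (case z of (x, y) \<Rightarrow> A x * B y)"
      using bound[of "fst z" "snd z"] by (simp add: case_prod_beta)
  qed
qed

lemma integral_swap:
  fixes f :: "'a::euclidean_space \<Rightarrow> 'b::euclidean_space \<Rightarrow> complex"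
  assumes "case_prod f \<in> borel_measurable (borel \<Otimes>\<^sub>M borel)"
    and "integrable lborel A" "integrable lborel B"
    and "\<And>x y. norm (f x y) \<le> A x * B y"
  shows "(\<integral>y. (\<integral>x. f x y \<partial>lborel) \<partial>lborel) = (\<integral>x. (\<integral>y. f x y \<partial>lborel) \<partial>lborel)"
  by (rule lborel_pair.Fubini_integral[OF integrable_product_bound[OF assms]])

lemma fourier_multiplication:
  fixes a b :: "'a::euclidean_space \<Rightarrow> complex"
  assumes "integrable lborel a" "integrable lborel b"
  shows "(\<integral>\<xi>. fourier a \<xi> * b \<xi> \<partial>lborel) = (\<integral>y. a y * fourier b y \<partial>lborel)"
proof -
  have [measurable]: "a \<in> borel_measurable borel" "b \<in> borel_measurable borel"
    using assms by auto
  have "(\<integral>\<xi>. (\<integral>y. a y * plane_wave \<xi> y * b \<xi> \<partial>lborel) \<partial>lborel) =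
      (\<integral>y. (\<integral>\<xi>. a y * plane_wave \<xi> y * b \<xi> \<partial>lborel) \<partial>lborel)"
  proof (rule integral_swap)
    show "integrable lborel (\<lambda>x. norm (a x))" "integrable lborel (\<lambda>x. norm (b x))"
      using assms by auto
  qed (auto simp: norm_mult)
  moreover have "(\<integral>y. a y * plane_wave \<xi> y * b \<xi> \<partial>lborel) = fourier a \<xi> * b \<xi>" for \<xi>
    by (simp add: fourier_def)
  moreover have "(\<integral>\<xi>. a y * plane_wave \<xi> y * b \<xi> \<partial>lborel) = a y * fourier b y" for y
  proof -
    have "(\<integral>\<xi>. a y * plane_wave \<xi> y * b \<xi> \<partial>lborel) = (\<integral>\<xi>. a y * (b \<xi> * plane_wave y \<xi>) \<partial>lborel)"
      by (intro Bochner_Integration.integral_cong) (simp_all add: plane_wave_commute[of _ y] mult_ac)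
    then show ?thesis by (simp add: fourier_def)
  qed
  ultimately show ?thesis by (simp only:)
qed

lemma integral_scale:
  fixes f :: "'a::euclidean_space \<Rightarrow> complex"
  assumes [measurable]: "f \<in> borel_measurable borel" and "c > 0"
  shows "(\<integral>x. f x \<partial>lborel) = complex_of_real (c ^ DIM('a)) * (\<integral>x. f (c *\<^sub>R x) \<partial>lborel)"
proof -
  have "(\<integral>x. f x \<partial>lborel) = (\<integral>x. f x \<partial>density (distr lborel borel (\<lambda>x. 0 + c *\<^sub>R x)) (\<lambda>_. ennreal (\<bar>c\<bar> ^ DIM('a))))"
    using lborel_affine[of c "0::'a"] assms(2) by (simp add: ennreal_power)
  also have "\<dots> = (\<integral>x. (\<bar>c\<bar> ^ DIM('a)) *\<^sub>R f x \<partial>distr lborel borel (\<lambda>x. 0 + c *\<^sub>R x))"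
    by (subst integral_density) auto
  also have "\<dots> = (\<integral>x. (\<bar>c\<bar> ^ DIM('a)) *\<^sub>R f (0 + c *\<^sub>R x) \<partial>lborel)"
    by (subst integral_distr) auto
  finally show ?thesis using assms(2) by (simp add: scaleR_conv_of_real)
qed

lemma integrable_scale:
  fixes f :: "'a::euclidean_space \<Rightarrow> complex"
  assumes f: "integrable lborel f" and "c > 0"
  shows "integrable lborel (\<lambda>x. f (c *\<^sub>R x))"
proof -
  have [measurable]: "f \<in> borel_measurable borel" using f by auto
  have "integrable (density (distr lborel borel (\<lambda>x. 0 + c *\<^sub>R x)) (\<lambda>_. ennreal (\<bar>c\<bar> ^ DIM('a)))) f"
    using f lborel_affine[of c "0::'a"] assms(2) by (simp add: ennreal_power)
  then have "integrable (distr lborel borel (\<lambda>x. 0 + c *\<^sub>R x)) (\<lambda>x. (\<bar>c\<bar> ^ DIM('a)) *\<^sub>R f x)"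
    by (subst (asm) integrable_density) auto
  then have "integrable lborel (\<lambda>x. (\<bar>c\<bar> ^ DIM('a)) *\<^sub>R f (0 + c *\<^sub>R x))"
    by (subst (asm) integrable_distr_eq) auto
  from integrable_scaleR_right[OF this, of "inverse (\<bar>c\<bar> ^ DIM('a))"] show ?thesis using assms(2) by simp
qed

text \<open>Dilating the function dilates its transform inversely. With the multiplication formula
  this moves the dilation from one factor to the other, and the Jacobians cancel.\<close>

lemma fourier_regularised:
  fixes \<phi> \<psi> :: "'a::euclidean_space \<Rightarrow> complex"
  assumes \<phi>: "\<phi> \<in> schwartz" and \<psi>: "\<psi> \<in> schwartz" and c: "c > 0"
  shows "(\<integral>\<xi>. fourier \<phi> \<xi> * \<psi> (c *\<^sub>R \<xi>) \<partial>lborel) = (\<integral>u. \<phi> (c *\<^sub>R u) * fourier \<psi> u \<partial>lborel)"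
proof -
  note [measurable] = schwartz_measurable[OF \<phi>] schwartz_measurable[OF \<psi>]
    schwartz_measurable[OF fourier_schwartz[OF \<phi>]] schwartz_measurable[OF fourier_schwartz[OF \<psi>]]
  let ?d = "complex_of_real (c ^ DIM('a))"
  have d: "?d \<noteq> 0" using c by simp
  have F: "fourier \<phi> \<xi> = ?d * fourier (\<lambda>y. \<phi> (c *\<^sub>R y)) (c *\<^sub>R \<xi>)" for \<xi>
  proof -
    have "(\<lambda>y. \<phi> y * plane_wave \<xi> y) \<in> borel_measurable borel" by measurable
    from integral_scale[OF this c] show ?thesis
      by (simp add: fourier_def plane_wave_def)
  qed
  have "(\<integral>\<xi>. fourier \<phi> \<xi> * \<psi> (c *\<^sub>R \<xi>) \<partial>lborel) =
      ?d * (\<integral>\<xi>. fourier (\<lambda>y. \<phi> (c *\<^sub>R y)) (c *\<^sub>R \<xi>) * \<psi> (c *\<^sub>R \<xi>) \<partial>lborel)"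
    by (simp add: F mult.assoc)
  also have "\<dots> = (\<integral>\<xi>. fourier (\<lambda>y. \<phi> (c *\<^sub>R y)) \<xi> * \<psi> \<xi> \<partial>lborel)"
  proof (rule integral_scale[symmetric, OF _ c])
    have "fourier (\<lambda>y. \<phi> (c *\<^sub>R y)) = (\<lambda>\<xi>. fourier \<phi> (inverse c *\<^sub>R \<xi>) / ?d)"
      using d c F[of "inverse c *\<^sub>R _"] by (simp add: fun_eq_iff)
    then show "(\<lambda>\<xi>. fourier (\<lambda>y. \<phi> (c *\<^sub>R y)) \<xi> * \<psi> \<xi>) \<in> borel_measurable borel"
      by simp
  qed
  also have "\<dots> = (\<integral>u. \<phi> (c *\<^sub>R u) * fourier \<psi> u \<partial>lborel)"
    by (intro fourier_multiplication integrable_scale schwartz_integrable \<phi> \<psi> c)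
  finally show ?thesis .
qed

lemma schwartz_bounded: "\<phi> \<in> schwartz \<Longrightarrow> norm (\<phi> x) \<le> jet_seminorm 0 0 \<phi>"
  using schwartz_decay[of \<phi> x 0] by simp

text \<open>As the dilation in \<open>fourier_regularised\<close> tends to 0, the dilated factors
  tend to their values at 0. This is the inversion formula at the origin, with a constant that any
  one \<open>\<psi>\<close> with \<open>\<psi> 0\<close> nonzero determines.\<close>

lemma fourier_integral_proportional:
  fixes \<phi> \<psi> :: "'a::euclidean_space \<Rightarrow> complex"
  assumes \<phi>: "\<phi> \<in> schwartz" and \<psi>: "\<psi> \<in> schwartz"
  shows "(\<integral>\<xi>. fourier \<phi> \<xi> \<partial>lborel) * \<psi> 0 = \<phi> 0 * (\<integral>u. fourier \<psi> u \<partial>lborel)"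
proof -
  note [measurable] = schwartz_measurable[OF \<phi>] schwartz_measurable[OF \<psi>]
    schwartz_measurable[OF fourier_schwartz[OF \<phi>]] schwartz_measurable[OF fourier_schwartz[OF \<psi>]]
  have int: "integrable lborel (fourier \<phi>)" "integrable lborel (fourier \<psi>)"
    by (intro schwartz_integrable fourier_schwartz \<phi> \<psi>)+
  define c where "c n = 1 / real (Suc n)" for n
  have "c \<longlonglongrightarrow> 0" using LIMSEQ_inverse_real_of_nat by (simp add: c_def[abs_def] inverse_eq_divide)
  then have c0: "(\<lambda>n. c n *\<^sub>R x) \<longlonglongrightarrow> 0" for x :: 'a
    using tendsto_scaleR[OF _ tendsto_const[of x]] by fastforce
  have lim: "(\<lambda>n. \<eta> (c n *\<^sub>R x)) \<longlonglongrightarrow> \<eta> 0" if "\<eta> \<in> schwartz" for \<eta> :: "'a \<Rightarrow> complex" and x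
    using smooth_continuous_on[OF schwartz_smooth[OF that], of UNIV] c0
    by (intro isCont_tendsto_compose[of 0 \<eta>]) (auto simp: continuous_on_eq_continuous_at)
  have "(\<lambda>n. \<integral>\<xi>. fourier \<phi> \<xi> * \<psi> (c n *\<^sub>R \<xi>) \<partial>lborel) \<longlonglongrightarrow> (\<integral>\<xi>. fourier \<phi> \<xi> * \<psi> 0 \<partial>lborel)"
  proof (rule integral_dominated_convergence)
    show "integrable lborel (\<lambda>\<xi>. norm (fourier \<phi> \<xi>) * jet_seminorm 0 0 \<psi>)" using int by simp
    show "AE \<xi> in lborel. (\<lambda>n. fourier \<phi> \<xi> * \<psi> (c n *\<^sub>R \<xi>)) \<longlonglongrightarrow> fourier \<phi> \<xi> * \<psi> 0"
      by (intro AE_I2 tendsto_mult tendsto_const lim \<psi>)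
    show "AE \<xi> in lborel. norm (fourier \<phi> \<xi> * \<psi> (c n *\<^sub>R \<xi>)) \<le> norm (fourier \<phi> \<xi>) * jet_seminorm 0 0 \<psi>" for n
      unfolding norm_mult by (intro AE_I2 mult_left_mono schwartz_bounded \<psi>) simp
  qed measurable
  moreover have "(\<lambda>n. \<integral>u. \<phi> (c n *\<^sub>R u) * fourier \<psi> u \<partial>lborel) \<longlonglongrightarrow> (\<integral>u. \<phi> 0 * fourier \<psi> u \<partial>lborel)"
  proof (rule integral_dominated_convergence)
    show "integrable lborel (\<lambda>u. jet_seminorm 0 0 \<phi> * norm (fourier \<psi> u))" using int by simp
    show "AE u in lborel. (\<lambda>n. \<phi> (c n *\<^sub>R u) * fourier \<psi> u) \<longlonglongrightarrow> \<phi> 0 * fourier \<psi> u"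
      by (intro AE_I2 tendsto_mult tendsto_const lim \<phi>)
    show "AE u in lborel. norm (\<phi> (c n *\<^sub>R u) * fourier \<psi> u) \<le> jet_seminorm 0 0 \<phi> * norm (fourier \<psi> u)" for n
      unfolding norm_mult by (intro AE_I2 mult_right_mono schwartz_bounded \<phi>) simp
  qed measurable
  moreover have "(\<integral>\<xi>. fourier \<phi> \<xi> * \<psi> (c n *\<^sub>R \<xi>) \<partial>lborel) = (\<integral>u. \<phi> (c n *\<^sub>R u) * fourier \<psi> u \<partial>lborel)" for n
    by (rule fourier_regularised[OF \<phi> \<psi>]) (simp add: c_def)
  ultimately have "(\<integral>\<xi>. fourier \<phi> \<xi> * \<psi> 0 \<partial>lborel) = (\<integral>u. \<phi> 0 * fourier \<psi> u \<partial>lborel)"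
    using LIMSEQ_unique by fastforce
  then show ?thesis by simp
qed

text \<open>The set where a continuous function is nonzero is open, and a nonempty open set contains
  a ball and so has positive measure.\<close>

lemma continuous_AE_zero:
  fixes f :: "'a::euclidean_space \<Rightarrow> 'b::real_normed_vector"
  assumes cont: "continuous_on UNIV f" and ae: "AE x in lborel. f x = 0"
  shows "f x = 0"
proof (rule ccontr)
  assume "f x \<noteq> 0"
  have op: "open {y. f y \<noteq> 0}"
    using open_Collect_neq[OF cont continuous_on_const[of UNIV 0]] by simp
  then obtain r where r: "r > 0" "ball x r \<subseteq> {y. f y \<noteq> 0}"
    using \<open>f x \<noteq> 0\<close> by (auto elim!: openE)
  have "emeasure lborel {y. f y \<noteq> 0} = 0"
    using ae op by (subst (asm) AE_iff_measurable[of "{y. f y \<noteq> 0}"]) auto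
  then have "emeasure lborel (ball x r) = 0"
    using emeasure_mono[OF r(2), of lborel] op by auto
  then show False using r(1) using unit_ball_vol_pos[of "real DIM('a)"] by (simp add: emeasure_ball)
qed

lemma schwartz_square_integral_nonzero:
  fixes \<gamma> :: "'a::euclidean_space \<Rightarrow> complex"
  assumes \<gamma>: "\<gamma> \<in> schwartz" and "\<gamma> \<noteq> (\<lambda>_. 0)"
  shows "(\<integral>x. \<gamma> x * cnj (\<gamma> x) \<partial>lborel) \<noteq> 0"
proof
  assume "(\<integral>x. \<gamma> x * cnj (\<gamma> x) \<partial>lborel) = 0"
  then have "complex_of_real (\<integral>y. (norm (\<gamma> y))\<^sup>2 \<partial>lborel) = 0"
    by (simp only: complex_norm_square[symmetric] integral_complex_of_real)
  moreover have "integrable lborel (\<lambda>y. (norm (\<gamma> y))\<^sup>2)"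
    using schwartz_integrable[OF schwartz_mult[OF \<gamma> schwartz_cnj[OF \<gamma>]]]
    unfolding complex_norm_square[symmetric] by (simp only: complex_of_real_integrable_eq)
  ultimately have "AE y in lborel. (norm (\<gamma> y))\<^sup>2 = 0"
    using integral_nonneg_eq_0_iff_AE[of lborel "\<lambda>y. (norm (\<gamma> y))\<^sup>2"] by simp
  then have "AE y in lborel. \<gamma> y = 0" by simp
  then have "\<gamma> x = 0" for x by (rule continuous_AE_zero[OF smooth_continuous_on[OF schwartz_smooth[OF \<gamma>]]])
  with assms(2) show False by auto
qed

text \<open>The constant is in fact 1, but only its being nonzero matters below: this spares the
  computation of a Gaussian integral. It is nonzero because it relates the two \<open>L\<^sup>2\<close> norms in
  Plancherel's formula.\<close>

lemma fourier_inversion: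
  fixes g :: "'a::euclidean_space \<Rightarrow> complex"
  assumes g: "g \<in> schwartz" "g \<noteq> (\<lambda>_. 0)"
  obtains \<kappa> where "\<kappa> \<noteq> 0"
    "\<And>(\<phi>::'a \<Rightarrow> complex) x. \<phi> \<in> schwartz \<Longrightarrow> (\<integral>\<xi>. fourier \<phi> \<xi> * plane_wave (- x) \<xi> \<partial>lborel) = \<kappa> * \<phi> x"
proof -
  obtain a where a: "g a \<noteq> 0" using g(2) by auto
  define \<psi> where "\<psi> y = g (y + a)" for y
  have \<psi>: "\<psi> \<in> schwartz" using schwartz_translate(1)[OF g(1), of "- a"] by (simp add: \<psi>_def[abs_def])
  have \<psi>0: "\<psi> 0 \<noteq> 0" using a by (simp add: \<psi>_def)
  define \<kappa> where "\<kappa> = (\<integral>u. fourier \<psi> u \<partial>lborel) / \<psi> 0"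
  have at0: "(\<integral>\<xi>. fourier \<phi> \<xi> \<partial>lborel) = \<kappa> * \<phi> 0" if "\<phi> \<in> schwartz" for \<phi> :: "'a \<Rightarrow> complex"
    using fourier_integral_proportional[OF that \<psi>] \<psi>0 by (simp add: \<kappa>_def field_simps)
  have inv: "(\<integral>\<xi>. fourier \<phi> \<xi> * plane_wave (- x) \<xi> \<partial>lborel) = \<kappa> * \<phi> x" if \<phi>: "\<phi> \<in> schwartz"
    for \<phi> :: "'a \<Rightarrow> complex" and x
  proof -
    have S: "(\<lambda>y. \<phi> (y + x)) \<in> schwartz" using schwartz_translate(1)[OF \<phi>, of "- x"] by simp
    have [measurable]: "\<phi> \<in> borel_measurable borel" by (rule schwartz_measurable[OF \<phi>])
    have "fourier (\<lambda>y. \<phi> (y + x)) \<xi> = fourier \<phi> \<xi> * plane_wave (- x) \<xi>" for \<xi>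
    proof -
      have "fourier \<phi> \<xi> = (\<integral>y. \<phi> (y + x) * plane_wave \<xi> (y + x) \<partial>lborel)"
        unfolding fourier_def by (rule integral_translate[symmetric]) measurable
      also have "\<dots> = fourier (\<lambda>y. \<phi> (y + x)) \<xi> * plane_wave \<xi> x"
        unfolding fourier_def plane_wave_add_right by (simp add: mult.assoc[symmetric])
      finally have "fourier \<phi> \<xi> * plane_wave (- x) \<xi> = fourier (\<lambda>y. \<phi> (y + x)) \<xi> * (plane_wave \<xi> x * cnj (plane_wave \<xi> x))"
        by (simp add: plane_wave_minus plane_wave_commute[of x])
      also have "plane_wave \<xi> x * cnj (plane_wave \<xi> x) = 1" by (simp add: complex_norm_square[symmetric])
      finally show ?thesis by simp
    qed
    then show ?thesis using at0[OF S] by simp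
  qed
  have "\<kappa> \<noteq> 0"
  proof
    assume "\<kappa> = 0"
    \<comment> \<open>With constant 0, pairing a transform with its own conjugate by the
      multiplication formula gives 0, so every transform vanishes. But the transform of
      \<open>g * cnj g\<close> at 0 is the squared norm of \<open>g\<close>.\<close>
    have zero: "fourier \<phi> \<xi> = 0" if \<phi>: "\<phi> \<in> schwartz" for \<phi> :: "'a \<Rightarrow> complex" and \<xi>
    proof -
      let ?F = "fourier \<phi>"
      have F: "?F \<in> schwartz" by (rule fourier_schwartz[OF \<phi>])
      have "fourier (\<lambda>\<xi>. cnj (?F \<xi>)) y = cnj (\<integral>\<xi>. ?F \<xi> * plane_wave (- y) \<xi> \<partial>lborel)" for y
        unfolding fourier_def[of "\<lambda>\<xi>. cnj (?F \<xi>)"] by (simp only: Bochner_Integration.integral_cnj[symmetric] complex_cnj_mult plane_wave_minus complex_cnj_cnj)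
      then have "fourier (\<lambda>\<xi>. cnj (?F \<xi>)) y = 0" for y using inv[OF \<phi>] \<open>\<kappa> = 0\<close> by simp
      then have "(\<integral>\<xi>. ?F \<xi> * cnj (?F \<xi>) \<partial>lborel) = 0"
        using fourier_multiplication[OF schwartz_integrable[OF \<phi>] schwartz_integrable[OF schwartz_cnj[OF F]]] by simp
      then show ?thesis using schwartz_square_integral_nonzero[OF F] by metis
    qed
    have G: "(\<lambda>y. g y * cnj (g y)) \<in> schwartz" by (intro schwartz_mult schwartz_cnj g(1))
    have "(\<integral>y. g y * cnj (g y) \<partial>lborel) = 0"
      using zero[OF G, of 0] by (simp add: fourier_def)
    with schwartz_square_integral_nonzero[OF g] show False by contradiction
  qed
  with inv show ?thesis using that by blast
qed

section \<open>The symplectic Fourier transform on the Schwartz space\<close>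

text \<open>The standard symplectic matrix J. The symplectic form is the inner product of one
  argument with J of the other, so the symplectic Fourier transform is the ordinary one composed
  with an isometry.\<close>

definition sympl_rot :: "'a::euclidean_space \<times> 'a \<Rightarrow> 'a \<times> 'a" where
  "sympl_rot z = (snd z, - fst z)"

lemma sympl_form_eq: "sympl_form \<zeta> z = z \<bullet> sympl_rot \<zeta>"
  by (simp add: sympl_form_def sympl_rot_def inner_prod_def inner_commute split: prod.split)

lemma sympl_rot_sympl_rot [simp]: "sympl_rot (sympl_rot z) = - z"
  by (simp add: sympl_rot_def prod_eq_iff)

lemma sympl_rot_minus [simp]: "sympl_rot (- z) = - sympl_rot z"
  by (simp add: sympl_rot_def prod_eq_iff)

lemma inner_sympl_rot: "sympl_rot z \<bullet> w = - (z \<bullet> sympl_rot w)"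
  by (simp add: sympl_rot_def inner_prod_def inner_commute)

lemma norm_sympl_rot [simp]: "norm (sympl_rot z) = norm z"
  by (simp add: sympl_rot_def norm_prod_def add.commute)

lemma bounded_linear_sympl_rot: "bounded_linear sympl_rot"
  unfolding sympl_rot_def
  by (intro bounded_linear_Pair bounded_linear_snd bounded_linear_minus bounded_linear_fst)

lemma sympl_rot_measurable [measurable]: "sympl_rot \<in> borel_measurable borel"
  by (intro borel_measurable_continuous_onI linear_continuous_on bounded_linear_sympl_rot)

text \<open>The rotation is a sign change of the first component followed by the exchange of the
  components. The first map is diagonal with entries of modulus 1, the second preserves the product
  measure by symmetry.\<close>

lemma distr_sympl_rot: "distr lborel borel sympl_rot = (lborel :: ('a::euclidean_space \<times> 'a) measure)"
proof -
  let ?N = "\<lambda>z::'a \<times> 'a. (- fst z, snd z)"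
  let ?S = "\<lambda>z::'a \<times> 'a. (snd z, fst z)"
  have [measurable]: "?N \<in> borel_measurable borel" "?S \<in> borel_measurable borel"
    by (intro borel_measurable_continuous_onI continuous_intros)+
  \<comment> \<open>The basis vectors of the first factor are those whose second component
    vanishes.\<close>
  let ?c = "\<lambda>j::'a \<times> 'a. if snd j = 0 then - 1 else 1 :: real"
  have T: "0 + (\<Sum>j\<in>Basis. (?c j * (z \<bullet> j)) *\<^sub>R j) = ?N z" for z :: "'a \<times> 'a"
  proof -
    have "(\<Sum>j\<in>Basis. (?c j * (z \<bullet> j)) *\<^sub>R j) =
      (\<Sum>i\<in>Basis. (?c (i, 0) * (z \<bullet> (i, 0))) *\<^sub>R (i, 0)) + (\<Sum>j\<in>Basis. (?c (0, j) * (z \<bullet> (0, j))) *\<^sub>R (0, j))"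
      by (rule sum_Basis_prod_eq)
    also have "(\<Sum>i\<in>Basis. (?c (i, 0) * (z \<bullet> (i, 0))) *\<^sub>R (i, 0)) = (- (\<Sum>i\<in>Basis. (fst z \<bullet> i) *\<^sub>R i), 0 :: 'a)"
      by (simp add: inner_prod_def prod_eq_iff fst_sum snd_sum sum_negf)
    also have "(\<Sum>j\<in>Basis. (?c (0, j) * (z \<bullet> (0, j))) *\<^sub>R (0, j)) = (0 :: 'a, \<Sum>j\<in>Basis. (snd z \<bullet> j) *\<^sub>R j)"
      by (auto simp: inner_prod_def prod_eq_iff fst_sum snd_sum nonzero_Basis intro!: sum.cong)
    finally show ?thesis by (simp add: euclidean_representation)
  qed
  have prod: "(\<Prod>j\<in>(Basis :: ('a \<times> 'a) set). \<bar>?c j\<bar>) = 1" by (intro prod.neutral) simp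
  have "(lborel :: ('a \<times> 'a) measure) = density (distr lborel borel ?N) (\<lambda>_. 1)"
    using lborel_affine_euclidean[of ?c "0 :: 'a \<times> 'a"] unfolding T prod by simp
  then have N: "distr lborel borel ?N = (lborel :: ('a \<times> 'a) measure)" by (simp add: density_1)
  have "distr (lborel \<Otimes>\<^sub>M lborel) (lborel \<Otimes>\<^sub>M lborel) (\<lambda>(x, y). (y, x)) = (lborel \<Otimes>\<^sub>M lborel :: ('a \<times> 'a) measure)"
    by (rule lborel_pair.distr_pair_swap[symmetric])
  then have "distr lborel lborel ?S = (lborel :: ('a \<times> 'a) measure)"
    by (simp add: lborel_prod case_prod_beta')
  then have S: "distr lborel borel ?S = (lborel :: ('a \<times> 'a) measure)"
    by (simp cong: distr_cong)
  have "distr lborel borel sympl_rot = distr (distr lborel borel ?N) borel (?S :: 'a \<times> 'a \<Rightarrow> _)"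
    by (subst distr_distr) (simp_all add: o_def sympl_rot_def[abs_def])
  then show ?thesis by (simp only: N S)
qed

lemma integral_sympl_rot:
  fixes f :: "'a::euclidean_space \<times> 'a \<Rightarrow> complex"
  assumes "f \<in> borel_measurable borel"
  shows "(\<integral>z. f (sympl_rot z) \<partial>lborel) = (\<integral>z. f z \<partial>lborel)"
  using integral_distr[of sympl_rot lborel borel f] assms by (simp add: distr_sympl_rot)

lemma integral_reflect:
  fixes f :: "'a::euclidean_space \<Rightarrow> complex"
  assumes [measurable]: "f \<in> borel_measurable borel"
  shows "(\<integral>z. f (- z) \<partial>lborel) = (\<integral>z. f z \<partial>lborel)"
proof -
  have "distr lborel borel (\<lambda>x::'a. - x) = lborel"
    using lborel_affine[of "- 1" "0::'a"] by (simp add: density_1)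
  then show ?thesis using integral_distr[of uminus lborel borel f] by simp
qed

lemma sympl_fourier_eq: "sympl_fourier \<phi> \<zeta> = fourier \<phi> (sympl_rot \<zeta>)"
  unfolding sympl_fourier_def fourier_def plane_wave_def sympl_form_eq by (simp add: mult.commute)

lemma schwartz_continuous_isometry:
  fixes L :: "'a::euclidean_space \<Rightarrow> 'b::euclidean_space"
  assumes "bounded_linear L" "\<And>x. norm (L x) = norm x"
  shows "schwartz_continuous (\<lambda>\<phi> x. \<phi> (L x))"
  unfolding schwartz_continuous_def
  using schwartz_compose_isometry[OF assms] by meson

lemma schwartz_continuous_sympl_fourier: "schwartz_continuous sympl_fourier"
proof -
  have "schwartz_continuous (\<lambda>\<phi>. (\<lambda>\<psi> \<zeta>. \<psi> (sympl_rot \<zeta>)) (fourier \<phi>))"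
    by (rule schwartz_continuous_compose[OF schwartz_continuous_isometry schwartz_continuous_fourier])
      (simp_all add: bounded_linear_sympl_rot)
  then show ?thesis by (simp add: sympl_fourier_eq[abs_def])
qed

lemma sympl_fourier_schwartz: "\<phi> \<in> schwartz \<Longrightarrow> sympl_fourier \<phi> \<in> schwartz"
  by (rule schwartz_continuousD[OF schwartz_continuous_sympl_fourier])

lemma schwartz_reflect: "\<phi> \<in> schwartz \<Longrightarrow> (\<lambda>x. \<phi> (- x)) \<in> schwartz"
  by (rule schwartz_continuousD[OF schwartz_continuous_isometry])
    (auto intro: bounded_linear_minus bounded_linear_ident)

lemma fourier_lincomb:
  assumes "\<phi> \<in> schwartz" "\<psi> \<in> schwartz"
  shows "fourier (\<lambda>x. a * \<phi> x + b * \<psi> x) \<xi> = a * fourier \<phi> \<xi> + b * fourier \<psi> \<xi>"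
proof -
  have int: "integrable lborel (\<lambda>y. \<phi> y * plane_wave \<xi> y)" "integrable lborel (\<lambda>y. \<psi> y * plane_wave \<xi> y)"
    using assms[THEN schwartz_mult_plane_wave, THEN schwartz_integrable] by (simp_all add: mult.commute)
  have "fourier (\<lambda>x. a * \<phi> x + b * \<psi> x) \<xi> =
      (\<integral>y. a * (\<phi> y * plane_wave \<xi> y) + b * (\<psi> y * plane_wave \<xi> y) \<partial>lborel)"
    by (simp add: fourier_def algebra_simps)
  also have "\<dots> = a * fourier \<phi> \<xi> + b * fourier \<psi> \<xi>"
    using int by (simp add: fourier_def)
  finally show ?thesis .
qed

lemma sympl_fourier_lincomb:
  "\<phi> \<in> schwartz \<Longrightarrow> \<psi> \<in> schwartz \<Longrightarrow>
    sympl_fourier (\<lambda>x. a * \<phi> x + b * \<psi> x) = (\<lambda>\<zeta>. a * sympl_fourier \<phi> \<zeta> + b * sympl_fourier \<psi> \<zeta>)"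
  by (simp add: sympl_fourier_eq fun_eq_iff fourier_lincomb)

lemma sympl_fourier_cmult:
  "\<phi> \<in> schwartz \<Longrightarrow> sympl_fourier (\<lambda>x. a * \<phi> x) = (\<lambda>\<zeta>. a * sympl_fourier \<phi> \<zeta>)"
  using sympl_fourier_lincomb[of \<phi> \<phi> a 0] by simp

lemma sympl_fourier_reflect:
  assumes "\<phi> \<in> schwartz"
  shows "sympl_fourier (\<lambda>z. \<phi> (- z)) = (\<lambda>\<zeta>. sympl_fourier \<phi> (- \<zeta>))"
proof
  fix \<zeta> :: "'a \<times> 'a"
  have [measurable]: "\<phi> \<in> borel_measurable borel" by (rule schwartz_measurable[OF assms])
  have "sympl_fourier (\<lambda>z. \<phi> (- z)) \<zeta> = (\<integral>z. (\<lambda>w. \<phi> w * plane_wave (sympl_rot (- \<zeta>)) w) (- z) \<partial>lborel)"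
    by (simp add: sympl_fourier_eq fourier_def plane_wave_def)
  also have "\<dots> = sympl_fourier \<phi> (- \<zeta>)"
    unfolding sympl_fourier_eq fourier_def by (rule integral_reflect) measurable
  finally show "sympl_fourier (\<lambda>z. \<phi> (- z)) \<zeta> = sympl_fourier \<phi> (- \<zeta>)" .
qed

text \<open>The constant is a bare complex number, so the \<open>itself\<close> argument records the
  space to which it belongs. As a parameter it lets the operators below be defined before a nonzero
  Schwartz function is at hand.\<close>

definition inversion_constant :: "'a::euclidean_space itself \<Rightarrow> complex \<Rightarrow> bool" where
  "inversion_constant _ \<kappa> \<longleftrightarrow> \<kappa> \<noteq> 0 \<and> (\<forall>\<phi>\<in>schwartz. \<forall>x::'a.
     (\<integral>\<xi>. fourier \<phi> \<xi> * plane_wave (- x) \<xi> \<partial>lborel) = \<kappa> * \<phi> x)"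

text \<open>The symplectic form is antisymmetric, so the second application already supplies the
  conjugate wave of the inversion formula and no reflection remains.\<close>

lemma sympl_fourier_involution:
  assumes \<kappa>: "inversion_constant TYPE('a::euclidean_space \<times> 'a) \<kappa>" and \<phi>: "\<phi> \<in> schwartz"
  shows "sympl_fourier (sympl_fourier \<phi>) = (\<lambda>z::'a \<times> 'a. \<kappa> * \<phi> z)"
proof
  fix z :: "'a \<times> 'a"
  have [measurable]: "fourier \<phi> \<in> borel_measurable borel" by (intro schwartz_measurable fourier_schwartz \<phi>)
  have "plane_wave (sympl_rot z) w = plane_wave (- z) (sympl_rot w)" for w
    by (simp add: plane_wave_def inner_sympl_rot)
  then have "sympl_fourier (sympl_fourier \<phi>) z = (\<integral>w. (\<lambda>v. fourier \<phi> v * plane_wave (- z) v) (sympl_rot w) \<partial>lborel)"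
    unfolding sympl_fourier_eq by (simp add: fourier_def[of "\<lambda>\<zeta>. fourier \<phi> (sympl_rot \<zeta>)"])
  also have "\<dots> = (\<integral>v. fourier \<phi> v * plane_wave (- z) v \<partial>lborel)"
    by (rule integral_sympl_rot) measurable
  also have "\<dots> = \<kappa> * \<phi> z" using \<kappa> \<phi> unfolding inversion_constant_def by blast
  finally show "sympl_fourier (sympl_fourier \<phi>) z = \<kappa> * \<phi> z" .
qed

section \<open>The multiplier as a superposition of chirps\<close>

definition chirp :: "real \<Rightarrow> 'a::euclidean_space \<times> 'a \<Rightarrow> complex" where
  "chirp s z = cis (2 * pi * s * (fst z \<bullet> snd z))"

lemma norm_chirp [simp]: "norm (chirp s z) = 1"
  by (simp add: chirp_def)

lemma chirp_measurable [measurable]: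
  assumes [measurable]: "f \<in> borel_measurable M" "h \<in> borel_measurable M"
  shows "(\<lambda>t. chirp (f t) (h t)) \<in> borel_measurable M"
proof -
  have [measurable]: "cis \<in> borel_measurable borel" "fst \<in> borel_measurable (borel :: ('b \<times> 'b) measure)"
    "snd \<in> borel_measurable (borel :: ('b \<times> 'b) measure)"
    by (intro borel_measurable_continuous_onI continuous_intros)+
  show ?thesis unfolding chirp_def by measurable
qed

text \<open>The classical transform of the box function; for nonzero \<open>t\<close> by the
  fundamental theorem of calculus.\<close>

lemma nsinc_integral:
  "(\<integral>s. indicator {-1/2..1/2} s *\<^sub>R cis (2 * pi * s * t) \<partial>lborel) = complex_of_real (nsinc t)"
proof (cases "t = 0")
  case True
  have "(\<integral>s. indicator {-1/2..1/2::real} s *\<^sub>R (1::complex) \<partial>lborel) = 1"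
    by (simp add: scaleR_conv_of_real)
  with True show ?thesis by (simp add: nsinc_def)
next
  case False
  define F where "F s = cis (2 * pi * s * t) / (2 * pi * \<i> * t)" for s
  have "(\<integral>s. indicator {-1/2..1/2} s *\<^sub>R cis (2 * pi * s * t) \<partial>lborel) = F (1/2) - F (-1/2)"
  proof (rule integral_FTC_atLeastAtMost)
    show "(F has_vector_derivative cis (2 * pi * s * t)) (at s within {-1/2..1/2})" for s
      unfolding F_def has_vector_derivative_def using False
      by (auto intro!: derivative_eq_intros simp: fun_eq_iff scaleR_conv_of_real field_simps)
  qed (auto intro!: continuous_intros)
  also have "\<dots> = (cis (pi * t) - cis (- (pi * t))) / (2 * pi * \<i> * t)"
    by (simp add: F_def diff_divide_distrib)
  also have "cis (pi * t) - cis (- (pi * t)) = 2 * \<i> * complex_of_real (sin (pi * t))"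
    by (simp add: complex_eq_iff)
  finally show ?thesis using False by (simp add: nsinc_def)
qed

lemma Theta_eq: "Theta z = (\<integral>s. indicator {-1/2..1/2} s *\<^sub>R chirp s z \<partial>lborel)"
  unfolding chirp_def nsinc_integral by (simp add: Theta_def case_prod_beta)

lemma Theta_measurable [measurable]: "Theta \<in> borel_measurable (borel :: ('a::euclidean_space \<times> 'a) measure)"
  unfolding Theta_eq[abs_def] by (rule lborel.borel_measurable_lebesgue_integral) measurable

lemma Theta_minus [simp]: "Theta (- z) = Theta z"
  by (simp add: Theta_def case_prod_beta)

lemma Theta_sympl_rot [simp]: "Theta (sympl_rot z) = Theta z"
  by (simp add: Theta_def case_prod_beta sympl_rot_def nsinc_def inner_commute)

section \<open>Derivatives of chirps and of the multiplier\<close>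

lemma chirp_has_derivative:
  "(chirp s has_derivative (\<lambda>h. 2 * pi * \<i> * s * (z \<bullet> prod.swap h) * chirp s z)) (at z)"
  unfolding chirp_def[abs_def]
  by (auto intro!: derivative_eq_intros
      simp: fun_eq_iff scaleR_conv_of_real inner_prod_def inner_commute algebra_simps)

lemma partial_deriv_chirp:
  "partial_deriv b (chirp s) = (\<lambda>z. (2 * pi * \<i> * s) * (complex_of_real (z \<bullet> prod.swap b) * chirp s z))"
  by (rule ext, subst partial_deriv_eqI[OF chirp_has_derivative]) (simp add: mult.assoc)

text \<open>Differentiation multiplies a chirp by a linear form, so the products of smooth functions
  with a fixed chirp form a class that is closed under derivatives.\<close>

lemma smooth_chirp: "smooth (chirp s)"
proof (rule smooth_coinduct[of "\<lambda>\<psi>. \<exists>u. smooth u \<and> \<psi> = (\<lambda>z. u z * chirp s z)"])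
  have d: "chirp s differentiable at z" for z :: "'a \<times> 'a"
    using chirp_has_derivative unfolding differentiable_def by blast
  show "\<exists>u. smooth u \<and> \<psi> = (\<lambda>z. u z * chirp s z) \<Longrightarrow> \<psi> differentiable at x" for \<psi> and x :: "'a \<times> 'a"
    using d[of x] by (auto intro!: differentiable_mult intro: smooth_differentiable)
  fix \<psi> :: "'a \<times> 'a \<Rightarrow> complex" and b :: "'a \<times> 'a"
  assume "\<exists>u. smooth u \<and> \<psi> = (\<lambda>z. u z * chirp s z)" and b: "b \<in> Basis"
  then obtain u where u: "smooth u" "\<psi> = (\<lambda>z. u z * chirp s z)" by blast
  let ?v = "\<lambda>z. partial_deriv b u z + u z * ((2 * pi * \<i> * s) * complex_of_real (z \<bullet> prod.swap b))"
  have "partial_deriv b \<psi> = (\<lambda>z. ?v z * chirp s z)"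
    unfolding u(2) using d u(1)
    by (subst partial_deriv_mult) (auto simp: smooth_differentiable partial_deriv_chirp algebra_simps)
  moreover have "smooth ?v"
    by (intro smooth_add smooth_mult smooth_partial_deriv smooth_const smooth_linear_functional u b)
  ultimately show "\<exists>u. smooth u \<and> partial_deriv b \<psi> = (\<lambda>z. u z * chirp s z)" by blast
qed (auto intro!: exI[of _ "\<lambda>_. 1"])

text \<open>Each derivative brings out one linear factor, hence one power of the weight. On the
  interval \<open>2 * pi * \<bar>s\<bar>\<close> is at most \<open>pi\<close>, which makes the bound
  uniform in \<open>s\<close>.\<close>

lemma jet_chirp:
  "\<exists>C\<ge>0. \<forall>s. \<bar>s\<bar> \<le> 1/2 \<longrightarrow> (\<forall>z::'a::euclidean_space \<times> 'a. jet m (chirp s) z \<le> C * (1 + norm z) ^ m)"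
proof (induction m)
  case 0
  then show ?case by (intro exI[of _ 1]) simp
next
  case (Suc m)
  then obtain C where C: "C \<ge> 0" "\<And>s (z::'a \<times> 'a). \<bar>s\<bar> \<le> 1/2 \<Longrightarrow> jet m (chirp s) z \<le> C * (1 + norm z) ^ m"
    by blast
  obtain D where D: "D \<ge> 0" "\<And>\<phi> \<psi>::'a \<times> 'a \<Rightarrow> complex. \<And>x. smooth \<phi> \<Longrightarrow> smooth \<psi> \<Longrightarrow>
     jet m (\<lambda>x. \<phi> x * \<psi> x) x \<le> D * (jet m \<phi> x * jet m \<psi> x)"
    using jet_mult[of m, where 'a="'a \<times> 'a"] by blast
  define n where "n = real DIM('a \<times> 'a)"
  define E where "E = 1 + n * (pi * (D * ((1 + n) * C)))"
  have "jet (Suc m) (chirp s) z \<le> E * (1 + norm z) ^ Suc m" if s: "\<bar>s\<bar> \<le> 1/2" for s and z :: "'a \<times> 'a"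
  proof -
    have "jet m (partial_deriv b (chirp s)) z \<le> pi * (D * ((1 + n) * C)) * (1 + norm z) ^ Suc m"
      if b: "b \<in> Basis" for b :: "'a \<times> 'a"
    proof -
      let ?l = "\<lambda>z::'a \<times> 'a. complex_of_real (z \<bullet> prod.swap b)"
      have nb: "norm (prod.swap b) = 1"
        using b norm_Basis[of b] by (simp add: norm_prod_def prod.swap_def add.commute)
      have "jet m (partial_deriv b (chirp s)) z = norm (2 * pi * \<i> * s) * jet m (\<lambda>z. ?l z * chirp s z) z"
        unfolding partial_deriv_chirp
        by (rule jet_cmult) (intro smooth_mult smooth_linear_functional smooth_chirp)
      also have "\<dots> \<le> pi * (D * (jet m ?l z * jet m (chirp s) z))"
        using s by (intro mult_mono D(2) smooth_linear_functional smooth_chirp) (auto simp: norm_mult)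
      also have "\<dots> \<le> pi * (D * (((1 + n) * 1 * (1 + norm z)) * (C * (1 + norm z) ^ m)))"
        using jet_linear_functional[of m "prod.swap b" z] nb
        by (intro mult_left_mono mult_mono C(2) s D(1)) (auto simp: n_def)
      also have "\<dots> = pi * (D * ((1 + n) * C)) * (1 + norm z) ^ Suc m" by (simp add: algebra_simps)
      finally show ?thesis .
    qed
    then have "(\<Sum>b\<in>Basis. jet m (partial_deriv b (chirp s)) z) \<le> n * (pi * (D * ((1 + n) * C)) * (1 + norm z) ^ Suc m)"
      unfolding n_def by (intro sum_bounded_above)
    moreover have "1 \<le> (1 + norm z) ^ Suc m" by (intro one_le_power) simp
    moreover have "jet (Suc m) (chirp s) z = 1 + (\<Sum>b\<in>Basis. jet m (partial_deriv b (chirp s)) z)" by simp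
    moreover have "E * (1 + norm z) ^ Suc m = (1 + norm z) ^ Suc m + n * (pi * (D * ((1 + n) * C)) * (1 + norm z) ^ Suc m)"
      by (simp only: E_def distrib_right mult_1 mult.assoc)
    ultimately show ?thesis by linarith
  qed
  moreover have "E \<ge> 0" using C(1) D(1) by (simp add: E_def n_def)
  ultimately show ?case by blast
qed

lemma jet_chirp_mult:
  "\<exists>C\<ge>0. \<forall>s. \<bar>s\<bar> \<le> 1/2 \<longrightarrow> (\<forall>\<phi>\<in>schwartz. \<forall>z::'a::euclidean_space \<times> 'a.
     (1 + norm z) ^ k * jet m (\<lambda>z. chirp s z * \<phi> z) z \<le> C * jet_seminorm (k + m) m \<phi>)"
proof -
  obtain C where C: "C \<ge> 0" "\<And>s (z::'a \<times> 'a). \<bar>s\<bar> \<le> 1/2 \<Longrightarrow> jet m (chirp s) z \<le> C * (1 + norm z) ^ m"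
    using jet_chirp[of m, where 'a='a] by blast
  obtain D where D: "D \<ge> 0" "\<And>\<theta> \<phi>::'a \<times> 'a \<Rightarrow> complex. \<And>A K x. smooth \<theta> \<Longrightarrow> (\<forall>x. jet m \<theta> x \<le> A * (1 + norm x) ^ K) \<Longrightarrow>
      \<phi> \<in> schwartz \<Longrightarrow> (1 + norm x) ^ k * jet m (\<lambda>x. \<theta> x * \<phi> x) x \<le> D * A * jet_seminorm (k + K) m \<phi>"
    using schwartz_multiplier[of m k, where 'a="'a \<times> 'a"] by blast
  show ?thesis
    using C D(1) D(2)[OF smooth_chirp] by (intro exI[of _ "D * C"]) auto
qed

lemma chirp_mult_schwartz:
  fixes \<phi> :: "'a::euclidean_space \<times> 'a \<Rightarrow> complex"
  assumes "\<phi> \<in> schwartz" "\<bar>s\<bar> \<le> 1/2"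
  shows "(\<lambda>z. chirp s z * \<phi> z) \<in> schwartz"
  unfolding schwartz_iff[of "\<lambda>z. chirp s z * \<phi> z"]
proof (intro conjI allI)
  show "smooth (\<lambda>z. chirp s z * \<phi> z)" by (intro smooth_mult smooth_chirp schwartz_smooth assms)
  show "\<exists>c. \<forall>z. (1 + norm z) ^ k * jet m (\<lambda>z. chirp s z * \<phi> z) z \<le> c" for k m
    using jet_chirp_mult[of k m, where 'a='a] assms by blast
qed

text \<open>The derivatives of \<open>Theta\<close> are controlled through this family: chirps have
  explicit derivatives, and only parameters in an interval of length 1 contribute, so a constant on
  that interval is a majorant.\<close>

lemma Theta_mult_family:
  fixes \<phi> :: "'a::euclidean_space \<times> 'a \<Rightarrow> complex"
  assumes "\<phi> \<in> schwartz"
  shows "smooth_family lborel (\<lambda>s z. indicator {-1/2..1/2::real} s * (chirp s z * \<phi> z))"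
  unfolding smooth_family_def
proof (intro conjI allI)
  show "smooth (\<lambda>z. indicator {-1/2..1/2::real} s * (chirp s z * \<phi> z))" for s
    by (intro smooth_cmult smooth_mult smooth_chirp schwartz_smooth assms)
  show "(\<lambda>s. indicator {-1/2..1/2::real} s * (chirp s z * \<phi> z)) \<in> borel_measurable lborel" for z
    by measurable
  fix m
  obtain C where C: "C \<ge> 0" "\<And>s (z::'a \<times> 'a). \<bar>s\<bar> \<le> 1/2 \<Longrightarrow>
     (1 + norm z) ^ 0 * jet m (\<lambda>z. chirp s z * \<phi> z) z \<le> C * jet_seminorm (0 + m) m \<phi>"
    using jet_chirp_mult[of 0 m, where 'a='a] assms by blast
  have "jet m (\<lambda>z. indicator {-1/2..1/2::real} s * (chirp s z * \<phi> z)) z \<le> indicator {-1/2..1/2} s * (C * jet_seminorm (0 + m) m \<phi>)" for s z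
    using C(2)[of s z] by (auto simp: indicator_def abs_le_iff jet_const)
  moreover have "integrable lborel (\<lambda>s. indicator {-1/2..1/2::real} s * (C * jet_seminorm (0 + m) m \<phi>))"
    by (intro integrable_mult_left integrable_real_indicator) auto
  ultimately show "\<exists>G. integrable lborel G \<and> (\<forall>s z. jet m (\<lambda>z. indicator {-1/2..1/2::real} s * (chirp s z * \<phi> z)) z \<le> G s)"
    by blast
qed

lemma Theta_mult_eq:
  "(\<lambda>z. Theta z * \<phi> z) = (\<lambda>z. \<integral>s. indicator {-1/2..1/2::real} s * (chirp s z * \<phi> z) \<partial>lborel)"
  unfolding Theta_eq
  by (rule ext, subst Bochner_Integration.integral_mult_left_zero[symmetric])
    (auto intro!: Bochner_Integration.integral_cong simp: indicator_def)

text \<open>The bound for chirps is uniform in \<open>s\<close>; averaged over an interval of length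
  1 it holds for \<open>Theta\<close> with the same constant.\<close>

lemma schwartz_continuous_Theta:
  "schwartz_continuous (\<lambda>\<phi> z::'a::euclidean_space \<times> 'a. Theta z * \<phi> z)"
proof -
  have *: "\<exists>C\<ge>0. \<forall>\<phi>\<in>schwartz. \<forall>z::'a \<times> 'a. (1 + norm z) ^ k * jet m (\<lambda>z. Theta z * \<phi> z) z
      \<le> C * jet_seminorm (k + m) m \<phi>" for k m
  proof -
    obtain C where C: "C \<ge> 0" "\<And>s \<phi> (z::'a \<times> 'a). \<bar>s\<bar> \<le> 1/2 \<Longrightarrow> \<phi> \<in> schwartz \<Longrightarrow>
        (1 + norm z) ^ k * jet m (\<lambda>z. chirp s z * \<phi> z) z \<le> C * jet_seminorm (k + m) m \<phi>"
      using jet_chirp_mult[of k m, where 'a='a] by blast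
    have "(1 + norm z) ^ k * jet m (\<lambda>z. Theta z * \<phi> z) z \<le> C * jet_seminorm (k + m) m \<phi>"
      if \<phi>: "\<phi> \<in> schwartz" for \<phi> and z :: "'a \<times> 'a"
    proof -
      let ?u = "\<lambda>s z. indicator {-1/2..1/2::real} s * (chirp s z * \<phi> z)"
      have fam: "smooth_family lborel ?u" by (rule Theta_mult_family[OF \<phi>])
      have "(1 + norm z) ^ k * jet m (\<lambda>z. Theta z * \<phi> z) z \<le> (1 + norm z) ^ k * (\<integral>s. jet m (?u s) z \<partial>lborel)"
        unfolding Theta_mult_eq by (intro mult_left_mono jet_integral_le fam) simp
      also have "\<dots> = (\<integral>s. (1 + norm z) ^ k * jet m (?u s) z \<partial>lborel)" by simp
      also have "\<dots> \<le> (\<integral>s. indicator {-1/2..1/2::real} s * (C * jet_seminorm (k + m) m \<phi>) \<partial>lborel)"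
      proof (rule integral_mono)
        show "integrable lborel (\<lambda>s. (1 + norm z) ^ k * jet m (?u s) z)"
          by (intro integrable_mult_right jet_integrable fam)
        show "integrable lborel (\<lambda>s. indicator {-1/2..1/2::real} s * (C * jet_seminorm (k + m) m \<phi>))"
          by (intro integrable_mult_left integrable_real_indicator) auto
        show "(1 + norm z) ^ k * jet m (?u s) z \<le> indicator {-1/2..1/2::real} s * (C * jet_seminorm (k + m) m \<phi>)" for s
          using C(2)[OF _ \<phi>, of s z] by (auto simp: indicator_def abs_le_iff jet_const)
      qed
      also have "\<dots> = C * jet_seminorm (k + m) m \<phi>" by simp
      finally show ?thesis .
    qed
    then show ?thesis using C(1) by blast
  qed
  show ?thesis
    unfolding schwartz_continuous_def
  proof (intro conjI ballI allI)
    show "(\<lambda>z. Theta z * \<phi> z) \<in> schwartz" if \<phi>: "\<phi> \<in> schwartz" for \<phi> :: "'a \<times> 'a \<Rightarrow> complex"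
    proof -
      have "smooth (\<lambda>z. Theta z * \<phi> z)"
        unfolding Theta_mult_eq by (rule smooth_integral[OF Theta_mult_family[OF \<phi>]])
      then show ?thesis unfolding schwartz_iff[of "\<lambda>z. Theta z * \<phi> z"] using * \<phi> by blast
    qed
    fix k m
    obtain C where "C \<ge> 0" "\<And>\<phi> (z::'a \<times> 'a). \<phi> \<in> schwartz \<Longrightarrow>
        (1 + norm z) ^ k * jet m (\<lambda>z. Theta z * \<phi> z) z \<le> C * jet_seminorm (k + m) m \<phi>"
      using *[of k m] by blast
    then show "\<exists>k' m' C. C \<ge> 0 \<and> (\<forall>\<phi>::'a \<times> 'a \<Rightarrow> complex\<in>schwartz. jet_seminorm k m (\<lambda>z. Theta z * \<phi> z) \<le> C * jet_seminorm k' m' \<phi>)"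
      by (intro exI[of _ "k + m"] exI[of _ m] exI[of _ C]) (auto intro: jet_seminorm_least)
  qed
qed

lemma Theta_mult_schwartz: "\<phi> \<in> schwartz \<Longrightarrow> (\<lambda>z. Theta z * \<phi> z) \<in> schwartz"
  by (rule schwartz_continuousD[OF schwartz_continuous_Theta])

section \<open>The Born--Jordan distribution as a transposed operator\<close>

definition bj_op :: "('a::euclidean_space \<times> 'a \<Rightarrow> complex) \<Rightarrow> 'a \<times> 'a \<Rightarrow> complex" where
  "bj_op \<phi> = sympl_fourier (\<lambda>z. Theta z * sympl_fourier \<phi> z)"

text \<open>Two applications of \<open>sympl_fourier\<close> give the identity only up to
  \<open>\<kappa>\<close>, hence the factor.\<close>

definition bj_dist :: "complex \<Rightarrow> ('a::euclidean_space \<times> 'a) functional \<Rightarrow> ('a \<times> 'a) functional" where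
  "bj_dist \<kappa> T = dual_op (\<lambda>\<phi> z. inverse \<kappa> * bj_op \<phi> z) T"

lemma schwartz_continuous_bj_op: "schwartz_continuous bj_op"
  unfolding bj_op_def[abs_def]
  by (intro schwartz_continuous_compose[OF schwartz_continuous_sympl_fourier]
      schwartz_continuous_compose[OF schwartz_continuous_Theta] schwartz_continuous_sympl_fourier)

lemma bj_op_schwartz: "\<phi> \<in> schwartz \<Longrightarrow> bj_op \<phi> \<in> schwartz"
  by (rule schwartz_continuousD[OF schwartz_continuous_bj_op])

lemma bj_op_lincomb:
  assumes "\<phi> \<in> schwartz" "\<psi> \<in> schwartz"
  shows "bj_op (\<lambda>x. a * \<phi> x + b * \<psi> x) = (\<lambda>z. a * bj_op \<phi> z + b * bj_op \<psi> z)"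
proof -
  have "bj_op (\<lambda>x. a * \<phi> x + b * \<psi> x) =
    sympl_fourier (\<lambda>z. a * (Theta z * sympl_fourier \<phi> z) + b * (Theta z * sympl_fourier \<psi> z))"
    unfolding bj_op_def sympl_fourier_lincomb[OF assms] by (simp add: algebra_simps)
  also have "\<dots> = (\<lambda>z. a * bj_op \<phi> z + b * bj_op \<psi> z)"
    unfolding bj_op_def by (intro sympl_fourier_lincomb Theta_mult_schwartz sympl_fourier_schwartz assms)
  finally show ?thesis .
qed

lemma bj_dist_apply:
  assumes "T \<in> tempered_distributions" "\<phi> \<in> schwartz"
  shows "bj_dist \<kappa> T \<phi> = inverse \<kappa> * T (bj_op \<phi>)"
  using assms by (simp add: bj_dist_def dual_op_def tempered_cmult bj_op_schwartz)

lemma bj_dist_tempered: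
  assumes T: "T \<in> tempered_distributions"
  shows "bj_dist \<kappa> T \<in> tempered_distributions"
proof -
  obtain k m C where C: "C \<ge> 0" "\<And>\<phi>. \<phi> \<in> schwartz \<Longrightarrow> norm (T \<phi>) \<le> C * jet_seminorm k m \<phi>"
    using tempered_bound[OF T] by metis
  obtain k' m' D where D: "D \<ge> 0" "\<And>\<phi>::'a \<times> 'a \<Rightarrow> complex. \<phi> \<in> schwartz \<Longrightarrow> jet_seminorm k m (bj_op \<phi>) \<le> D * jet_seminorm k' m' \<phi>"
    using schwartz_continuous_bound[OF schwartz_continuous_bj_op] by metis
  show ?thesis
  proof (rule temperedI)
    show "bj_dist \<kappa> T \<phi> = 0" if "\<phi> \<notin> schwartz" for \<phi> using that by (simp add: bj_dist_def dual_op_def)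
    show "bj_dist \<kappa> T (\<lambda>x. a * \<phi> x + b * \<psi> x) = a * bj_dist \<kappa> T \<phi> + b * bj_dist \<kappa> T \<psi>"
      if "\<phi> \<in> schwartz" "\<psi> \<in> schwartz" for \<phi> \<psi> a b
      using that by (simp add: bj_dist_apply[OF T] schwartz_lincomb(1) bj_op_lincomb
          tempered_linear[OF T] bj_op_schwartz algebra_simps)
    show "norm (bj_dist \<kappa> T \<phi>) \<le> (norm (inverse \<kappa>) * C * D) * jet_seminorm k' m' \<phi>" if "\<phi> \<in> schwartz" for \<phi>
    proof -
      have "norm (T (bj_op \<phi>)) \<le> C * (D * jet_seminorm k' m' \<phi>)"
        by (rule order_trans[OF C(2)[OF bj_op_schwartz[OF that]] mult_left_mono[OF D(2)[OF that] C(1)]])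
      then have "norm (inverse \<kappa>) * norm (T (bj_op \<phi>)) \<le> norm (inverse \<kappa>) * (C * (D * jet_seminorm k' m' \<phi>))"
        by (intro mult_left_mono) auto
      then show ?thesis by (simp only: bj_dist_apply[OF T that] norm_mult mult.assoc)
    qed
  qed (use C(1) D(1) in simp)
qed

text \<open>The transposed transform tests against a reflected transform. Reflection commutes with
  \<open>sympl_fourier\<close> and with multiplication by the even function \<open>Theta\<close>, so
  the inner transform of \<open>bj_op\<close> cancels against the one in the test function up to
  \<open>\<kappa>\<close>, and the transform of \<open>Theta\<close> times the test function
  remains.\<close>

lemma sympl_fourier_dist_bj_dist:
  fixes T :: "('a::euclidean_space \<times> 'a) functional"
  assumes \<kappa>: "inversion_constant TYPE('a \<times> 'a) \<kappa>" and T: "T \<in> tempered_distributions"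
  shows "sympl_fourier_dist (bj_dist \<kappa> T) = mult_dist Theta (sympl_fourier_dist T)"
proof
  fix \<phi> :: "'a \<times> 'a \<Rightarrow> complex"
  show "sympl_fourier_dist (bj_dist \<kappa> T) \<phi> = mult_dist Theta (sympl_fourier_dist T) \<phi>"
  proof (cases "\<phi> \<in> schwartz")
    case \<phi>: True
    have k0: "\<kappa> \<noteq> 0" using \<kappa> by (simp add: inversion_constant_def)
    let ?\<psi> = "\<lambda>z. sympl_fourier \<phi> (- z)"
    let ?\<theta> = "\<lambda>z. Theta z * \<phi> z"
    have \<psi>: "?\<psi> \<in> schwartz" by (intro schwartz_reflect sympl_fourier_schwartz \<phi>)
    have \<theta>: "?\<theta> \<in> schwartz" by (rule Theta_mult_schwartz[OF \<phi>])
    have "sympl_fourier ?\<psi> = (\<lambda>z. \<kappa> * \<phi> (- z))"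
      by (simp add: sympl_fourier_reflect[OF sympl_fourier_schwartz[OF \<phi>]] sympl_fourier_involution[OF \<kappa> \<phi>])
    then have "bj_op ?\<psi> = sympl_fourier (\<lambda>z. \<kappa> * ?\<theta> (- z))"
      by (simp add: bj_op_def mult.left_commute)
    also have "\<dots> = (\<lambda>z. \<kappa> * sympl_fourier ?\<theta> (- z))"
      by (simp only: sympl_fourier_cmult[OF schwartz_reflect[OF \<theta>]] sympl_fourier_reflect[OF \<theta>])
    finally have "bj_dist \<kappa> T ?\<psi> = T (\<lambda>z. sympl_fourier ?\<theta> (- z))"
      using k0 by (simp add: bj_dist_apply[OF T \<psi>] tempered_cmult[OF T schwartz_reflect[OF sympl_fourier_schwartz[OF \<theta>]]])
    then show ?thesis using \<phi> \<theta> by (simp add: sympl_fourier_dist_def mult_dist_def dual_op_def)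
  qed (simp add: sympl_fourier_dist_def mult_dist_def dual_op_def)
qed

text \<open>Every Schwartz function is, up to the nonzero factor \<open>\<kappa>\<close>, the
  reflected transform of a Schwartz function, so the transformed functional determines the original.
  Off the Schwartz space both functionals are 0.\<close>

lemma sympl_fourier_dist_inj:
  fixes S T :: "('a::euclidean_space \<times> 'a) functional"
  assumes \<kappa>: "inversion_constant TYPE('a \<times> 'a) \<kappa>"
    and S: "S \<in> tempered_distributions" and T: "T \<in> tempered_distributions"
    and eq: "sympl_fourier_dist S = sympl_fourier_dist T"
  shows "S = T"
proof
  fix \<psi> :: "'a \<times> 'a \<Rightarrow> complex"
  have off: "R \<psi> = 0" if "R \<in> tempered_distributions" "\<psi> \<notin> schwartz" for R
    using that by (simp add: tempered_distributions_def)
  show "S \<psi> = T \<psi>"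
  proof (cases "\<psi> \<in> schwartz")
    case \<psi>: True
    have k0: "\<kappa> \<noteq> 0" using \<kappa> by (simp add: inversion_constant_def)
    let ?\<phi> = "\<lambda>z. sympl_fourier \<psi> (- z)"
    have \<phi>: "?\<phi> \<in> schwartz" by (intro schwartz_reflect sympl_fourier_schwartz \<psi>)
    have "(\<lambda>z. sympl_fourier ?\<phi> (- z)) = (\<lambda>z. \<kappa> * \<psi> z)"
      by (simp add: sympl_fourier_reflect[OF sympl_fourier_schwartz[OF \<psi>]] sympl_fourier_involution[OF \<kappa> \<psi>])
    then have "sympl_fourier_dist R ?\<phi> = \<kappa> * R \<psi>" if "R \<in> tempered_distributions" for R
      using \<phi> by (simp add: sympl_fourier_dist_def dual_op_def tempered_cmult[OF that \<psi>])
    from this[OF S] this[OF T] eq k0 show ?thesis by simp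
  qed (simp add: off[OF S] off[OF T])
qed

lemma bj_dist_power_tempered:
  "T \<in> tempered_distributions \<Longrightarrow> (bj_dist \<kappa> ^^ n) T \<in> tempered_distributions"
  by (induction n) (auto intro: bj_dist_tempered)

text \<open>The definite description calls for a witness and for uniqueness. Each application of
  \<open>bj_dist\<close> multiplies the transform by one more factor \<open>Theta\<close>;
  uniqueness is the injectivity of the transform on tempered distributions.\<close>

lemma born_jordan_eq:
  fixes f :: "'a::euclidean_space functional"
  assumes \<kappa>: "inversion_constant TYPE('a \<times> 'a) \<kappa>" and W: "wigner f \<in> tempered_distributions"
  shows "born_jordan n f = (bj_dist \<kappa> ^^ n) (wigner f)"
proof -
  have eq: "sympl_fourier_dist ((bj_dist \<kappa> ^^ n) (wigner f)) =
      mult_dist (\<lambda>z. Theta z ^ n) (sympl_fourier_dist (wigner f))" for n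
  proof (induction n)
    case 0
    then show ?case by (auto simp: mult_dist_def dual_op_def sympl_fourier_dist_def)
  next
    case (Suc n)
    then have "sympl_fourier_dist ((bj_dist \<kappa> ^^ Suc n) (wigner f)) =
        mult_dist Theta (mult_dist (\<lambda>z. Theta z ^ n) (sympl_fourier_dist (wigner f)))"
      by (simp add: sympl_fourier_dist_bj_dist[OF \<kappa> bj_dist_power_tempered[OF W]])
    also have "\<dots> = mult_dist (\<lambda>z. Theta z ^ Suc n) (sympl_fourier_dist (wigner f))"
      by (rule ext) (simp add: mult_dist_def dual_op_def Theta_mult_schwartz power_Suc2 mult.assoc del: power_Suc)
    finally show ?case .
  qed
  show ?thesis
    unfolding born_jordan_def
  proof (rule the_equality)
    show "(bj_dist \<kappa> ^^ n) (wigner f) \<in> tempered_distributions \<and>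
      sympl_fourier_dist ((bj_dist \<kappa> ^^ n) (wigner f)) = mult_dist (\<lambda>z. Theta z ^ n) (sympl_fourier_dist (wigner f))"
      by (intro conjI eq bj_dist_power_tempered W)
    show "Q = (bj_dist \<kappa> ^^ n) (wigner f)"
      if "Q \<in> tempered_distributions \<and>
        sympl_fourier_dist Q = mult_dist (\<lambda>z. Theta z ^ n) (sympl_fourier_dist (wigner f))" for Q
      by (rule sympl_fourier_dist_inj[OF \<kappa> conjunct1[OF that] bj_dist_power_tempered[OF W]])
        (simp only: conjunct2[OF that] eq)
  qed
qed

section \<open>Time-frequency shifts of a window\<close>

text \<open>The time-frequency shift of a window, in the convention of a bilinear pairing: the
  short-time Fourier transform is the pairing with an atom of the conjugated window, and the wave
  has frequency \<open>- snd t\<close>.\<close>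

definition atom :: "('a::euclidean_space \<Rightarrow> complex) \<Rightarrow> 'a \<times> 'a \<Rightarrow> 'a \<Rightarrow> complex" where
  "atom \<gamma> t y = \<gamma> (y - fst t) * plane_wave (snd t) y"

lemma stft_eq_atom: "stft g F x \<omega> = F (atom (\<lambda>y. cnj (g y)) (x, \<omega>))"
  by (simp add: stft_def atom_def[abs_def] plane_wave_def)

lemma weight_fst_le: "1 + norm (fst t) \<le> 1 + norm t"
  and weight_snd_le: "1 + norm (snd t) \<le> 1 + norm (t :: 'a::real_normed_vector \<times> 'b::real_normed_vector)"
  using norm_fst_le[of "fst t" "snd t"] norm_snd_le[of "snd t" "fst t"] by simp_all

lemma atom_schwartz: "\<gamma> \<in> schwartz \<Longrightarrow> atom \<gamma> t \<in> schwartz"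
  unfolding atom_def[abs_def]
  using schwartz_mult_plane_wave[OF schwartz_translate(1)[of \<gamma> "fst t"], of "snd t"] by (simp add: mult.commute)

text \<open>The translation costs \<open>k\<close> powers of the weight and the modulation
  \<open>m\<close>. The growth in \<open>t\<close> is polynomial, which rapidly decreasing
  coefficients can absorb.\<close>

lemma jet_seminorm_atom:
  fixes \<gamma> :: "'a::euclidean_space \<Rightarrow> complex"
  assumes \<gamma>: "\<gamma> \<in> schwartz"
  shows "\<exists>C\<ge>0. \<forall>t. jet_seminorm k m (atom \<gamma> t) \<le> C * (1 + norm t) ^ (m + k)"
proof -
  obtain C where C: "C \<ge> 0" "\<And>v::'a. \<And>\<phi>. \<phi> \<in> schwartz \<Longrightarrow>
     jet_seminorm k m (\<lambda>y. plane_wave v y * \<phi> y) \<le> C * (1 + norm v) ^ m * jet_seminorm k m \<phi>"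
    using schwartz_plane_wave[of k m, where 'a='a] by blast
  have "jet_seminorm k m (atom \<gamma> t) \<le> (C * jet_seminorm k m \<gamma>) * (1 + norm t) ^ (m + k)" for t
  proof -
    have S: "(\<lambda>y. \<gamma> (y - fst t)) \<in> schwartz" by (rule schwartz_translate(1)[OF \<gamma>])
    have "jet_seminorm k m (atom \<gamma> t) = jet_seminorm k m (\<lambda>y. plane_wave (snd t) y * \<gamma> (y - fst t))"
      by (simp add: atom_def[abs_def] mult.commute)
    also have "\<dots> \<le> C * (1 + norm (snd t)) ^ m * jet_seminorm k m (\<lambda>y. \<gamma> (y - fst t))"
      by (rule C(2)[OF S])
    also have "\<dots> \<le> C * (1 + norm t) ^ m * ((1 + norm t) ^ k * jet_seminorm k m \<gamma>)"
    proof (intro mult_mono power_mono weight_snd_le order_refl)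
      show "jet_seminorm k m (\<lambda>y. \<gamma> (y - fst t)) \<le> (1 + norm t) ^ k * jet_seminorm k m \<gamma>"
        by (rule order_trans[OF schwartz_translate(2)[OF \<gamma>]])
          (intro mult_right_mono power_mono weight_fst_le jet_seminorm_nonneg \<gamma>; simp)
    qed (use C(1) jet_seminorm_nonneg[OF S] in auto)
    finally show ?thesis by (simp add: power_add algebra_simps)
  qed
  then show ?thesis using C(1) jet_seminorm_nonneg[OF \<gamma>, of k m]
    by (intro exI[of _ "C * jet_seminorm k m \<gamma>"]) auto
qed

text \<open>The mean value inequality on the segment, applied to each derivative in turn, since
  taking differences of translates commutes with differentiation.\<close>

lemma jet_translate_diff:
  fixes \<gamma> :: "'a::euclidean_space \<Rightarrow> complex"
  assumes "smooth \<gamma>" and "\<And>z. z \<in> closed_segment (y - x') (y - x) \<Longrightarrow> jet (Suc m) \<gamma> z \<le> B"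
  shows "jet m (\<lambda>y. \<gamma> (y - x) - \<gamma> (y - x')) y \<le> (1 + real DIM('a)) ^ m * (B * norm (x - x'))"
  using assms
proof (induction m arbitrary: \<gamma>)
  case 0
  have "norm (\<gamma> (y - x) - \<gamma> (y - x')) \<le> B * norm ((y - x) - (y - x'))"
    using 0 by (intro smooth_lipschitz_segment) auto
  then show ?case by (simp add: norm_minus_commute)
next
  case (Suc m)
  have B: "0 \<le> B * norm (x - x')"
    using order_trans[OF jet_nonneg Suc.prems(2)[of "y - x"]] by simp
  have "norm (\<gamma> (y - x) - \<gamma> (y - x')) \<le> B * norm ((y - x) - (y - x'))"
  proof (rule smooth_lipschitz_segment[OF Suc.prems(1)])
    fix z assume "z \<in> closed_segment (y - x') (y - x)"
    then show "jet (Suc 0) \<gamma> z \<le> B"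
      using Suc.prems(2)[of z] jet_mono[of "Suc 0" "Suc (Suc m)" \<gamma> z] by (meson Suc_le_mono le0 order_trans)
  qed
  also have "\<dots> = B * norm (x - x')" by (simp add: norm_minus_commute)
  also have "\<dots> \<le> (1 + real DIM('a)) ^ m * (B * norm (x - x'))"
    using mult_right_mono[OF one_le_power[of "1 + real DIM('a)" m] B] by simp
  finally have 1: "norm (\<gamma> (y - x) - \<gamma> (y - x')) \<le> (1 + real DIM('a)) ^ m * (B * norm (x - x'))" .
  have pd: "partial_deriv b (\<lambda>y. \<gamma> (y - x) - \<gamma> (y - x')) = (\<lambda>y. partial_deriv b \<gamma> (y - x) - partial_deriv b \<gamma> (y - x'))" for b
  proof -
    have d: "\<And>x. \<gamma> differentiable at x" by (rule smooth_differentiable[OF Suc.prems(1)])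
    have "partial_deriv b (\<lambda>y. \<gamma> (y - x) + (- 1) * \<gamma> (y - x')) =
        (\<lambda>y. partial_deriv b (\<lambda>y. \<gamma> (y - x)) y + partial_deriv b (\<lambda>y. (- 1) * \<gamma> (y - x')) y)"
      by (intro partial_deriv_add differentiable_mult differentiable_const differentiable_translate d)
    then show ?thesis
      using partial_deriv_cmult[OF differentiable_translate[OF d], of b "- 1" x']
      by (simp add: partial_deriv_translate[OF d])
  qed
  have 2: "jet m (partial_deriv b (\<lambda>y. \<gamma> (y - x) - \<gamma> (y - x'))) y \<le> (1 + real DIM('a)) ^ m * (B * norm (x - x'))"
    if b: "b \<in> Basis" for b
    unfolding pd
  proof (rule Suc.IH[OF smooth_partial_deriv[OF Suc.prems(1) b]])
    fix z assume "z \<in> closed_segment (y - x') (y - x)"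
    then show "jet (Suc m) (partial_deriv b \<gamma>) z \<le> B"
      by (rule order_trans[OF jet_partial_deriv_le[OF b] Suc.prems(2)])
  qed
  have "(\<Sum>b\<in>Basis. jet m (partial_deriv b (\<lambda>y. \<gamma> (y - x) - \<gamma> (y - x'))) y)
      \<le> real DIM('a) * ((1 + real DIM('a)) ^ m * (B * norm (x - x')))"
    by (intro sum_bounded_above 2)
  with 1 show ?case by (simp add: algebra_simps)
qed

text \<open>Passing from one atom to the other is split into a change of the translation and a
  change of the modulation. The former is a mean value estimate, the latter is
  \<open>jet_plane_wave_minus_one\<close>; both have polynomially growing constants.\<close>

lemma atom_lipschitz:
  fixes \<gamma> :: "'a::euclidean_space \<Rightarrow> complex"
  assumes \<gamma>: "\<gamma> \<in> schwartz"
  shows "\<exists>C\<ge>0. \<exists>P. \<forall>s t. jet_seminorm k m (\<lambda>y. atom \<gamma> s y - atom \<gamma> t y)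
      \<le> C * ((1 + norm s) * (1 + norm t)) ^ P * norm (s - t)"
proof -
  let ?w = "\<lambda>s t :: 'a \<times> 'a. (1 + norm s) * (1 + norm t)"
  let ?n = "real DIM('a)"
  obtain C1 where C1: "C1 \<ge> 0" "\<And>v::'a. \<And>\<phi>. \<phi> \<in> schwartz \<Longrightarrow>
     jet_seminorm k m (\<lambda>y. plane_wave v y * \<phi> y) \<le> C1 * (1 + norm v) ^ m * jet_seminorm k m \<phi>"
    using schwartz_plane_wave[of k m, where 'a='a] by blast
  obtain C2 where C2: "C2 \<ge> 0" "\<And>\<theta> \<phi>::'a \<Rightarrow> complex. \<And>A K x. smooth \<theta> \<Longrightarrow> (\<forall>x. jet m \<theta> x \<le> A * (1 + norm x) ^ K) \<Longrightarrow>
      \<phi> \<in> schwartz \<Longrightarrow> (1 + norm x) ^ k * jet m (\<lambda>x. \<theta> x * \<phi> x) x \<le> C2 * A * jet_seminorm (k + K) m \<phi>"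
    using schwartz_multiplier[of m k, where 'a='a] by blast
  define S1 where "S1 = jet_seminorm k (Suc m) \<gamma>"
  define S2 where "S2 = jet_seminorm (k + 1) m \<gamma>"
  define a where "a = 1 + ?n * (1 + 2 * pi * ?n) ^ m"
  have S: "0 \<le> S1" "0 \<le> S2" "0 \<le> a" by (simp_all add: S1_def S2_def a_def jet_seminorm_nonneg \<gamma>)
  define C where "C = C1 * ((1 + ?n) ^ m * S1) + C1 * (C2 * (2 * pi * a) * S2)"
  \<comment> \<open>One \<open>m\<close> for the outer modulation, one for the jet of the modulation
    difference, and \<open>k + 1\<close> for a translation measured with the extra power of the
    weight which that difference costs.\<close>
  define P where "P = m + (m + (k + 1))"
  have Tw: "(1::real) \<le> ?w s t" for s t
  proof -
    have "1 * 1 \<le> ?w s t" by (intro mult_mono) auto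
    then show ?thesis by simp
  qed
  have w_ge: "1 + r \<le> ?w s t" if "r \<le> norm s + norm t" for r s t
  proof -
    have "?w s t = 1 + norm s + norm t + norm s * norm t" by (simp add: algebra_simps)
    moreover have "0 \<le> norm s * norm t" by simp
    ultimately show ?thesis using that by linarith
  qed
  have "jet_seminorm k m (\<lambda>y. atom \<gamma> s y - atom \<gamma> t y) \<le> C * (?w s t) ^ P * norm (s - t)" for s t
  proof -
    define x x' \<omega> \<omega>' where "x = fst s" and "x' = fst t" and "\<omega> = snd s" and "\<omega>' = snd t"
    have st: "norm (x - x') \<le> norm (s - t)" "norm (\<omega> - \<omega>') \<le> norm (s - t)"
      using weight_fst_le[of "s - t"] weight_snd_le[of "s - t"]
      by (simp_all add: x_def x'_def \<omega>_def \<omega>'_def)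
    have le_w: "1 + norm s \<le> ?w s t" "1 + norm t \<le> ?w s t"
      by (simp_all add: algebra_simps add_increasing)
    define u where "u y = \<gamma> (y - x) - \<gamma> (y - x')" for y
    define v where "v y = (plane_wave (\<omega> - \<omega>') y - 1) * \<gamma> (y - x')" for y
    have uS: "u \<in> schwartz" unfolding u_def[abs_def] by (intro schwartz_diff schwartz_translate(1) \<gamma>)
    have T': "(\<lambda>y. \<gamma> (y - x')) \<in> schwartz" by (rule schwartz_translate(1)[OF \<gamma>])
    have "v = (\<lambda>y. plane_wave (\<omega> - \<omega>') y * \<gamma> (y - x') - \<gamma> (y - x'))"
      by (simp add: v_def fun_eq_iff algebra_simps)
    then have vS: "v \<in> schwartz" by (simp only:) (intro schwartz_diff schwartz_mult_plane_wave T')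
    have split: "atom \<gamma> s y - atom \<gamma> t y = 1 * (plane_wave \<omega> y * u y) + 1 * (plane_wave \<omega>' y * v y)" for y
      using plane_wave_add[of "\<omega>'" "\<omega> - \<omega>'" y]
      by (simp add: atom_def u_def v_def x_def x'_def \<omega>_def \<omega>'_def algebra_simps)
    have u: "jet_seminorm k m u \<le> ((1 + ?n) ^ m * S1) * (?w s t) ^ k * norm (s - t)"
    proof (rule jet_seminorm_least)
      fix y
      have "jet m u y \<le> (1 + ?n) ^ m * (((?w s t) ^ k * S1 / (1 + norm y) ^ k) * norm (x - x'))"
        unfolding u_def[abs_def]
      proof (rule jet_translate_diff[OF schwartz_smooth[OF \<gamma>]])
        fix z assume "z \<in> closed_segment (y - x') (y - x)"
        then obtain l where l: "0 \<le> l" "l \<le> 1" "z = (1 - l) *\<^sub>R (y - x') + l *\<^sub>R (y - x)"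
          by (auto simp: closed_segment_def)
        \<comment> \<open>A point of the segment is \<open>y\<close> minus a point \<open>p\<close>
          between the two translation parameters; Peetre's inequality with \<open>p\<close> makes
          the bound independent of the place on the segment.\<close>
        define p where "p = (1 - l) *\<^sub>R x' + l *\<^sub>R x"
        have z: "z = y - p" by (simp add: l(3) p_def algebra_simps)
        have "norm p \<le> (1 - l) * norm x' + l * norm x"
          unfolding p_def using l(1,2) norm_triangle_ineq[of "(1 - l) *\<^sub>R x'" "l *\<^sub>R x"] by simp
        also have "\<dots> \<le> 1 * norm t + 1 * norm s"
          using l(1,2) by (intro add_mono mult_mono) (use weight_fst_le[of s] weight_fst_le[of t] in \<open>auto simp: x_def x'_def\<close>)
        finally have "norm p \<le> norm s + norm t" by simp
        then have "1 + norm p \<le> ?w s t" by (rule w_ge)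
        then have "(1 + norm z) * (1 + norm p) \<le> (1 + norm z) * ?w s t" by (intro mult_left_mono) auto
        then have "1 + norm y \<le> (1 + norm z) * ?w s t"
          using weight_translate[of y p] by (simp add: z)
        then have "(1 + norm y) ^ k \<le> ((1 + norm z) * ?w s t) ^ k" by (intro power_mono) auto
        then have "(1 + norm y) ^ k * jet (Suc m) \<gamma> z \<le> ((1 + norm z) * ?w s t) ^ k * jet (Suc m) \<gamma> z"
          by (intro mult_right_mono jet_nonneg)
        also have "\<dots> = (?w s t) ^ k * ((1 + norm z) ^ k * jet (Suc m) \<gamma> z)"
          by (simp only: power_mult_distrib mult_ac)
        also have "\<dots> \<le> (?w s t) ^ k * S1"
          unfolding S1_def by (intro mult_left_mono jet_seminorm_upper \<gamma>) auto
        finally show "jet (Suc m) \<gamma> z \<le> (?w s t) ^ k * S1 / (1 + norm y) ^ k"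
          by (simp only: pos_le_divide_eq weight_pos mult.commute)
      qed
      then have "(1 + norm y) ^ k * jet m u y \<le>
          (1 + norm y) ^ k * ((1 + ?n) ^ m * (((?w s t) ^ k * S1 / (1 + norm y) ^ k) * norm (x - x')))"
        by (intro mult_left_mono) auto
      also have "\<dots> = ((1 + ?n) ^ m * S1) * (?w s t) ^ k * norm (x - x')"
      proof -
        have "1 + norm y \<noteq> 0" using norm_ge_zero[of y] by linarith
        then show ?thesis by (simp add: field_simps)
      qed
      also have "\<dots> \<le> ((1 + ?n) ^ m * S1) * (?w s t) ^ k * norm (s - t)"
        using S by (intro mult_left_mono st) auto
      finally show "(1 + norm y) ^ k * jet m u y \<le> ((1 + ?n) ^ m * S1) * (?w s t) ^ k * norm (s - t)" .
    qed
    have v: "jet_seminorm k m v \<le> (C2 * (2 * pi * a) * S2) * (?w s t) ^ (m + (k + 1)) * norm (s - t)"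
    proof (rule jet_seminorm_least)
      fix y
      let ?A = "2 * pi * norm (\<omega> - \<omega>') * (1 + ?n * ((1 + 2 * pi * ?n) ^ m * (1 + norm (\<omega> - \<omega>')) ^ m))"
      have "(1 + norm y) ^ k * jet m v y \<le> C2 * ?A * jet_seminorm (k + 1) m (\<lambda>y. \<gamma> (y - x'))"
        unfolding v_def[abs_def]
      proof (rule C2(2)[OF _ _ T'])
        show "smooth (\<lambda>y. plane_wave (\<omega> - \<omega>') y - 1)" by (intro smooth_diff smooth_plane_wave smooth_const)
        show "\<forall>y. jet m (\<lambda>y. plane_wave (\<omega> - \<omega>') y - 1) y \<le> ?A * (1 + norm y) ^ 1"
          using jet_plane_wave_minus_one[of m "\<omega> - \<omega>'"] by simp
      qed
      also have "\<dots> \<le> C2 * (2 * pi * norm (s - t) * (a * (?w s t) ^ m)) * ((?w s t) ^ (k + 1) * S2)"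
      proof (intro mult_mono mult_left_mono)
        have "norm (\<omega> - \<omega>') \<le> norm s + norm t"
          using norm_triangle_ineq4[of \<omega> \<omega>'] norm_snd_le[of "snd s" "fst s"] norm_snd_le[of "snd t" "fst t"]
          by (simp add: \<omega>_def \<omega>'_def)
        then have "1 + norm (\<omega> - \<omega>') \<le> ?w s t" by (rule w_ge)
        then have p: "(1 + norm (\<omega> - \<omega>')) ^ m \<le> (?w s t) ^ m" by (intro power_mono) auto
        have "1 + ?n * ((1 + 2 * pi * ?n) ^ m * (1 + norm (\<omega> - \<omega>')) ^ m) \<le>
          (?w s t) ^ m + ?n * ((1 + 2 * pi * ?n) ^ m * (?w s t) ^ m)"
          using p one_le_power[OF Tw, of s t m] by (intro add_mono mult_left_mono) auto
        then show "1 + ?n * ((1 + 2 * pi * ?n) ^ m * (1 + norm (\<omega> - \<omega>')) ^ m) \<le> a * (?w s t) ^ m"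
          by (simp only: a_def distrib_right mult_1 mult.assoc)
        show "norm (\<omega> - \<omega>') \<le> norm (s - t)" by (rule st)
        have "jet_seminorm (k + 1) m (\<lambda>y. \<gamma> (y - x')) \<le> (1 + norm x') ^ (k + 1) * S2"
          unfolding S2_def by (rule schwartz_translate(2)[OF \<gamma>])
        also have "\<dots> \<le> (?w s t) ^ (k + 1) * S2"
          using S order_trans[OF weight_fst_le le_w(2)] by (intro mult_right_mono power_mono) (auto simp: x'_def)
        finally show "jet_seminorm (k + 1) m (\<lambda>y. \<gamma> (y - x')) \<le> (?w s t) ^ (k + 1) * S2" .
      qed (use C2(1) S jet_seminorm_nonneg[OF T'] in \<open>auto intro!: add_nonneg_nonneg mult_nonneg_nonneg\<close>)
      also have "\<dots> = (C2 * (2 * pi * a) * S2) * (?w s t) ^ (m + (k + 1)) * norm (s - t)"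
        by (simp only: power_add mult_ac)
      finally show "(1 + norm y) ^ k * jet m v y \<le> (C2 * (2 * pi * a) * S2) * (?w s t) ^ (m + (k + 1)) * norm (s - t)" .
    qed
    \<comment> \<open>Both summands are brought to the common exponent \<open>P\<close>, the outer
      modulation being absorbed into the weight.\<close>
    have w: "C1 * (1 + norm \<nu>) ^ m * (c * (?w s t) ^ j * norm (s - t)) \<le> C1 * c * (?w s t) ^ P * norm (s - t)"
      if "1 + norm \<nu> \<le> ?w s t" "c \<ge> 0" "j \<le> m + (k + 1)" for \<nu> :: 'a and c j
    proof -
      have "(1 + norm \<nu>) ^ m * (?w s t) ^ j \<le> (?w s t) ^ m * (?w s t) ^ (m + (k + 1))"
        using that Tw[of s t] by (intro mult_mono power_mono power_increasing) auto
      then have "(C1 * c * norm (s - t)) * ((1 + norm \<nu>) ^ m * (?w s t) ^ j) \<le>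
          (C1 * c * norm (s - t)) * ((?w s t) ^ m * (?w s t) ^ (m + (k + 1)))"
        using C1(1) that(2) by (intro mult_left_mono) auto
      then show ?thesis by (simp only: P_def power_add mult_ac)
    qed
    have "jet_seminorm k m (\<lambda>y. atom \<gamma> s y - atom \<gamma> t y) \<le>
        jet_seminorm k m (\<lambda>y. plane_wave \<omega> y * u y) + jet_seminorm k m (\<lambda>y. plane_wave \<omega>' y * v y)"
      unfolding split
      using schwartz_lincomb(2)[OF schwartz_mult_plane_wave[OF uS] schwartz_mult_plane_wave[OF vS], of k m 1 \<omega> 1 \<omega>']
      by simp
    also have "\<dots> \<le> C1 * (1 + norm \<omega>) ^ m * jet_seminorm k m u + C1 * (1 + norm \<omega>') ^ m * jet_seminorm k m v"
      by (intro add_mono C1(2) uS vS)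
    also have "\<dots> \<le> C1 * (1 + norm \<omega>) ^ m * (((1 + ?n) ^ m * S1) * (?w s t) ^ k * norm (s - t)) +
        C1 * (1 + norm \<omega>') ^ m * ((C2 * (2 * pi * a) * S2) * (?w s t) ^ (m + (k + 1)) * norm (s - t))"
      using C1(1) by (intro add_mono mult_left_mono u v) auto
    also have "\<dots> \<le> C1 * ((1 + ?n) ^ m * S1) * (?w s t) ^ P * norm (s - t) +
        C1 * (C2 * (2 * pi * a) * S2) * (?w s t) ^ P * norm (s - t)"
      using S C2(1) order_trans[OF weight_snd_le le_w(1)] order_trans[OF weight_snd_le le_w(2)]
      by (intro add_mono w) (auto simp: \<omega>_def \<omega>'_def)
    also have "\<dots> = C * (?w s t) ^ P * norm (s - t)" by (simp only: C_def distrib_right)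
    finally show ?thesis .
  qed
  moreover have "C \<ge> 0" using C1(1) C2(1) S by (simp add: C_def)
  ultimately show ?thesis by blast
qed

text \<open>Continuity of the short-time Fourier transform. Besides measurability, it is what later
  reduces essential suprema to countable ones.\<close>

lemma continuous_tempered_atom:
  fixes \<gamma> :: "'a::euclidean_space \<Rightarrow> complex"
  assumes T: "T \<in> tempered_distributions" and \<gamma>: "\<gamma> \<in> schwartz"
  shows "continuous_on UNIV (\<lambda>t. T (atom \<gamma> t))"
proof -
  obtain k m C where C: "C \<ge> 0" "\<And>\<phi>. \<phi> \<in> schwartz \<Longrightarrow> norm (T \<phi>) \<le> C * jet_seminorm k m \<phi>"
    using tempered_bound[OF T] by metis
  obtain D P where D: "D \<ge> 0" "\<And>s t. jet_seminorm k m (\<lambda>y. atom \<gamma> s y - atom \<gamma> t y)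
      \<le> D * ((1 + norm s) * (1 + norm t)) ^ P * norm (s - t)"
    using atom_lipschitz[OF \<gamma>, of k m] by blast
  have bound: "norm (T (atom \<gamma> s) - T (atom \<gamma> t)) \<le> C * (D * ((1 + norm s) * (1 + norm t)) ^ P * norm (s - t))" for s t
    unfolding tempered_diff[OF T atom_schwartz[OF \<gamma>] atom_schwartz[OF \<gamma>], symmetric]
    by (rule order_trans[OF C(2)[OF schwartz_diff[OF atom_schwartz[OF \<gamma>] atom_schwartz[OF \<gamma>]]] mult_left_mono[OF D(2) C(1)]])
  have "((\<lambda>s. T (atom \<gamma> s)) \<longlongrightarrow> T (atom \<gamma> t)) (at t)" for t
  proof (rule LIM_zero_cancel, rule Lim_null_comparison)
    show "\<forall>\<^sub>F s in at t. norm (T (atom \<gamma> s) - T (atom \<gamma> t)) \<le>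
        C * (D * ((1 + norm s) * (1 + norm t)) ^ P * norm (s - t))"
      using bound by simp
    have "((\<lambda>s. C * (D * ((1 + norm s) * (1 + norm t)) ^ P * norm (s - t))) \<longlongrightarrow>
        C * (D * ((1 + norm t) * (1 + norm t)) ^ P * norm (t - t))) (at t)"
      by (intro tendsto_intros)
    then show "((\<lambda>s. C * (D * ((1 + norm s) * (1 + norm t)) ^ P * norm (s - t))) \<longlongrightarrow> 0) (at t)"
      by simp
  qed
  then show ?thesis by (simp add: continuous_on_def)
qed

section \<open>Tempered distributions and superpositions of atoms\<close>

definition rapidly_decreasing :: "('a::euclidean_space \<Rightarrow> complex) \<Rightarrow> bool" where
  "rapidly_decreasing c \<longleftrightarrow> c \<in> borel_measurable borel \<and> (\<forall>P. \<exists>K. \<forall>t. (1 + norm t) ^ P * norm (c t) \<le> K)"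

lemma rapidly_decreasing_integrable:
  fixes c :: "'a::euclidean_space \<Rightarrow> complex"
  assumes "rapidly_decreasing c"
  shows "integrable lborel (\<lambda>t. norm (c t) * (1 + norm t) ^ P)"
proof -
  have [measurable]: "c \<in> borel_measurable borel" using assms by (simp add: rapidly_decreasing_def)
  obtain K where K: "\<And>t. (1 + norm t) ^ (P + (DIM('a) + 2)) * norm (c t) \<le> K"
    using assms unfolding rapidly_decreasing_def by blast
  show ?thesis
  proof (rule integrable_decay)
    fix t :: 'a
    have "norm (c t) * (1 + norm t) ^ P * (1 + norm t) ^ (DIM('a) + 2) \<le> K"
      using K[of t] by (simp only: power_add mult_ac)
    then show "norm (norm (c t) * (1 + norm t) ^ P) \<le> K / (1 + norm t) ^ (DIM('a) + 2)"
      by (simp only: pos_le_divide_eq weight_pos) (simp add: abs_mult)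
  qed measurable
qed

text \<open>The integral over \<open>t\<close> is approximated in every Schwartz seminorm by finite sums, namely by
  replacing the atoms at \<open>t\<close> by those at \<open>F i t\<close>, with simple functions \<open>F i\<close> tending to the
  identity.\<close>

lemma tempered_superposition:
  fixes \<gamma> h :: "'a::euclidean_space \<Rightarrow> complex" and c :: "'a \<times> 'a \<Rightarrow> complex"
  assumes T: "T \<in> tempered_distributions" and \<gamma>: "\<gamma> \<in> schwartz" and h: "h \<in> schwartz"
    and c: "rapidly_decreasing c"
    and h_eq: "\<And>y. h y = (\<integral>t. c t * atom \<gamma> t y \<partial>lborel)"
  shows "T h = (\<integral>t. c t * T (atom \<gamma> t) \<partial>lborel)"
proof -
  have [measurable]: "c \<in> borel_measurable borel" using c by (simp add: rapidly_decreasing_def)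
  obtain k m C where C: "C \<ge> 0" "\<And>\<phi>. \<phi> \<in> schwartz \<Longrightarrow> norm (T \<phi>) \<le> C * jet_seminorm k m \<phi>"
    using tempered_bound[OF T] by metis
  have lip: "\<exists>D\<ge>0. \<exists>P. \<forall>s t. jet_seminorm k m (\<lambda>y. atom \<gamma> s y - atom \<gamma> t y)
      \<le> D * ((1 + norm s) * (1 + norm t)) ^ P * norm (s - t)" for k m
    by (rule atom_lipschitz[OF \<gamma>])
  have at_S: "atom \<gamma> t \<in> schwartz" for t by (rule atom_schwartz[OF \<gamma>])
  have diff_S: "(\<lambda>y. atom \<gamma> s y - atom \<gamma> t y) \<in> schwartz" for s t by (intro schwartz_diff at_S)
  have cint: "integrable lborel (\<lambda>t. norm (c t) * (K * (1 + norm t) ^ P))" for K P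
    using integrable_mult_right[OF rapidly_decreasing_integrable[OF c, of P], of K] by (simp add: mult_ac)
  have cont: "continuous_on UNIV (\<lambda>t. T (atom \<gamma> t))" by (rule continuous_tempered_atom[OF T \<gamma>])
  have [measurable]: "(\<lambda>t. T (atom \<gamma> t)) \<in> borel_measurable borel"
    by (rule borel_measurable_continuous_onI[OF cont])
  have atom_cont: "continuous_on UNIV (\<lambda>t. atom \<gamma> t y)" for y
    unfolding atom_def
    by (intro continuous_intros continuous_plane_wave continuous_on_compose2[OF smooth_continuous_on[OF schwartz_smooth[OF \<gamma>], of UNIV]]) auto
  have [measurable]: "(\<lambda>t. atom \<gamma> t y) \<in> borel_measurable borel" for y
    by (rule borel_measurable_continuous_onI[OF atom_cont])
  \<comment> \<open>The bound by \<open>2 * norm t\<close> keeps the growth of the atoms at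
    \<open>F i t\<close> comparable to that of the atom at \<open>t\<close>, uniformly in
    \<open>i\<close>.\<close>
  obtain F :: "nat \<Rightarrow> 'a \<times> 'a \<Rightarrow> 'a \<times> 'a" where F: "\<And>i. simple_function lborel (F i)"
    "\<And>t. (\<lambda>i. F i t) \<longlonglongrightarrow> t" "\<And>i t. norm (F i t) \<le> 2 * norm t"
    using borel_measurable_implies_sequence_metric[of "\<lambda>t. t" lborel "0 :: 'a \<times> 'a"] by auto
  have [measurable]: "F i \<in> borel_measurable borel" for i
    using borel_measurable_simple_function[OF F(1)] by simp
  have norm_F: "(1 + norm (F i t)) ^ P \<le> 2 ^ P * (1 + norm t) ^ P" for i t P
  proof -
    have "(1 + norm (F i t)) ^ P \<le> (2 * (1 + norm t)) ^ P"
      using F(3)[of i t] by (intro power_mono) auto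
    then show ?thesis by (simp only: power_mult_distrib)
  qed
  \<comment> \<open>An upper bound of the form given by \<open>atom_lipschitz\<close> for the
    seminorms of the difference of the atoms at \<open>F i t\<close> and at
    \<open>t\<close>.\<close>
  define E where "E D P i t = D * ((1 + norm (F i t)) * (1 + norm t)) ^ P * norm (F i t - t)" for D P i t
  have E_meas [measurable]: "(\<lambda>t. E D P i t) \<in> borel_measurable borel" for D P i
    unfolding E_def by measurable
  have E_nonneg: "0 \<le> E D P i t" if "D \<ge> 0" for D P i t using that by (simp add: E_def)
  have E_bound: "E D P i t \<le> D * 2 ^ P * 3 * (1 + norm t) ^ (P + P + 1)" if "D \<ge> 0" for D P i t
  proof -
    have "norm (F i t - t) \<le> 3 * (1 + norm t) ^ 1"
      using norm_triangle_ineq4[of "F i t" t] F(3)[of i t] by simp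
    then have "E D P i t \<le> D * (2 ^ P * (1 + norm t) ^ P * (1 + norm t) ^ P) * (3 * (1 + norm t) ^ 1)"
      unfolding E_def power_mult_distrib using that norm_F[of i t P]
      by (intro mult_mono mult_left_mono mult_right_mono) auto
    also have "\<dots> = D * 2 ^ P * 3 * (1 + norm t) ^ (P + P + 1)" by (simp only: power_add mult_ac)
    finally show ?thesis .
  qed
  have E_lim: "(\<lambda>i. E D P i t) \<longlonglongrightarrow> 0" for D P t
  proof -
    have "(\<lambda>i. E D P i t) \<longlonglongrightarrow> D * ((1 + norm t) * (1 + norm t)) ^ P * norm (t - t)"
      unfolding E_def by (intro tendsto_intros F(2))
    then show ?thesis by simp
  qed
  \<comment> \<open>\<open>F i\<close> takes finitely many values, so this integral is a finite
    linear combination of atoms and \<open>T\<close> can be applied by linearity.\<close>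
  define \<psi> where "\<psi> i y = (\<integral>t. c t * atom \<gamma> (F i t) y \<partial>lborel)" for i y
  define coef where "coef i v = (\<integral>t. indicator {t. F i t = v} t * c t \<partial>lborel)" for i v
  have fin: "finite (range (F i))" for i using simple_functionD(1)[OF F(1)[of i]] by simp
  have c_int: "integrable lborel c"
    using cint[of 1 0] by (subst integrable_norm_iff[symmetric]) auto
  have simple_int: "(\<integral>t. c t * G (F i t) \<partial>lborel) = (\<Sum>v\<in>range (F i). coef i v * G v)" for G :: "'a \<times> 'a \<Rightarrow> complex" and i
  proof -
    have "c t * G (F i t) = (\<Sum>v\<in>range (F i). (indicator {t. F i t = v} t * c t) * G v)" for t
    proof -
      have "(\<Sum>v\<in>range (F i). (indicator {t. F i t = v} t * c t) * G v) =
          (\<Sum>v\<in>range (F i). if v = F i t then c t * G v else 0)"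
        by (intro sum.cong) (auto simp: indicator_def)
      then show ?thesis using fin[of i] by simp
    qed
    then have "(\<integral>t. c t * G (F i t) \<partial>lborel) = (\<integral>t. (\<Sum>v\<in>range (F i). (indicator {t. F i t = v} t * c t) * G v) \<partial>lborel)"
      by simp
    also have "\<dots> = (\<Sum>v\<in>range (F i). (\<integral>t. (indicator {t. F i t = v} t * c t) * G v \<partial>lborel))"
    proof (intro Bochner_Integration.integral_sum integrable_mult_left)
      fix v
      have "{t. F i t = v} \<in> sets lborel" using simple_functionD(2)[OF F(1)[of i], of "{v}"] by (simp add: vimage_def)
      then show "integrable lborel (\<lambda>t. indicator {t. F i t = v} t * c t)"
        using integrable_mult_indicator[OF _ c_int, of "{t. F i t = v}"]
        by (simp add: indicator_def of_bool_def scaleR_conv_of_real if_distrib[of "\<lambda>x. x * _"] if_distrib[of complex_of_real] cong: if_cong)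
    qed
    finally show ?thesis by (simp add: coef_def)
  qed
  have \<psi>_eq: "\<psi> i = (\<lambda>y. \<Sum>v\<in>range (F i). coef i v * atom \<gamma> v y)" for i
    unfolding \<psi>_def by (rule ext, rule simple_int)
  have \<psi>_S: "\<psi> i \<in> schwartz" for i
    unfolding \<psi>_eq by (intro schwartz_sum schwartz_cmult at_S)
  have T_\<psi>: "T (\<psi> i) = (\<integral>t. c t * T (atom \<gamma> (F i t)) \<partial>lborel)" for i
    unfolding \<psi>_eq simple_int[of "\<lambda>t. T (atom \<gamma> t)"] by (intro tempered_sum T at_S)
  obtain D0 where D0: "D0 \<ge> 0" "\<And>t. jet_seminorm k m (atom \<gamma> t) \<le> D0 * (1 + norm t) ^ (m + k)"
    using jet_seminorm_atom[OF \<gamma>, of k m] by blast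
  have T_atom: "norm (T (atom \<gamma> t)) \<le> C * D0 * (1 + norm t) ^ (m + k)" for t
    using order_trans[OF C(2)[OF at_S] mult_left_mono[OF D0(2) C(1)]] by (simp add: mult.assoc)
  \<comment> \<open>The limit on the side of the functional: dominated convergence, by continuity in
    \<open>t\<close> and polynomial growth.\<close>
  have lim1: "(\<lambda>i. T (\<psi> i)) \<longlonglongrightarrow> (\<integral>t. c t * T (atom \<gamma> t) \<partial>lborel)"
    unfolding T_\<psi>
  proof (rule integral_dominated_convergence)
    show "integrable lborel (\<lambda>t. norm (c t) * (C * D0 * 2 ^ (m + k) * (1 + norm t) ^ (m + k)))" by (rule cint)
    show "AE t in lborel. (\<lambda>i. c t * T (atom \<gamma> (F i t))) \<longlonglongrightarrow> c t * T (atom \<gamma> t)"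
      using cont F(2) by (intro AE_I2 tendsto_mult tendsto_const isCont_tendsto_compose[of _ "\<lambda>t. T (atom \<gamma> t)"])
        (auto simp: continuous_on_eq_continuous_at)
    show "AE t in lborel. norm (c t * T (atom \<gamma> (F i t))) \<le> norm (c t) * (C * D0 * 2 ^ (m + k) * (1 + norm t) ^ (m + k))" for i
    proof (intro AE_I2)
      fix t
      have "norm (T (atom \<gamma> (F i t))) \<le> C * D0 * (2 ^ (m + k) * (1 + norm t) ^ (m + k))"
        using C(1) D0(1) by (intro order_trans[OF T_atom] mult_left_mono norm_F) auto
      then show "norm (c t * T (atom \<gamma> (F i t))) \<le> norm (c t) * (C * D0 * 2 ^ (m + k) * (1 + norm t) ^ (m + k))"
        unfolding norm_mult by (intro mult_left_mono) (auto simp: mult.assoc)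
    qed
  qed measurable
  obtain D P where D: "D \<ge> 0" "\<And>s t. jet_seminorm k m (\<lambda>y. atom \<gamma> s y - atom \<gamma> t y)
      \<le> D * ((1 + norm s) * (1 + norm t)) ^ P * norm (s - t)"
    using lip[of k m] by blast
  \<comment> \<open>The limit on the side of the test functions: in the seminorm that controls
    \<open>T\<close>, the error is at most the integral of the errors of the single atoms.\<close>
  have diff: "norm (T (\<psi> i) - T h) \<le> C * (\<integral>t. norm (c t) * E D P i t \<partial>lborel)" for i
  proof -
    let ?u = "\<lambda>t y. c t * (atom \<gamma> (F i t) y - atom \<gamma> t y)"
    have jet_u: "jet m' (?u t) y = norm (c t) * jet m' (\<lambda>y. atom \<gamma> (F i t) y - atom \<gamma> t y) y" for m' t y
      by (rule jet_cmult[OF schwartz_smooth[OF diff_S]])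
    have fam: "smooth_family lborel ?u"
      unfolding smooth_family_def
    proof (intro conjI allI)
      show "smooth (?u t)" for t by (rule smooth_cmult[OF schwartz_smooth[OF diff_S]])
      show "(\<lambda>t. ?u t y) \<in> borel_measurable lborel" for y by measurable
      fix m'
      obtain D' P' where D': "D' \<ge> 0" "\<And>s t. jet_seminorm 0 m' (\<lambda>y. atom \<gamma> s y - atom \<gamma> t y)
          \<le> D' * ((1 + norm s) * (1 + norm t)) ^ P' * norm (s - t)"
        using lip[of 0 m'] by blast
      have "jet m' (?u t) y \<le> norm (c t) * (D' * 2 ^ P' * 3 * (1 + norm t) ^ (P' + P' + 1))" for t y
      proof -
        have "jet m' (\<lambda>y. atom \<gamma> (F i t) y - atom \<gamma> t y) y \<le> jet_seminorm 0 m' (\<lambda>y. atom \<gamma> (F i t) y - atom \<gamma> t y)"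
          using jet_seminorm_upper[OF diff_S, of y 0 m'] by simp
        also have "\<dots> \<le> E D' P' i t" unfolding E_def by (rule D'(2))
        also have "\<dots> \<le> D' * 2 ^ P' * 3 * (1 + norm t) ^ (P' + P' + 1)" by (rule E_bound[OF D'(1)])
        finally show ?thesis unfolding jet_u by (rule mult_left_mono) simp
      qed
      then show "\<exists>G. integrable lborel G \<and> (\<forall>t y. jet m' (?u t) y \<le> G t)"
        using cint by blast
    qed
    have int1: "integrable lborel (\<lambda>t. c t * atom \<gamma> (g' t) y)"
      if "\<And>t. norm (g' t) \<le> 2 * norm t" "g' \<in> borel_measurable borel" for g' y
    proof -
      have [measurable]: "g' \<in> borel_measurable borel" by fact
      show ?thesis
      proof (rule Bochner_Integration.integrable_bound)
        show "integrable lborel (\<lambda>t. norm (c t) * (jet_seminorm 0 0 \<gamma> * (1 + norm t) ^ 0))" by (rule cint)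
        show "AE t in lborel. norm (c t * atom \<gamma> (g' t) y) \<le> norm (norm (c t) * (jet_seminorm 0 0 \<gamma> * (1 + norm t) ^ 0))"
          using schwartz_bounded[OF \<gamma>] jet_seminorm_nonneg[OF \<gamma>, of 0 0]
          by (intro AE_I2) (auto simp: norm_mult atom_def intro!: mult_left_mono)
        have "(\<lambda>t. atom \<gamma> (g' t) y) \<in> borel_measurable borel"
          by (rule measurable_compose[OF \<open>g' \<in> borel_measurable borel\<close>]) measurable
        then show "(\<lambda>t. c t * atom \<gamma> (g' t) y) \<in> borel_measurable lborel" by measurable
      qed
    qed
    have "\<psi> i y - h y = (\<integral>t. ?u t y \<partial>lborel)" for y
      unfolding \<psi>_def h_eq right_diff_distrib
      using int1[of "F i" y] int1[of "\<lambda>t. t" y] F(3) by simp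
    then have eq: "(\<lambda>y. \<psi> i y - h y) = (\<lambda>y. \<integral>t. ?u t y \<partial>lborel)" by (rule ext)
    have "jet_seminorm k m (\<lambda>y. \<psi> i y - h y) \<le> (\<integral>t. norm (c t) * E D P i t \<partial>lborel)"
    proof (rule jet_seminorm_least)
      fix y
      have "(1 + norm y) ^ k * jet m (\<lambda>y. \<psi> i y - h y) y \<le> (1 + norm y) ^ k * (\<integral>t. jet m (?u t) y \<partial>lborel)"
        unfolding eq by (intro mult_left_mono jet_integral_le fam) simp
      also have "\<dots> = (\<integral>t. (1 + norm y) ^ k * jet m (?u t) y \<partial>lborel)" by simp
      also have "\<dots> \<le> (\<integral>t. norm (c t) * E D P i t \<partial>lborel)"
      proof (rule integral_mono)
        show "integrable lborel (\<lambda>t. (1 + norm y) ^ k * jet m (?u t) y)"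
          by (intro integrable_mult_right jet_integrable fam)
        show "integrable lborel (\<lambda>t. norm (c t) * E D P i t)"
        proof (rule Bochner_Integration.integrable_bound)
          show "integrable lborel (\<lambda>t. norm (c t) * (D * 2 ^ P * 3 * (1 + norm t) ^ (P + P + 1)))" by (rule cint)
          show "AE t in lborel. norm (norm (c t) * E D P i t) \<le> norm (norm (c t) * (D * 2 ^ P * 3 * (1 + norm t) ^ (P + P + 1)))"
            using E_nonneg[OF D(1)] E_bound[OF D(1)] D(1)
            by (intro AE_I2) (auto simp: abs_mult intro!: mult_left_mono)
        qed measurable
        fix t
        have "(1 + norm y) ^ k * jet m (\<lambda>y. atom \<gamma> (F i t) y - atom \<gamma> t y) y \<le> E D P i t"
          unfolding E_def by (rule order_trans[OF jet_seminorm_upper[OF diff_S] D(2)])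
        then show "(1 + norm y) ^ k * jet m (?u t) y \<le> norm (c t) * E D P i t"
          unfolding jet_u by (simp add: mult.left_commute mult_left_mono)
      qed
      finally show "(1 + norm y) ^ k * jet m (\<lambda>y. \<psi> i y - h y) y \<le> (\<integral>t. norm (c t) * E D P i t \<partial>lborel)" .
    qed
    then show ?thesis
      unfolding tempered_diff[OF T \<psi>_S h, symmetric]
      using order_trans[OF C(2)[OF schwartz_diff[OF \<psi>_S h]] mult_left_mono[OF _ C(1)]] by blast
  qed
  have "(\<lambda>i. \<integral>t. norm (c t) * E D P i t \<partial>lborel) \<longlonglongrightarrow> (\<integral>t. norm (c t) * 0 \<partial>(lborel :: ('a \<times> 'a) measure))"
  proof (rule integral_dominated_convergence)
    show "integrable lborel (\<lambda>t. norm (c t) * (D * 2 ^ P * 3 * (1 + norm t) ^ (P + P + 1)))" by (rule cint)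
    show "AE t in lborel. (\<lambda>i. norm (c t) * E D P i t) \<longlonglongrightarrow> norm (c t) * 0"
      by (intro AE_I2 tendsto_mult tendsto_const E_lim)
    show "AE t in lborel. norm (norm (c t) * E D P i t) \<le> norm (c t) * (D * 2 ^ P * 3 * (1 + norm t) ^ (P + P + 1))" for i
      using E_nonneg[OF D(1)] E_bound[OF D(1)]
      by (intro AE_I2) (auto simp: abs_mult intro!: mult_left_mono)
  qed measurable
  then have "(\<lambda>i. C * (\<integral>t. norm (c t) * E D P i t \<partial>lborel)) \<longlonglongrightarrow> 0"
    by (intro tendsto_mult_right_zero) simp
  then have "(\<lambda>i. T (\<psi> i) - T h) \<longlonglongrightarrow> 0"
    by (rule Lim_null_comparison[rotated]) (use diff in simp)
  then have "(\<lambda>i. T (\<psi> i)) \<longlonglongrightarrow> T h" by (rule LIM_zero_cancel)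
  with lim1 show ?thesis by (rule LIMSEQ_unique[symmetric])
qed

section \<open>The reproducing formula of the short-time Fourier transform\<close>

lemma borel_measurable_cnj [measurable]:
  "f \<in> borel_measurable M \<Longrightarrow> (\<lambda>x. cnj (f x)) \<in> borel_measurable M"
  by (rule measurable_compose[OF _ borel_measurable_continuous_onI]) (auto intro!: continuous_intros)

text \<open>One factor is concentrated near 0 and the other near \<open>x\<close>, so their overlap
  is small for large \<open>x\<close>: by Peetre's inequality \<open>N\<close> powers of decay of
  each combine to \<open>N\<close> powers in \<open>x\<close>.\<close>

lemma jet_seminorm_mult_translate:
  "\<exists>C\<ge>0. \<forall>h\<in>schwartz. \<forall>\<eta>\<in>schwartz. \<forall>x::'a::euclidean_space.
     jet_seminorm k m (\<lambda>y. h y * \<eta> (y - x)) \<le> C * jet_seminorm (k + N) m h * jet_seminorm N m \<eta> / (1 + norm x) ^ N"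
proof -
  obtain C where C: "C \<ge> 0" "\<And>\<phi> \<psi>::'a \<Rightarrow> complex. \<And>x. smooth \<phi> \<Longrightarrow> smooth \<psi> \<Longrightarrow>
     jet m (\<lambda>x. \<phi> x * \<psi> x) x \<le> C * (jet m \<phi> x * jet m \<psi> x)"
    using jet_mult[of m, where 'a='a] by blast
  have "jet_seminorm k m (\<lambda>y. h y * \<eta> (y - x)) \<le> C * jet_seminorm (k + N) m h * jet_seminorm N m \<eta> / (1 + norm x) ^ N"
    if h: "h \<in> schwartz" and \<eta>: "\<eta> \<in> schwartz" for h \<eta> and x :: 'a
  proof (rule jet_seminorm_least)
    fix y
    let ?J = "jet m (\<lambda>y. h y * \<eta> (y - x)) y"
    have "?J \<le> C * (jet m h y * jet m (\<lambda>y. \<eta> (y - x)) y)"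
      by (intro C(2) smooth_translate schwartz_smooth h \<eta>)
    then have J: "?J \<le> C * (jet m h y * jet m \<eta> (y - x))"
      by (simp only: jet_translate[OF schwartz_smooth[OF \<eta>]])
    have w: "(1 + norm x) ^ N \<le> ((1 + norm (y - x)) * (1 + norm y)) ^ N"
      using weight_translate[of x y] by (intro power_mono) (simp_all add: norm_minus_commute)
    have "(1 + norm x) ^ N * ((1 + norm y) ^ k * ?J) \<le>
        ((1 + norm (y - x)) * (1 + norm y)) ^ N * ((1 + norm y) ^ k * (C * (jet m h y * jet m \<eta> (y - x))))"
      using C(1) by (intro mult_mono w mult_left_mono J) (auto intro!: mult_nonneg_nonneg)
    also have "\<dots> = C * (((1 + norm y) ^ (k + N) * jet m h y) * ((1 + norm (y - x)) ^ N * jet m \<eta> (y - x)))"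
      by (simp only: power_add power_mult_distrib mult_ac)
    also have "\<dots> \<le> C * (jet_seminorm (k + N) m h * jet_seminorm N m \<eta>)"
      using C(1) by (intro mult_left_mono mult_mono jet_seminorm_upper h \<eta> jet_seminorm_nonneg) auto
    finally have "(1 + norm x) ^ N * ((1 + norm y) ^ k * ?J) \<le> C * jet_seminorm (k + N) m h * jet_seminorm N m \<eta>"
      by (simp only: mult.assoc)
    then show "(1 + norm y) ^ k * ?J \<le> C * jet_seminorm (k + N) m h * jet_seminorm N m \<eta> / (1 + norm x) ^ N"
      by (simp only: pos_le_divide_eq weight_pos mult.commute)
  qed
  then show ?thesis using C(1) by blast
qed

text \<open>The inner product with an atom, hence conjugate-linear in the atom, unlike the bilinear
  pairing in \<open>stft\<close>. These are the coefficients with which a test function is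
  synthesised from atoms.\<close>

definition stft_coeff :: "('a::euclidean_space \<Rightarrow> complex) \<Rightarrow> ('a \<Rightarrow> complex) \<Rightarrow> 'a \<times> 'a \<Rightarrow> complex" where
  "stft_coeff \<gamma> h t = (\<integral>y. h y * cnj (atom \<gamma> t y) \<partial>lborel)"

lemma stft_coeff_fourier:
  "stft_coeff \<gamma> h t = fourier (\<lambda>y. h y * cnj (\<gamma> (y - fst t))) (- snd t)"
  by (simp add: stft_coeff_def fourier_def atom_def plane_wave_minus mult.assoc)

lemma atom_pair_continuous:
  assumes "\<gamma> \<in> schwartz"
  shows "continuous_on UNIV (\<lambda>(t, y). atom \<gamma> t y)"
  unfolding atom_def case_prod_beta
  by (intro continuous_intros continuous_plane_wave
      continuous_on_compose2[OF smooth_continuous_on[OF schwartz_smooth[OF assms], of UNIV]]) auto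

lemma atom_measurable:
  assumes "\<gamma> \<in> schwartz" "f \<in> borel_measurable M" "u \<in> borel_measurable M"
  shows "(\<lambda>z. atom \<gamma> (f z) (u z)) \<in> borel_measurable M"
proof -
  have "(\<lambda>(t, y). atom \<gamma> t y) \<in> borel_measurable (borel \<Otimes>\<^sub>M borel)"
    unfolding borel_prod by (rule borel_measurable_continuous_onI[OF atom_pair_continuous[OF assms(1)]])
  from measurable_compose[OF measurable_Pair[OF assms(2,3)] this] show ?thesis by simp
qed

lemma weight_Pair_le:
  "1 + norm t \<le> (1 + norm (fst t)) * (1 + norm (snd (t :: 'a::real_normed_vector \<times> 'b::real_normed_vector)))"
proof -
  have "norm t \<le> norm (fst t) + norm (snd t)" using norm_Pair_le[of "fst t" "snd t"] by simp
  moreover have "0 \<le> norm (fst t) * norm (snd t)" by simp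
  moreover have "(1 + norm (fst t)) * (1 + norm (snd t)) = 1 + norm (fst t) + norm (snd t) + norm (fst t) * norm (snd t)"
    by (simp add: algebra_simps)
  ultimately show ?thesis by linarith
qed

text \<open>In the frequency the coefficient is a Fourier transform and decays by
  \<open>fourier_decay\<close>; in the position the product with a translated window is small in
  every seminorm. \<open>P\<close> powers in each variable give \<open>P\<close> powers
  jointly.\<close>

lemma stft_coeff_rapidly_decreasing:
  fixes \<gamma> h :: "'a::euclidean_space \<Rightarrow> complex"
  assumes \<gamma>: "\<gamma> \<in> schwartz" and h: "h \<in> schwartz"
  shows "rapidly_decreasing (stft_coeff \<gamma> h)"
  unfolding rapidly_decreasing_def
proof (intro conjI allI)
  note [measurable] = atom_measurable[OF \<gamma>] schwartz_measurable[OF h]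
  have "(\<lambda>t. \<integral>y. h y * cnj (atom \<gamma> t y) \<partial>lborel) \<in> borel_measurable borel"
    by (rule lborel.borel_measurable_lebesgue_integral) (simp add: case_prod_beta)
  then show "stft_coeff \<gamma> h \<in> borel_measurable borel" by (simp add: stft_coeff_def[abs_def])
  fix P
  let ?D = "DIM('a) + 2"
  let ?\<eta> = "\<lambda>y. cnj (\<gamma> y)"
  have \<eta>: "?\<eta> \<in> schwartz" by (rule schwartz_cnj[OF \<gamma>])
  obtain A where A: "A \<ge> 0" "\<And>\<phi> \<xi>::'a. \<phi> \<in> schwartz \<Longrightarrow> (1 + norm \<xi>) ^ P * norm (fourier \<phi> \<xi>) \<le> A * jet_seminorm ?D P \<phi>"
    using fourier_decay[of P, where 'a='a] by blast
  obtain B where B: "B \<ge> 0" "\<And>h \<eta> (x::'a). h \<in> schwartz \<Longrightarrow> \<eta> \<in> schwartz \<Longrightarrow>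
     jet_seminorm ?D P (\<lambda>y. h y * \<eta> (y - x)) \<le> B * jet_seminorm (?D + P) P h * jet_seminorm P P \<eta> / (1 + norm x) ^ P"
    using jet_seminorm_mult_translate[of ?D P P, where 'a='a] by blast
  let ?K = "A * (B * jet_seminorm (?D + P) P h * jet_seminorm P P ?\<eta>)"
  have "(1 + norm t) ^ P * norm (stft_coeff \<gamma> h t) \<le> ?K" for t
  proof -
    have "(1 + norm (snd t)) ^ P * norm (stft_coeff \<gamma> h t) \<le> A * jet_seminorm ?D P (\<lambda>y. h y * ?\<eta> (y - fst t))"
      unfolding stft_coeff_fourier
      using A(2)[OF schwartz_mult[OF h schwartz_translate(1)[OF \<eta>, of "fst t"]], of "- snd t"] by simp
    also have "\<dots> \<le> A * (B * jet_seminorm (?D + P) P h * jet_seminorm P P ?\<eta> / (1 + norm (fst t)) ^ P)"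
      by (intro mult_left_mono B(2) h \<eta> A(1))
    also have "\<dots> = ?K / (1 + norm (fst t)) ^ P" by simp
    finally have "(1 + norm (fst t)) ^ P * ((1 + norm (snd t)) ^ P * norm (stft_coeff \<gamma> h t)) \<le> ?K"
      by (simp only: pos_le_divide_eq weight_pos mult.commute)
    moreover have "(1 + norm t) ^ P * norm (stft_coeff \<gamma> h t) \<le>
        ((1 + norm (fst t)) * (1 + norm (snd t))) ^ P * norm (stft_coeff \<gamma> h t)"
      by (intro mult_right_mono power_mono weight_Pair_le) auto
    ultimately show ?thesis by (simp only: power_mult_distrib mult.assoc)
  qed
  then show "\<exists>K. \<forall>t. (1 + norm t) ^ P * norm (stft_coeff \<gamma> h t) \<le> K" by blast
qed

text \<open>For a fixed position the frequency integral inverts the Fourier transform of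
  \<open>h\<close> times a conjugated translate of the window. It returns \<open>h y\<close> times
  the squared modulus of the translate at \<open>y\<close>, and the integral over positions yields
  the squared norm of the window.\<close>

lemma stft_reproducing:
  fixes \<gamma> h :: "'a::euclidean_space \<Rightarrow> complex"
  assumes \<kappa>: "inversion_constant TYPE('a) \<kappa>" and \<gamma>: "\<gamma> \<in> schwartz" and h: "h \<in> schwartz"
  shows "(\<integral>t. stft_coeff \<gamma> h t * atom \<gamma> t y \<partial>lborel) = \<kappa> * (\<integral>x. \<gamma> x * cnj (\<gamma> x) \<partial>lborel) * h y"
proof -
  let ?d = "stft_coeff \<gamma> h"
  have rd: "rapidly_decreasing ?d" by (rule stft_coeff_rapidly_decreasing[OF \<gamma> h])
  note [measurable] = atom_measurable[OF \<gamma>] schwartz_measurable[OF h] schwartz_measurable[OF \<gamma>]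
  have [measurable]: "?d \<in> borel_measurable borel" using rd by (simp add: rapidly_decreasing_def)
  have int: "integrable lborel (\<lambda>t. ?d t * atom \<gamma> t y)"
  proof (rule Bochner_Integration.integrable_bound)
    show "integrable lborel (\<lambda>t. norm (?d t) * (1 + norm t) ^ 0 * jet_seminorm 0 0 \<gamma>)"
      by (intro integrable_mult_left rapidly_decreasing_integrable rd)
    show "AE t in lborel. norm (?d t * atom \<gamma> t y) \<le> norm (norm (?d t) * (1 + norm t) ^ 0 * jet_seminorm 0 0 \<gamma>)"
      using schwartz_bounded[OF \<gamma>] jet_seminorm_nonneg[OF \<gamma>, of 0 0]
      by (intro AE_I2) (auto simp: norm_mult atom_def intro!: mult_left_mono)
  qed measurable
  have inner: "(\<integral>\<omega>. ?d (x, \<omega>) * atom \<gamma> (x, \<omega>) y \<partial>lborel) = \<kappa> * h y * (\<gamma> (y - x) * cnj (\<gamma> (y - x)))" for x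
  proof -
    let ?\<phi> = "\<lambda>y. h y * cnj (\<gamma> (y - x))"
    have \<phi>: "?\<phi> \<in> schwartz" by (intro schwartz_mult h schwartz_translate(1)[OF schwartz_cnj[OF \<gamma>]])
    have [measurable]: "fourier ?\<phi> \<in> borel_measurable borel" by (intro schwartz_measurable fourier_schwartz \<phi>)
    have "(\<integral>\<omega>. ?d (x, \<omega>) * atom \<gamma> (x, \<omega>) y \<partial>lborel) =
        (\<integral>\<omega>. (\<lambda>\<omega>. \<gamma> (y - x) * (fourier ?\<phi> \<omega> * plane_wave (- y) \<omega>)) (- \<omega>) \<partial>lborel)"
      by (simp add: stft_coeff_fourier atom_def plane_wave_def mult_ac inner_commute)
    also have "\<dots> = (\<integral>\<omega>. \<gamma> (y - x) * (fourier ?\<phi> \<omega> * plane_wave (- y) \<omega>) \<partial>lborel)"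
      by (rule integral_reflect) measurable
    also have "\<dots> = \<gamma> (y - x) * (\<kappa> * ?\<phi> y)"
      using \<kappa> \<phi> unfolding inversion_constant_def by simp
    finally show ?thesis by (simp add: mult_ac)
  qed
  have "(\<integral>t. ?d t * atom \<gamma> t y \<partial>lborel) = (\<integral>x. (\<integral>\<omega>. ?d (x, \<omega>) * atom \<gamma> (x, \<omega>) y \<partial>lborel) \<partial>lborel)"
    using lborel_pair.integral_fst'[of "\<lambda>t. ?d t * atom \<gamma> t y"] int by (simp add: lborel_prod)
  also have "\<dots> = \<kappa> * h y * (\<integral>x. (\<lambda>x. \<gamma> (x + y) * cnj (\<gamma> (x + y))) (- x) \<partial>lborel)"
    unfolding inner by simp
  also have "(\<integral>x. (\<lambda>x. \<gamma> (x + y) * cnj (\<gamma> (x + y))) (- x) \<partial>lborel) = (\<integral>x. \<gamma> (x + y) * cnj (\<gamma> (x + y)) \<partial>lborel)"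
    by (rule integral_reflect) measurable
  also have "\<dots> = (\<integral>x. \<gamma> x * cnj (\<gamma> x) \<partial>lborel)"
    by (rule integral_translate[of "\<lambda>x. \<gamma> x * cnj (\<gamma> x)"]) measurable
  finally show ?thesis by (simp add: mult_ac)
qed

text \<open>The reproducing formula by duality: a distribution is recovered on an arbitrary test
  function from its values on atoms, that is, from its short-time Fourier transform.\<close>

lemma tempered_stft_expansion:
  fixes \<gamma> h :: "'a::euclidean_space \<Rightarrow> complex"
  assumes \<kappa>: "inversion_constant TYPE('a) \<kappa>" and \<gamma>: "\<gamma> \<in> schwartz" "\<gamma> \<noteq> (\<lambda>_. 0)"
    and h: "h \<in> schwartz" and T: "T \<in> tempered_distributions"
  shows "\<kappa> * (\<integral>x. \<gamma> x * cnj (\<gamma> x) \<partial>lborel) * T h = (\<integral>t. stft_coeff \<gamma> h t * T (atom \<gamma> t) \<partial>lborel)"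
proof -
  let ?c = "\<kappa> * (\<integral>x. \<gamma> x * cnj (\<gamma> x) \<partial>lborel)"
  have "T (\<lambda>y. ?c * h y) = (\<integral>t. stft_coeff \<gamma> h t * T (atom \<gamma> t) \<partial>lborel)"
    by (rule tempered_superposition[OF T \<gamma>(1) schwartz_cmult[OF h] stft_coeff_rapidly_decreasing[OF \<gamma>(1) h]])
      (rule stft_reproducing[OF \<kappa> \<gamma>(1) h, symmetric])
  then show ?thesis by (simp only: tempered_cmult[OF T h])
qed

section \<open>The kernel of the Born--Jordan operator\<close>

lemma fourier_atom:
  fixes \<gamma> :: "'a::euclidean_space \<Rightarrow> complex"
  assumes \<gamma>: "\<gamma> \<in> schwartz"
  shows "fourier (atom \<gamma> (x, \<omega>)) \<xi> = plane_wave (\<omega> + \<xi>) x * fourier \<gamma> (\<omega> + \<xi>)"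
proof -
  note [measurable] = schwartz_measurable[OF \<gamma>]
  have "fourier (atom \<gamma> (x, \<omega>)) \<xi> = (\<integral>y. (\<lambda>y. \<gamma> y * plane_wave (\<omega> + \<xi>) (x + y)) (y + - x) \<partial>lborel)"
    by (simp add: fourier_def atom_def plane_wave_add mult.assoc)
  also have "\<dots> = (\<integral>y. \<gamma> y * plane_wave (\<omega> + \<xi>) (x + y) \<partial>lborel)"
    by (rule integral_translate) measurable
  also have "\<dots> = (\<integral>y. plane_wave (\<omega> + \<xi>) x * (\<gamma> y * plane_wave (\<omega> + \<xi>) y) \<partial>lborel)"
    by (simp only: plane_wave_add_right mult_ac)
  also have "\<dots> = plane_wave (\<omega> + \<xi>) x * fourier \<gamma> (\<omega> + \<xi>)"
    by (simp add: fourier_def)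
  finally show ?thesis .
qed

text \<open>Parseval's identity for the multiplier. The multiplication formula moves the outer
  transform to \<open>b\<close>; the rotations that accompany the two transforms preserve both the
  measure and \<open>Theta\<close>, so they disappear from the integral.\<close>

lemma bj_op_inner:
  fixes a b :: "'a::euclidean_space \<times> 'a \<Rightarrow> complex"
  assumes a: "a \<in> schwartz" and b: "b \<in> schwartz"
  shows "(\<integral>y. bj_op a y * cnj (b y) \<partial>lborel) = (\<integral>w. Theta w * fourier a w * cnj (fourier b w) \<partial>lborel)"
proof -
  define u where "u z = Theta z * sympl_fourier a z" for z
  define v where "v w = cnj (b (- sympl_rot w))" for w
  have u: "u \<in> schwartz" unfolding u_def[abs_def] by (intro Theta_mult_schwartz sympl_fourier_schwartz a)
  have v: "v \<in> schwartz" unfolding v_def[abs_def]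
    by (intro schwartz_continuousD[OF schwartz_continuous_isometry, of "\<lambda>w. - sympl_rot w" "\<lambda>w. cnj (b w)"]
        bounded_linear_minus bounded_linear_sympl_rot schwartz_cnj b) simp
  note [measurable] = schwartz_measurable[OF u] schwartz_measurable[OF v] schwartz_measurable[OF fourier_schwartz[OF u]]
    schwartz_measurable[OF fourier_schwartz[OF a]] schwartz_measurable[OF fourier_schwartz[OF b]] schwartz_measurable[OF b]
  have Fv: "fourier v z = cnj (fourier b (sympl_rot z))" for z
  proof -
    have "fourier v z = (\<integral>w. (\<lambda>w. v w * plane_wave z w) (sympl_rot w) \<partial>lborel)"
      unfolding fourier_def by (rule integral_sympl_rot[symmetric]) measurable
    also have "\<dots> = (\<integral>w. cnj (b w * plane_wave (sympl_rot z) w) \<partial>lborel)"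
      by (simp add: v_def plane_wave_def inner_sympl_rot cis_cnj)
    also have "\<dots> = cnj (fourier b (sympl_rot z))" by (simp only: Bochner_Integration.integral_cnj fourier_def)
    finally show ?thesis .
  qed
  have "(\<integral>y. bj_op a y * cnj (b y) \<partial>lborel) = (\<integral>y. (\<lambda>w. fourier u w * v w) (sympl_rot y) \<partial>lborel)"
    by (simp add: bj_op_def u_def[symmetric, abs_def] sympl_fourier_eq[of u] v_def)
  also have "\<dots> = (\<integral>w. fourier u w * v w \<partial>lborel)" by (rule integral_sympl_rot) measurable
  also have "\<dots> = (\<integral>z. u z * fourier v z \<partial>lborel)"
    by (intro fourier_multiplication schwartz_integrable u v)
  also have "\<dots> = (\<integral>z. (\<lambda>w. Theta w * fourier a w * cnj (fourier b w)) (sympl_rot z) \<partial>lborel)"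
    by (simp add: u_def Fv sympl_fourier_eq)
  also have "\<dots> = (\<integral>w. Theta w * fourier a w * cnj (fourier b w) \<partial>lborel)"
    by (rule integral_sympl_rot) measurable
  finally show ?thesis .
qed

text \<open>The cross terms of the quadratic phase are linear in \<open>\<eta>\<close> and form a
  plane wave of frequency \<open>s *\<^sub>R prod.swap w\<close>. This is the source of the
  shear.\<close>

lemma chirp_translate:
  "chirp s (\<eta> - w) = chirp s w * (chirp s \<eta> * plane_wave (s *\<^sub>R prod.swap w) \<eta>)"
  by (simp add: chirp_def plane_wave_def cis_mult inner_prod_def inner_diff_left inner_diff_right
      inner_commute algebra_simps)

text \<open>A function that is not integrable has Bochner integral 0 by convention, so the bound
  extends to all functions.\<close>

lemma norm_integral_le_nn_integral:
  fixes f :: "_ \<Rightarrow> 'b::{banach, second_countable_topology}"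
  shows "ennreal (norm (\<integral>x. f x \<partial>M)) \<le> (\<integral>\<^sup>+x. ennreal (norm (f x)) \<partial>M)"
  by (cases "integrable M f") (simp_all add: integral_norm_bound_ennreal not_integrable_integral_eq)

text \<open>Fubini over the chirp parameter; the wave split off by each translated chirp then shifts
  the argument of the Fourier transform.\<close>

lemma Theta_translate_fourier:
  fixes \<rho> :: "'a::euclidean_space \<times> 'a \<Rightarrow> complex"
  assumes \<rho>: "\<rho> \<in> schwartz"
  shows "(\<integral>\<eta>. Theta (\<eta> - w) * (\<rho> \<eta> * plane_wave v \<eta>) \<partial>lborel) =
    (\<integral>s. indicator {-1/2..1/2::real} s * (chirp s w * fourier (\<lambda>\<eta>. chirp s \<eta> * \<rho> \<eta>) (v + s *\<^sub>R prod.swap w)) \<partial>lborel)"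
proof -
  note [measurable] = schwartz_measurable[OF \<rho>]
  let ?f = "\<lambda>s \<eta>. indicator {-1/2..1/2::real} s * (chirp s (\<eta> - w) * (\<rho> \<eta> * plane_wave v \<eta>))"
  have "(\<integral>\<eta>. Theta (\<eta> - w) * (\<rho> \<eta> * plane_wave v \<eta>) \<partial>lborel) = (\<integral>\<eta>. (\<integral>s. ?f s \<eta> \<partial>lborel) \<partial>lborel)"
    unfolding Theta_eq Bochner_Integration.integral_mult_left_zero[symmetric]
    by (intro Bochner_Integration.integral_cong refl) (auto simp: indicator_def)
  also have "\<dots> = (\<integral>s. (\<integral>\<eta>. ?f s \<eta> \<partial>lborel) \<partial>lborel)"
  proof (rule integral_swap)
    show "integrable lborel (indicator {-1/2..1/2::real} :: real \<Rightarrow> real)"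
      by (intro integrable_real_indicator) auto
    show "integrable lborel (\<lambda>\<eta>. norm (\<rho> \<eta>))" by (intro integrable_norm schwartz_integrable \<rho>)
    show "norm (?f s \<eta>) \<le> indicator {-1/2..1/2} s * norm (\<rho> \<eta>)" for s \<eta>
      by (simp add: norm_mult indicator_def)
    show "case_prod ?f \<in> borel_measurable (borel \<Otimes>\<^sub>M borel)" by measurable
  qed
  also have "\<dots> = (\<integral>s. indicator {-1/2..1/2::real} s *
      (chirp s w * fourier (\<lambda>\<eta>. chirp s \<eta> * \<rho> \<eta>) (v + s *\<^sub>R prod.swap w)) \<partial>lborel)"
  proof (rule Bochner_Integration.integral_cong[OF refl])
    fix s :: real
    have "(\<integral>\<eta>. ?f s \<eta> \<partial>lborel) = (\<integral>\<eta>. (indicator {-1/2..1/2} s * chirp s w) *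
        (chirp s \<eta> * \<rho> \<eta> * plane_wave (v + s *\<^sub>R prod.swap w) \<eta>) \<partial>lborel)"
      by (simp only: chirp_translate plane_wave_add mult_ac)
    also have "\<dots> = (indicator {-1/2..1/2} s * chirp s w) * fourier (\<lambda>\<eta>. chirp s \<eta> * \<rho> \<eta>) (v + s *\<^sub>R prod.swap w)"
      by (simp only: fourier_def Bochner_Integration.integral_mult_right_zero)
    finally show "(\<integral>\<eta>. ?f s \<eta> \<partial>lborel) = indicator {-1/2..1/2::real} s *
      (chirp s w * fourier (\<lambda>\<eta>. chirp s \<eta> * \<rho> \<eta>) (v + s *\<^sub>R prod.swap w))" by (simp only: mult.assoc)
  qed
  finally show ?thesis .
qed

text \<open>By Parseval the coefficient integrates \<open>Theta\<close> against the product of two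
  translates of the transform of \<open>\<gamma>\<close>. Their overlap is small in
  \<open>w - \<omega>\<close>, and the transform of a chirp times this overlap is small in its
  argument \<open>z - x + s *\<^sub>R prod.swap w\<close>; both bounds are uniform in the chirp
  parameter.\<close>

lemma bj_kernel_bound:
  fixes \<gamma> :: "'a::euclidean_space \<times> 'a \<Rightarrow> complex"
  assumes \<gamma>: "\<gamma> \<in> schwartz"
  shows "\<exists>C\<ge>0. \<forall>z w x \<omega>. ennreal (norm (stft_coeff \<gamma> (bj_op (atom \<gamma> (z, w))) (x, \<omega>))) \<le>
    (\<integral>\<^sup>+s. ennreal (indicator {-1/2..1/2} s * (C / (1 + norm (w - \<omega>)) ^ N / (1 + norm (z - x + s *\<^sub>R prod.swap w)) ^ N)) \<partial>lborel)"
proof -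
  define \<beta> where "\<beta> = fourier \<gamma>"
  have \<beta>: "\<beta> \<in> schwartz" unfolding \<beta>_def by (rule fourier_schwartz[OF \<gamma>])
  have c\<beta>: "(\<lambda>\<eta>. cnj (\<beta> \<eta>)) \<in> schwartz" by (rule schwartz_cnj[OF \<beta>])
  let ?D = "DIM('a \<times> 'a) + 2"
  obtain A where A: "A \<ge> 0" "\<And>\<phi> \<xi>::'a \<times> 'a. \<phi> \<in> schwartz \<Longrightarrow> (1 + norm \<xi>) ^ N * norm (fourier \<phi> \<xi>) \<le> A * jet_seminorm ?D N \<phi>"
    using fourier_decay[of N, where 'a="'a \<times> 'a"] by blast
  obtain B where B: "B \<ge> 0" "\<And>s \<phi> (z::'a \<times> 'a). \<bar>s\<bar> \<le> 1/2 \<Longrightarrow> \<phi> \<in> schwartz \<Longrightarrow>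
     (1 + norm z) ^ ?D * jet N (\<lambda>z. chirp s z * \<phi> z) z \<le> B * jet_seminorm (?D + N) N \<phi>"
    using jet_chirp_mult[of ?D N, where 'a='a] by blast
  obtain E where E: "E \<ge> 0" "\<And>h \<eta> (x::'a \<times> 'a). h \<in> schwartz \<Longrightarrow> \<eta> \<in> schwartz \<Longrightarrow>
     jet_seminorm (?D + N) N (\<lambda>y. h y * \<eta> (y - x)) \<le> E * jet_seminorm (?D + N + N) N h * jet_seminorm N N \<eta> / (1 + norm x) ^ N"
    using jet_seminorm_mult_translate[of "?D + N" N N, where 'a="'a \<times> 'a"] by blast
  \<comment> \<open>The constants of Fourier decay, of multiplication by a chirp and of the
    overlap.\<close>
  define C where "C = A * (B * (E * jet_seminorm (?D + N + N) N \<beta> * jet_seminorm N N (\<lambda>\<eta>. cnj (\<beta> \<eta>))))"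
  have "ennreal (norm (stft_coeff \<gamma> (bj_op (atom \<gamma> (z, w))) (x, \<omega>))) \<le>
    (\<integral>\<^sup>+s. ennreal (indicator {-1/2..1/2} s * (C / (1 + norm (w - \<omega>)) ^ N / (1 + norm (z - x + s *\<^sub>R prod.swap w)) ^ N)) \<partial>lborel)"
    for z w x \<omega>
  proof -
    define \<rho> where "\<rho> \<eta> = \<beta> \<eta> * cnj (\<beta> (\<eta> - (w - \<omega>)))" for \<eta>
    have \<rho>: "\<rho> \<in> schwartz" unfolding \<rho>_def[abs_def] by (intro schwartz_mult \<beta> schwartz_translate(1)[OF c\<beta>])
    note [measurable] = schwartz_measurable[OF \<beta>] schwartz_measurable[OF \<rho>]
    let ?g = "\<lambda>\<xi>. Theta \<xi> * (plane_wave (w + \<xi>) z * \<beta> (w + \<xi>)) * cnj (plane_wave (\<omega> + \<xi>) x * \<beta> (\<omega> + \<xi>))"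
    let ?c = "cnj (plane_wave (\<omega> - w) x)"
    have "stft_coeff \<gamma> (bj_op (atom \<gamma> (z, w))) (x, \<omega>) = (\<integral>\<xi>. ?g \<xi> \<partial>lborel)"
      unfolding stft_coeff_def bj_op_inner[OF atom_schwartz[OF \<gamma>] atom_schwartz[OF \<gamma>]] fourier_atom[OF \<gamma>]
      by (simp add: \<beta>_def)
    \<comment> \<open>The substitution centres one of the two translates at the origin and moves the
      shift by \<open>w\<close> into \<open>Theta\<close>, where the chirps turn it into a
      wave.\<close>
    also have "\<dots> = (\<integral>\<eta>. ?g (\<eta> + - w) \<partial>lborel)"
      by (rule integral_translate[symmetric]) measurable
    also have "\<dots> = (\<integral>\<eta>. ?c * (Theta (\<eta> - w) * (\<rho> \<eta> * plane_wave (z - x) \<eta>)) \<partial>lborel)"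
    proof (rule Bochner_Integration.integral_cong[OF refl])
      fix \<eta>
      have 1: "\<omega> + (\<eta> + - w) = (\<omega> - w) + \<eta>" "w + (\<eta> + - w) = \<eta>" "(\<omega> - w) + \<eta> = \<eta> - (w - \<omega>)" by simp_all
      have 2: "plane_wave \<eta> z * cnj (plane_wave \<eta> x) = plane_wave (z - x) \<eta>"
        using plane_wave_add[of z "- x" \<eta>] by (simp add: plane_wave_minus plane_wave_commute[of \<eta>])
      show "?g (\<eta> + - w) = ?c * (Theta (\<eta> - w) * (\<rho> \<eta> * plane_wave (z - x) \<eta>))"
        unfolding 1 \<rho>_def 2[symmetric] plane_wave_add[of "\<omega> - w" \<eta>, unfolded 1]
        by (simp add: mult_ac)
    qed
    also have "\<dots> = ?c * (\<integral>\<eta>. Theta (\<eta> - w) * (\<rho> \<eta> * plane_wave (z - x) \<eta>) \<partial>lborel)" by simp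
    finally have eq: "norm (stft_coeff \<gamma> (bj_op (atom \<gamma> (z, w))) (x, \<omega>)) =
        norm (\<integral>\<eta>. Theta (\<eta> - w) * (\<rho> \<eta> * plane_wave (z - x) \<eta>) \<partial>lborel)"
      by (simp add: norm_mult)
    have "ennreal (norm (stft_coeff \<gamma> (bj_op (atom \<gamma> (z, w))) (x, \<omega>))) \<le>
        (\<integral>\<^sup>+s. ennreal (norm (indicator {-1/2..1/2::real} s * (chirp s w *
          fourier (\<lambda>\<eta>. chirp s \<eta> * \<rho> \<eta>) (z - x + s *\<^sub>R prod.swap w)))) \<partial>lborel)"
      unfolding eq Theta_translate_fourier[OF \<rho>] by (rule norm_integral_le_nn_integral)
    also have "\<dots> \<le> (\<integral>\<^sup>+s. ennreal (indicator {-1/2..1/2} s * (C / (1 + norm (w - \<omega>)) ^ N / (1 + norm (z - x + s *\<^sub>R prod.swap w)) ^ N)) \<partial>lborel)"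
    proof (intro nn_integral_mono ennreal_leI)
      fix s :: real
      let ?\<xi> = "z - x + s *\<^sub>R prod.swap w"
      show "norm (indicator {-1/2..1/2::real} s * (chirp s w * fourier (\<lambda>\<eta>. chirp s \<eta> * \<rho> \<eta>) ?\<xi>)) \<le>
        indicator {-1/2..1/2} s * (C / (1 + norm (w - \<omega>)) ^ N / (1 + norm ?\<xi>) ^ N)"
      proof (cases "s \<in> {-1/2..1/2}")
        case True
        then have s: "\<bar>s\<bar> \<le> 1/2" by auto
        have "(1 + norm ?\<xi>) ^ N * norm (fourier (\<lambda>\<eta>. chirp s \<eta> * \<rho> \<eta>) ?\<xi>) \<le> A * jet_seminorm ?D N (\<lambda>\<eta>. chirp s \<eta> * \<rho> \<eta>)"
          by (intro A(2) chirp_mult_schwartz \<rho> s)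
        also have "\<dots> \<le> A * (B * jet_seminorm (?D + N) N \<rho>)"
          by (intro mult_left_mono jet_seminorm_least B(2) s \<rho> A(1))
        also have "\<dots> \<le> A * (B * (E * jet_seminorm (?D + N + N) N \<beta> * jet_seminorm N N (\<lambda>\<eta>. cnj (\<beta> \<eta>)) / (1 + norm (w - \<omega>)) ^ N))"
          unfolding \<rho>_def[abs_def] by (intro mult_left_mono E(2)[OF \<beta> c\<beta>] A(1) B(1))
        also have "\<dots> = C / (1 + norm (w - \<omega>)) ^ N" by (simp add: C_def)
        finally have "norm (fourier (\<lambda>\<eta>. chirp s \<eta> * \<rho> \<eta>) ?\<xi>) \<le> C / (1 + norm (w - \<omega>)) ^ N / (1 + norm ?\<xi>) ^ N"
          by (simp only: pos_le_divide_eq weight_pos mult.commute)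
        then show ?thesis using True by (simp add: norm_mult)
      qed simp
    qed
    finally show ?thesis .
  qed
  moreover have "C \<ge> 0"
    unfolding C_def by (intro mult_nonneg_nonneg A(1) B(1) E(1) jet_seminorm_nonneg \<beta> c\<beta>)
  ultimately show ?thesis by blast
qed

section \<open>Minkowski's integral inequality\<close>

lemma ennreal_powr_ennreal [simp]: "0 \<le> r \<Longrightarrow> ennreal_powr (ennreal r) P = ennreal (r powr P)"
  by (simp add: ennreal_powr_def)

lemma ennreal_powr_top [simp]: "ennreal_powr \<infinity> P = \<infinity>"
  by (simp add: ennreal_powr_def)

lemma ennreal_powr_0 [simp]: "ennreal_powr 0 P = 0"
  by (simp add: ennreal_powr_def)

lemma ennreal_powr_mono:
  assumes "x \<le> y" "0 \<le> P" shows "ennreal_powr x P \<le> ennreal_powr y P"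
proof (cases y)
  case (real s)
  with assms obtain r where "x = ennreal r" "0 \<le> r" "r \<le> s" by (cases x) (auto simp: top_unique)
  with real assms show ?thesis by (auto intro!: ennreal_leI powr_mono2)
qed (use ennreal_powr_top in simp)

lemma ennreal_powr_mult: "0 < P \<Longrightarrow> ennreal_powr (x * y) P = ennreal_powr x P * ennreal_powr y P"
proof (cases x; cases y)
  fix r s assume "0 < P" "x = ennreal r" "0 \<le> r" "y = ennreal s" "0 \<le> s"
  then show ?thesis by (simp add: ennreal_mult[symmetric] powr_mult)
next
  fix r assume *: "0 < P" "x = ennreal r" "0 \<le> r" "y = top"
  then show ?thesis
    by (cases "r = 0") (auto simp: ennreal_powr_def ennreal_mult_top)
next
  fix s assume *: "0 < P" "x = top" "y = ennreal s" "0 \<le> s"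
  then show ?thesis
    by (cases "s = 0") (auto simp: ennreal_powr_def ennreal_top_mult)
qed (simp add: ennreal_powr_def)

lemma ennreal_powr_inverse: "0 < P \<Longrightarrow> ennreal_powr (ennreal_powr x P) (1 / P) = x"
  by (cases x) (auto simp: powr_powr ennreal_powr_def)

lemma ennreal_powr_inverse': "0 < P \<Longrightarrow> ennreal_powr (ennreal_powr x (1 / P)) P = x"
  using ennreal_powr_inverse[of "1 / P" x] by simp

lemma ennreal_powr_eq_0_iff: "ennreal_powr x P = 0 \<longleftrightarrow> x = 0"
  by (cases x) (auto simp: ennreal_powr_def)

lemma ennreal_powr_measurable [measurable]:
  assumes [measurable]: "f \<in> borel_measurable M"
  shows "(\<lambda>x. ennreal_powr (f x) P) \<in> borel_measurable M"
  unfolding ennreal_powr_def by measurable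

text \<open>Convexity: the power function lies above its tangent at \<open>c\<close>. For exponents
  above 1 this is Young's inequality for \<open>r\<close> and \<open>c powr (P - 1)\<close> with
  conjugate exponents.\<close>

lemma powr_tangent:
  fixes r c P :: real
  assumes "1 \<le> P" "0 \<le> r" "0 < c"
  shows "P * c powr (P - 1) * r \<le> r powr P + (P - 1) * c powr P"
proof (cases "P = 1")
  case True then show ?thesis using assms by simp
next
  case False
  then have P: "1 < P" using assms by simp
  define Q where "Q = P / (P - 1)"
  have Q: "1 < Q" "1 / P + 1 / Q = 1" using P by (auto simp: Q_def field_simps)
  have "r * c powr (P - 1) \<le> r powr P / P + (c powr (P - 1)) powr Q / Q"
    using Youngs_inequality[of P Q r "c powr (P - 1)"] P Q assms by simp
  also have "(c powr (P - 1)) powr Q = c powr P" using P by (simp add: powr_powr Q_def)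
  finally have "P * (r * c powr (P - 1)) \<le> P * (r powr P / P + c powr P / Q)"
    using P by (intro mult_left_mono) auto
  also have "\<dots> = r powr P + (P - 1) * c powr P" using P by (simp add: Q_def field_simps)
  finally show ?thesis by (simp add: mult_ac)
qed

lemma ennreal_powr_tangent:
  assumes "1 \<le> P" "0 < c"
  shows "ennreal (P * c powr (P - 1)) * x \<le> ennreal_powr x P + ennreal ((P - 1) * c powr P)"
proof (cases x)
  case (real r)
  have "ennreal (P * c powr (P - 1)) * x = ennreal (P * c powr (P - 1) * r)"
    using real assms by (simp add: ennreal_mult)
  also have "\<dots> \<le> ennreal (r powr P + (P - 1) * c powr P)"
    using powr_tangent[of P r c] real assms by (intro ennreal_leI) auto
  also have "\<dots> = ennreal_powr x P + ennreal ((P - 1) * c powr P)"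
    using real assms by (simp add: ennreal_plus)
  finally show ?thesis .
qed (simp add: ennreal_powr_def)

text \<open>Jensen's inequality for a weight of total mass \<open>A\<close>, written without
  division. It is the integrated tangent inequality, with the tangent taken at the weighted mean
  \<open>I / A\<close>.\<close>

lemma weighted_jensen:
  assumes P: "1 \<le> P" and [measurable]: "f \<in> borel_measurable M" "w \<in> borel_measurable M"
    and A: "(\<integral>\<^sup>+t. w t \<partial>M) = ennreal A" "0 < A"
  shows "ennreal A * ennreal_powr (\<integral>\<^sup>+t. f t * w t \<partial>M) P \<le> ennreal (A powr P) * (\<integral>\<^sup>+t. ennreal_powr (f t) P * w t \<partial>M)"
proof -
  let ?Y = "\<integral>\<^sup>+t. ennreal_powr (f t) P * w t \<partial>M"
  let ?I = "\<integral>\<^sup>+t. f t * w t \<partial>M"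
  have tangent: "ennreal (P * c powr (P - 1)) * ?I \<le> ?Y + ennreal ((P - 1) * c powr P * A)" if "0 < c" for c
  proof -
    have "ennreal (P * c powr (P - 1)) * ?I = (\<integral>\<^sup>+t. (ennreal (P * c powr (P - 1)) * f t) * w t \<partial>M)"
      by (subst nn_integral_cmult[symmetric]) (auto simp: mult_ac)
    also have "\<dots> \<le> (\<integral>\<^sup>+t. (ennreal_powr (f t) P + ennreal ((P - 1) * c powr P)) * w t \<partial>M)"
      by (intro nn_integral_mono mult_right_mono ennreal_powr_tangent P that) simp
    also have "\<dots> = ?Y + ennreal ((P - 1) * c powr P) * (\<integral>\<^sup>+t. w t \<partial>M)"
      by (simp add: distrib_right nn_integral_add nn_integral_cmult)
    finally show ?thesis using A P by (simp add: ennreal_mult)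
  qed
  show ?thesis
  proof (cases ?I)
    case top
    \<comment> \<open>A finite value would contradict the tangent inequality at the point 1.\<close>
    have "?Y = top"
    proof (rule ccontr)
      assume "?Y \<noteq> top"
      then have "?Y + ennreal ((P - 1) * 1 powr P * A) \<noteq> top" by simp
      moreover have "ennreal (P * 1 powr (P - 1)) * ?I = top" using top P by (simp add: ennreal_mult_top)
      ultimately show False using tangent[of 1] by (simp add: top_unique)
    qed
    then show ?thesis using A(2) by (simp add: ennreal_mult_top)
  next
    case (real I)
    show ?thesis
    proof (cases "I = 0")
      case True then show ?thesis using real by simp
    next
      case False
      then have I: "0 < I" using real by simp
      define c where "c = I / A"
      have c: "0 < c" "I = c * A" using I A(2) by (simp_all add: c_def)
      show ?thesis
      proof (cases ?Y)
        case top then show ?thesis using A(2) by (simp add: ennreal_mult_top)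
      next
        case (real Y)
        have "ennreal (P * c powr (P - 1) * I) \<le> ennreal (Y + (P - 1) * c powr P * A)"
          using tangent[OF c(1)] real \<open>?I = ennreal I\<close> I P A(2) by (simp add: ennreal_mult ennreal_plus)
        then have "P * c powr (P - 1) * I \<le> Y + (P - 1) * c powr P * A"
          using real P A(2) by (subst (asm) ennreal_le_iff) auto
        moreover have "c powr (P - 1) * I = c powr P * A"
          using c powr_add[of c "P - 1" 1] by simp
        then have "P * c powr (P - 1) * I = P * (c powr P * A)" by (simp only: mult.assoc)
        moreover have "(P - 1) * c powr P * A = P * (c powr P * A) - c powr P * A" by (simp add: algebra_simps)
        ultimately have "c powr P * A \<le> Y" by linarith
        then have "A powr P * (c powr P * A) \<le> A powr P * Y" by (intro mult_left_mono) auto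
        moreover have "A * I powr P = A powr P * (c powr P * A)"
          using c A(2) by (simp add: powr_mult mult_ac)
        ultimately have "A * I powr P \<le> A powr P * Y" by linarith
        then show ?thesis using real \<open>?I = ennreal I\<close> I A(2) by (simp add: ennreal_mult[symmetric] ennreal_leI)
      qed
    qed
  qed
qed

text \<open>Normalising \<open>F t\<close> by its norm \<open>N t\<close> and integrating against the weight \<open>N\<close> reduces the
  inequality to Jensen's.\<close>

lemma minkowski_integral:
  fixes F :: "'t::euclidean_space \<Rightarrow> 'a::euclidean_space \<Rightarrow> ennreal"
  assumes P: "1 \<le> P" and F [measurable]: "case_prod F \<in> borel_measurable (borel \<Otimes>\<^sub>M borel)"
  shows "ennreal_powr (\<integral>\<^sup>+x. ennreal_powr (\<integral>\<^sup>+t. F t x \<partial>lborel) P \<partial>lborel) (1 / P) \<le>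
    (\<integral>\<^sup>+t. ennreal_powr (\<integral>\<^sup>+x. ennreal_powr (F t x) P \<partial>lborel) (1 / P) \<partial>lborel)"
proof -
  define N where "N t = ennreal_powr (\<integral>\<^sup>+x. ennreal_powr (F t x) P \<partial>lborel) (1 / P)" for t
  have [measurable]: "N \<in> borel_measurable borel"
    unfolding N_def[abs_def] by measurable
  have NP: "ennreal_powr (N t) P = (\<integral>\<^sup>+x. ennreal_powr (F t x) P \<partial>lborel)" for t
    unfolding N_def using P by (intro ennreal_powr_inverse') simp
  have F_t [measurable]: "F t \<in> borel_measurable borel" for t
    using measurable_compose[OF measurable_Pair1'[of t borel borel] F] by simp
  have F_x [measurable]: "(\<lambda>t. F t x) \<in> borel_measurable borel" for x
    using measurable_compose[OF measurable_Pair2'[of x borel borel] F] by simp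
  show ?thesis
  proof (cases "\<integral>\<^sup>+t. N t \<partial>lborel")
    case top then show ?thesis by (simp add: N_def)
  next
    case (real A)
    have fin: "AE t in lborel. N t \<noteq> \<infinity>"
      using real by (intro nn_integral_PInf_AE) auto
    \<comment> \<open>By the conventions for \<open>inverse\<close>, \<open>g t * N t\<close> is 1
      where \<open>N t\<close> is positive and finite and 0 elsewhere, so it never exceeds
      1.\<close>
    define g where "g t = inverse (N t)" for t
    have [measurable]: "g \<in> borel_measurable borel" unfolding g_def[abs_def] by measurable
    have gN: "g t * N t = 1" if "N t \<noteq> 0" "N t \<noteq> \<infinity>" for t
      using that unfolding g_def by (cases "N t") (auto simp: inverse_ennreal ennreal_mult[symmetric])
    have gN_le: "g t * N t \<le> 1" for t
      using gN[of t] by (cases "N t = 0 \<or> N t = \<infinity>") (auto simp: g_def)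
    \<comment> \<open>Where \<open>N t = 0\<close> the function \<open>F t\<close> vanishes almost
      everywhere, so dividing by the norm and multiplying again loses nothing.\<close>
    have ae1: "AE t in lborel. AE x in lborel. F t x = F t x * g t * N t"
      using fin
    proof eventually_elim
      fix t assume "N t \<noteq> \<infinity>"
      show "AE x in lborel. F t x = F t x * g t * N t"
      proof (cases "N t = 0")
        case True
        then have "(\<integral>\<^sup>+x. ennreal_powr (F t x) P \<partial>lborel) = 0" using NP[of t] by simp
        then have "AE x in lborel. ennreal_powr (F t x) P = 0"
          by (subst (asm) nn_integral_0_iff_AE) auto
        then show ?thesis by eventually_elim (simp add: ennreal_powr_eq_0_iff)
      next
        case False
        then show ?thesis using gN[OF _ \<open>N t \<noteq> \<infinity>\<close>] by (simp add: mult.assoc)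
      qed
    qed
    \<comment> \<open>Jensen's inequality is applied in \<open>t\<close> for fixed \<open>x\<close>,
      so the order of the two null sets has to be exchanged.\<close>
    have ae2: "AE x in lborel. AE t in lborel. F t x = F t x * g t * N t"
      using ae1 by (subst lborel_pair.AE_commute[symmetric]) measurable
    define I where "I x = (\<integral>\<^sup>+t. F t x \<partial>lborel)" for x
    define X where "X = (\<integral>\<^sup>+x. ennreal_powr (I x) P \<partial>lborel)"
    have [measurable]: "I \<in> borel_measurable borel" unfolding I_def[abs_def] by measurable
    have "ennreal_powr X (1 / P) \<le> ennreal A"
    proof (cases "A = 0")
      case True
      then have "(\<integral>\<^sup>+t. N t \<partial>lborel) = 0" using real by simp
      then have N0: "AE t in lborel. N t = 0" by (subst (asm) nn_integral_0_iff_AE) auto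
      have "AE x in lborel. I x = 0"
        using ae2
      proof eventually_elim
        fix x assume "AE t in lborel. F t x = F t x * g t * N t"
        with N0 have "AE t in lborel. F t x = 0" by eventually_elim simp
        then show "I x = 0" unfolding I_def by (subst nn_integral_0_iff_AE) auto
      qed
      then have "AE x in lborel. ennreal_powr (I x) P = 0" by eventually_elim simp
      then have "X = 0" unfolding X_def by (subst nn_integral_0_iff_AE) auto
      then show ?thesis by simp
    next
      case False
      then have A: "0 < A" using real by simp
      have "ennreal A * X = (\<integral>\<^sup>+x. ennreal A * ennreal_powr (I x) P \<partial>lborel)"
        unfolding X_def by (rule nn_integral_cmult[symmetric]) measurable
      also have "\<dots> \<le> (\<integral>\<^sup>+x. ennreal (A powr P) * (\<integral>\<^sup>+t. ennreal_powr (F t x * g t) P * N t \<partial>lborel) \<partial>lborel)"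
      proof (rule nn_integral_mono_AE)
        show "AE x in lborel. ennreal A * ennreal_powr (I x) P \<le>
            ennreal (A powr P) * (\<integral>\<^sup>+t. ennreal_powr (F t x * g t) P * N t \<partial>lborel)"
          using ae2
        proof eventually_elim
          fix x assume "AE t in lborel. F t x = F t x * g t * N t"
          then have "I x = (\<integral>\<^sup>+t. F t x * g t * N t \<partial>lborel)" unfolding I_def by (rule nn_integral_cong_AE)
          then show "ennreal A * ennreal_powr (I x) P \<le>
              ennreal (A powr P) * (\<integral>\<^sup>+t. ennreal_powr (F t x * g t) P * N t \<partial>lborel)"
            using weighted_jensen[OF P _ _ real(2) A, of "\<lambda>t. F t x * g t"] by simp
        qed
      qed
      also have "\<dots> = ennreal (A powr P) * (\<integral>\<^sup>+x. (\<integral>\<^sup>+t. ennreal_powr (F t x * g t) P * N t \<partial>lborel) \<partial>lborel)"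
        by (rule nn_integral_cmult) measurable
      also have "(\<integral>\<^sup>+x. (\<integral>\<^sup>+t. ennreal_powr (F t x * g t) P * N t \<partial>lborel) \<partial>lborel) =
          (\<integral>\<^sup>+t. (\<integral>\<^sup>+x. ennreal_powr (F t x * g t) P * N t \<partial>lborel) \<partial>lborel)"
        by (rule lborel_pair.Fubini') measurable
      \<comment> \<open>Each normalised function has norm at most 1, so only the weight is
        left.\<close>
      also have "\<dots> \<le> (\<integral>\<^sup>+t. N t \<partial>lborel)"
      proof (rule nn_integral_mono)
        fix t
        have "(\<integral>\<^sup>+x. ennreal_powr (F t x * g t) P * N t \<partial>lborel) =
            (\<integral>\<^sup>+x. (ennreal_powr (g t) P * N t) * ennreal_powr (F t x) P \<partial>lborel)"
          using P by (simp add: ennreal_powr_mult mult_ac)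
        also have "\<dots> = (ennreal_powr (g t) P * N t) * ennreal_powr (N t) P"
          unfolding NP by (rule nn_integral_cmult) measurable
        also have "\<dots> = ennreal_powr (g t * N t) P * N t" using P by (simp add: ennreal_powr_mult mult_ac)
        also have "\<dots> \<le> ennreal_powr 1 P * N t"
          using P by (intro mult_right_mono ennreal_powr_mono gN_le) auto
        also have "ennreal_powr 1 P = 1" using ennreal_powr_ennreal[of 1 P] by simp
        finally show "(\<integral>\<^sup>+x. ennreal_powr (F t x * g t) P * N t \<partial>lborel) \<le> N t" by simp
      qed
      finally have le: "ennreal A * X \<le> ennreal (A powr P) * ennreal A"
        using real by (simp add: mult_left_mono)
      have "X \<le> ennreal (A powr P)"
      proof (cases X)
        case top
        then show ?thesis using le A by (simp add: ennreal_mult_top ennreal_mult[symmetric] top_unique)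
      next
        case (real r)
        then have "A * r \<le> A powr P * A" using le A by (simp add: ennreal_mult[symmetric])
        then show ?thesis using real A by (simp add: ennreal_leI mult.commute)
      qed
      then have "ennreal_powr X (1 / P) \<le> ennreal_powr (ennreal (A powr P)) (1 / P)"
        using P by (intro ennreal_powr_mono) auto
      also have "\<dots> = ennreal A" using A P by (simp add: powr_powr)
      finally show ?thesis .
    qed
    then show ?thesis using real by (simp add: X_def I_def N_def)
  qed
qed

section \<open>Mixed norms\<close>

lemma nn_integral_translate:
  fixes f :: "'a::euclidean_space \<Rightarrow> ennreal"
  assumes "f \<in> borel_measurable borel"
  shows "(\<integral>\<^sup>+x. f (x + a) \<partial>lborel) = (\<integral>\<^sup>+x. f x \<partial>lborel)"
  using nn_integral_distr[of "(+) a" lborel borel f] assms by (simp add: lborel_distr_plus add.commute)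

lemma nn_integral_reflect:
  fixes f :: "'a::euclidean_space \<Rightarrow> ennreal"
  assumes "f \<in> borel_measurable borel"
  shows "(\<integral>\<^sup>+x. f (a - x) \<partial>lborel) = (\<integral>\<^sup>+x. f x \<partial>lborel)"
proof -
  have "distr lborel borel (\<lambda>x. a - x) = lborel"
    using lborel_affine[of "- 1" a] by (simp add: density_1)
  then show ?thesis using nn_integral_distr[of "\<lambda>x. a - x" lborel borel f] assms by simp
qed

section \<open>Translations, superpositions and convolutions in \<open>Lp_norm\<close>\<close>

lemma Lp_norm_finite:
  assumes "1 \<le> p" "p \<noteq> \<infinity>"
  shows "1 \<le> enn2real p"
    and "Lp_norm p h = ennreal_powr (\<integral>\<^sup>+x. ennreal_powr (h x) (enn2real p) \<partial>lborel) (1 / enn2real p)"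
proof -
  show "1 \<le> enn2real p" using assms by (cases p) auto
  show "Lp_norm p h = ennreal_powr (\<integral>\<^sup>+x. ennreal_powr (h x) (enn2real p) \<partial>lborel) (1 / enn2real p)"
    using assms by (simp add: Lp_norm_def)
qed

lemma Lp_norm_mono:
  fixes u v :: "'a::euclidean_space \<Rightarrow> ennreal"
  assumes p: "1 \<le> p" and [measurable]: "u \<in> borel_measurable borel" and le: "\<And>x. u x \<le> v x"
  shows "Lp_norm p u \<le> Lp_norm p v"
proof (cases "p = \<infinity>")
  case True
  then show ?thesis using le by (simp add: Lp_norm_def esssup_mono)
next
  case False
  show ?thesis unfolding Lp_norm_finite(2)[OF p False] using Lp_norm_finite(1)[OF p False] le
    by (intro ennreal_powr_mono nn_integral_mono) auto
qed

lemma Lp_norm_cmult_translate: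
  fixes u :: "'a::euclidean_space \<Rightarrow> ennreal"
  assumes p: "1 \<le> p" "p \<noteq> \<infinity>" and [measurable]: "u \<in> borel_measurable borel"
  shows "Lp_norm p (\<lambda>x. c * u (x + a)) = c * Lp_norm p u"
proof -
  let ?P = "enn2real p"
  have P: "1 \<le> ?P" by (rule Lp_norm_finite(1)[OF p])
  have "(\<integral>\<^sup>+x. ennreal_powr (c * u (x + a)) ?P \<partial>lborel) = ennreal_powr c ?P * (\<integral>\<^sup>+x. ennreal_powr (u (x + a)) ?P \<partial>lborel)"
    using P by (simp add: ennreal_powr_mult nn_integral_cmult)
  also have "(\<integral>\<^sup>+x. ennreal_powr (u (x + a)) ?P \<partial>lborel) = (\<integral>\<^sup>+x. ennreal_powr (u x) ?P \<partial>lborel)"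
    by (rule nn_integral_translate[of "\<lambda>x. ennreal_powr (u x) ?P"]) measurable
  finally show ?thesis unfolding Lp_norm_finite(2)[OF p] using P
    by (simp add: ennreal_powr_mult ennreal_powr_inverse)
qed

lemma Lp_norm_integral:
  fixes F :: "'t::euclidean_space \<Rightarrow> 'a::euclidean_space \<Rightarrow> ennreal"
  assumes p: "1 \<le> p" "p \<noteq> \<infinity>" and F: "case_prod F \<in> borel_measurable (borel \<Otimes>\<^sub>M borel)"
  shows "Lp_norm p (\<lambda>x. \<integral>\<^sup>+t. F t x \<partial>lborel) \<le> (\<integral>\<^sup>+t. Lp_norm p (F t) \<partial>lborel)"
  unfolding Lp_norm_finite(2)[OF p] by (rule minkowski_integral[OF Lp_norm_finite(1)[OF p] F])

text \<open>Young's inequality with an integrable kernel: the convolution is a superposition of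
  translates of \<open>u\<close>, each with the norm of \<open>u\<close>. For
  \<open>p = \<infinity>\<close> the essential supremum is taken out of the integral
  directly.\<close>

lemma Lp_norm_convolution:
  fixes k u :: "'a::euclidean_space \<Rightarrow> ennreal"
  assumes p: "1 \<le> p" and [measurable]: "k \<in> borel_measurable borel" "u \<in> borel_measurable borel"
  shows "Lp_norm p (\<lambda>x. \<integral>\<^sup>+y. k (x - y) * u y \<partial>lborel) \<le> (\<integral>\<^sup>+y. k y \<partial>lborel) * Lp_norm p u"
proof (cases "p = \<infinity>")
  case True
  have "esssup lborel (\<lambda>x. \<integral>\<^sup>+y. k (x - y) * u y \<partial>lborel) \<le> (\<integral>\<^sup>+y. k y \<partial>lborel) * esssup lborel u"
  proof (intro esssup_I AE_I2)
    fix x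
    have "(\<integral>\<^sup>+y. k (x - y) * u y \<partial>lborel) \<le> (\<integral>\<^sup>+y. k (x - y) * esssup lborel u \<partial>lborel)"
      using esssup_AE[of u lborel] by (intro nn_integral_mono_AE) (auto elim!: eventually_mono intro!: mult_left_mono)
    also have "\<dots> = (\<integral>\<^sup>+y. k y \<partial>lborel) * esssup lborel u"
      using nn_integral_reflect[of k x] by (simp add: nn_integral_multc)
    finally show "(\<integral>\<^sup>+y. k (x - y) * u y \<partial>lborel) \<le> (\<integral>\<^sup>+y. k y \<partial>lborel) * esssup lborel u" .
  qed measurable
  then show ?thesis using True by (simp add: Lp_norm_def)
next
  case False
  have eq: "(\<lambda>x. \<integral>\<^sup>+y. k (x - y) * u y \<partial>lborel) = (\<lambda>x. \<integral>\<^sup>+y. k y * u (x + - y) \<partial>lborel)"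
    using nn_integral_reflect[of "\<lambda>y. k (x - y) * u y" x for x] by (intro ext) simp
  have "Lp_norm p (\<lambda>x. \<integral>\<^sup>+y. k (x - y) * u y \<partial>lborel) \<le> (\<integral>\<^sup>+y. Lp_norm p (\<lambda>x. k y * u (x + - y)) \<partial>lborel)"
    unfolding eq by (rule Lp_norm_integral[OF p False]) measurable
  also have "\<dots> = (\<integral>\<^sup>+y. k y * Lp_norm p u \<partial>lborel)"
    by (simp only: Lp_norm_cmult_translate[OF p False \<open>u \<in> borel_measurable borel\<close>])
  also have "\<dots> = (\<integral>\<^sup>+y. k y \<partial>lborel) * Lp_norm p u" by (simp add: nn_integral_multc)
  finally show ?thesis .
qed

text \<open>Superlevel sets of a continuous function are open, and a nonempty open set both meets a
  dense set and has positive measure. With a countable dense set this makes the essential supremum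
  measurable in a parameter.\<close>

lemma esssup_continuous:
  fixes u :: "'a::euclidean_space \<Rightarrow> ennreal"
  assumes cont: "continuous_on UNIV u" and D: "\<And>X. open X \<Longrightarrow> X \<noteq> {} \<Longrightarrow> \<exists>d\<in>D. d \<in> X"
  shows "esssup lborel u = (SUP x\<in>D. u x)"
proof (rule antisym)
  have [measurable]: "u \<in> borel_measurable borel" by (rule borel_measurable_continuous_onI[OF cont])
  have op: "open {x. a < u x}" for a
    using open_Collect_less[OF continuous_on_const[of UNIV a] cont] by simp
  have "u x \<le> (SUP x\<in>D. u x)" for x
  proof (rule ccontr)
    assume "\<not> ?thesis"
    then have "{y. (SUP x\<in>D. u x) < u y} \<noteq> {}" by (auto simp: not_le)
    then obtain d where "d \<in> D" "(SUP x\<in>D. u x) < u d" using D[OF op] by auto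
    then show False by (meson SUP_upper not_less)
  qed
  then show "esssup lborel u \<le> (SUP x\<in>D. u x)" by (intro esssup_I AE_I2) auto
  show "(SUP x\<in>D. u x) \<le> esssup lborel u"
  proof (rule SUP_least)
    fix d
    show "u d \<le> esssup lborel u"
    proof (rule ccontr)
      assume "\<not> ?thesis"
      then obtain r where r: "r > 0" "ball d r \<subseteq> {y. esssup lborel u < u y}"
        using op[of "esssup lborel u"] by (auto elim!: openE simp: not_le)
      have "AE x in lborel. \<not> (esssup lborel u < u x)"
        using esssup_AE[of u lborel] by eventually_elim (simp add: not_less)
      then have "emeasure lborel {y. esssup lborel u < u y} = 0"
        using op by (subst (asm) AE_iff_measurable[of "{y. esssup lborel u < u y}"]) auto
      then have "emeasure lborel (ball d r) = 0"
        using emeasure_mono[OF r(2), of lborel] op by auto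
      then show False using r(1) unit_ball_vol_pos[of "real DIM('a)"] by (simp add: emeasure_ball)
    qed
  qed
qed

lemma Lp_norm_measurable:
  fixes H :: "'a::euclidean_space \<times> 'b::euclidean_space \<Rightarrow> ennreal"
  assumes cont: "continuous_on UNIV H"
  shows "(\<lambda>\<omega>. Lp_norm p (\<lambda>x. H (x, \<omega>))) \<in> borel_measurable borel"
proof (cases "p = \<infinity>")
  case True
  obtain D :: "'a set" where D: "countable D" "\<And>X. open X \<Longrightarrow> X \<noteq> {} \<Longrightarrow> \<exists>d\<in>D. d \<in> X"
    using countable_dense_setE by blast
  have c: "continuous_on UNIV (\<lambda>x. H (x, \<omega>))" "continuous_on UNIV (\<lambda>\<omega>. H (x, \<omega>))" for x \<omega>
    by (intro continuous_on_compose2[OF cont] continuous_intros; simp)+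
  have [measurable]: "(\<lambda>\<omega>. H (x, \<omega>)) \<in> borel_measurable borel" for x
    by (rule borel_measurable_continuous_onI[OF c(2)])
  have "(\<lambda>\<omega>. SUP x\<in>D. H (x, \<omega>)) \<in> borel_measurable borel"
    by (rule borel_measurable_SUP[OF D(1)]) measurable
  then show ?thesis using True by (simp add: Lp_norm_def esssup_continuous[OF c(1) D(2)])
next
  case False
  have [measurable]: "H \<in> borel_measurable (borel \<Otimes>\<^sub>M borel)"
    unfolding borel_prod by (rule borel_measurable_continuous_onI[OF cont])
  show ?thesis using False unfolding Lp_norm_def by simp
qed

lemma nn_integral_unit_interval:
  "(\<integral>\<^sup>+s. indicator {-1/2..1/2::real} s * c \<partial>lborel) = (c :: ennreal)"
  by (simp add: nn_integral_multc)

text \<open>The vector \<open>a\<close> stands for \<open>prod.swap w\<close> and is fixed, so for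
  each \<open>s\<close> the integrand is a translate of \<open>H\<close> in the position. For finite
  \<open>p\<close>, Minkowski's inequality in all three variables and translation invariance remove
  the shift, and the average over an interval of length 1 costs nothing.\<close>

lemma Lp_norm_shear_bound:
  fixes H :: "'a::euclidean_space \<times> 'a \<Rightarrow> ennreal" and u k1 k2 :: "'a \<Rightarrow> ennreal"
  assumes p: "1 \<le> p" and [measurable]: "H \<in> borel_measurable (borel \<Otimes>\<^sub>M borel)" "u \<in> borel_measurable borel"
      "k1 \<in> borel_measurable borel" "k2 \<in> borel_measurable borel"
    and le: "\<And>z. u z \<le> (\<integral>\<^sup>+\<omega>. \<integral>\<^sup>+s. \<integral>\<^sup>+x. k1 (w - \<omega>) *
      (indicator {-1/2..1/2::real} s * (k2 (z - x + s *\<^sub>R a) * H (x, \<omega>))) \<partial>lborel \<partial>lborel \<partial>lborel)"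
  shows "Lp_norm p u \<le> (\<integral>\<^sup>+\<omega>. k1 (w - \<omega>) * (\<integral>\<^sup>+y. k2 y \<partial>lborel) * Lp_norm p (\<lambda>x. H (x, \<omega>)) \<partial>lborel)"
proof (cases "p = \<infinity>")
  case True
  have "esssup lborel u \<le> (\<integral>\<^sup>+\<omega>. k1 (w - \<omega>) * (\<integral>\<^sup>+y. k2 y \<partial>lborel) * esssup lborel (\<lambda>x. H (x, \<omega>)) \<partial>lborel)"
  proof (intro esssup_I AE_I2)
    fix z
    note le[of z]
    also have "(\<integral>\<^sup>+\<omega>. \<integral>\<^sup>+s. \<integral>\<^sup>+x. k1 (w - \<omega>) *
        (indicator {-1/2..1/2::real} s * (k2 (z - x + s *\<^sub>R a) * H (x, \<omega>))) \<partial>lborel \<partial>lborel \<partial>lborel) \<le>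
      (\<integral>\<^sup>+\<omega>. \<integral>\<^sup>+s. indicator {-1/2..1/2::real} s *
        (k1 (w - \<omega>) * (\<integral>\<^sup>+y. k2 y \<partial>lborel) * esssup lborel (\<lambda>x. H (x, \<omega>))) \<partial>lborel \<partial>lborel)"
    \<comment> \<open>\<open>H\<close> is replaced by its essential supremum in the position, after
      which the shift acts on \<open>k2\<close> only and does not change its integral.\<close>
    proof (intro nn_integral_mono)
      fix \<omega> and s :: real
      let ?E = "esssup lborel (\<lambda>x. H (x, \<omega>))"
      have "(\<integral>\<^sup>+x. k1 (w - \<omega>) * (indicator {-1/2..1/2::real} s * (k2 (z - x + s *\<^sub>R a) * H (x, \<omega>))) \<partial>lborel) \<le>
          (\<integral>\<^sup>+x. (k1 (w - \<omega>) * indicator {-1/2..1/2::real} s * ?E) * k2 (z + s *\<^sub>R a - x) \<partial>lborel)"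
      proof (rule nn_integral_mono_AE)
        have "AE x in lborel. H (x, \<omega>) \<le> ?E" by (rule esssup_AE)
        then show "AE x in lborel. k1 (w - \<omega>) * (indicator {-1/2..1/2::real} s * (k2 (z - x + s *\<^sub>R a) * H (x, \<omega>))) \<le>
            (k1 (w - \<omega>) * indicator {-1/2..1/2::real} s * ?E) * k2 (z + s *\<^sub>R a - x)"
        proof eventually_elim
          fix x assume "H (x, \<omega>) \<le> ?E"
          then have "k1 (w - \<omega>) * (indicator {-1/2..1/2::real} s * (k2 (z - x + s *\<^sub>R a) * H (x, \<omega>))) \<le>
              k1 (w - \<omega>) * (indicator {-1/2..1/2::real} s * (k2 (z - x + s *\<^sub>R a) * ?E))"
            by (intro mult_left_mono) auto
          then show "k1 (w - \<omega>) * (indicator {-1/2..1/2::real} s * (k2 (z - x + s *\<^sub>R a) * H (x, \<omega>))) \<le>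
              (k1 (w - \<omega>) * indicator {-1/2..1/2::real} s * ?E) * k2 (z + s *\<^sub>R a - x)"
            by (simp add: mult_ac algebra_simps)
        qed
      qed
      also have "\<dots> = (k1 (w - \<omega>) * indicator {-1/2..1/2::real} s * ?E) * (\<integral>\<^sup>+y. k2 y \<partial>lborel)"
        by (subst nn_integral_cmult) (simp_all add: nn_integral_reflect[of k2])
      finally show "(\<integral>\<^sup>+x. k1 (w - \<omega>) * (indicator {-1/2..1/2::real} s * (k2 (z - x + s *\<^sub>R a) * H (x, \<omega>))) \<partial>lborel) \<le>
          indicator {-1/2..1/2::real} s * (k1 (w - \<omega>) * (\<integral>\<^sup>+y. k2 y \<partial>lborel) * ?E)"
        by (simp only: mult_ac)
    qed
    also have "\<dots> = (\<integral>\<^sup>+\<omega>. k1 (w - \<omega>) * (\<integral>\<^sup>+y. k2 y \<partial>lborel) * esssup lborel (\<lambda>x. H (x, \<omega>)) \<partial>lborel)"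
      by (simp only: nn_integral_unit_interval)
    finally show "u z \<le> (\<integral>\<^sup>+\<omega>. k1 (w - \<omega>) * (\<integral>\<^sup>+y. k2 y \<partial>lborel) * esssup lborel (\<lambda>x. H (x, \<omega>)) \<partial>lborel)" .
  qed simp
  then show ?thesis using True by (simp add: Lp_norm_def)
next
  case False
  note Lp = Lp_norm_integral[OF p False]
  let ?c = "\<lambda>\<omega> s y. k1 (w - \<omega>) * (indicator {-1/2..1/2::real} s * k2 y)"
  have "u z \<le> (\<integral>\<^sup>+\<omega>. \<integral>\<^sup>+s. \<integral>\<^sup>+y. ?c \<omega> s y * H (z + (s *\<^sub>R a - y), \<omega>) \<partial>lborel \<partial>lborel \<partial>lborel)" for z
  proof -
    \<comment> \<open>Substituting \<open>z + s *\<^sub>R a - y\<close> for \<open>x\<close> moves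
      the shift from the kernel to \<open>H\<close>.\<close>
    have "(\<integral>\<^sup>+x. k1 (w - \<omega>) * (indicator {-1/2..1/2::real} s * (k2 (z - x + s *\<^sub>R a) * H (x, \<omega>))) \<partial>lborel) =
        (\<integral>\<^sup>+y. ?c \<omega> s y * H (z + (s *\<^sub>R a - y), \<omega>) \<partial>lborel)" for \<omega> s
      using nn_integral_reflect[of "\<lambda>x. k1 (w - \<omega>) * (indicator {-1/2..1/2::real} s * (k2 (z - x + s *\<^sub>R a) * H (x, \<omega>)))" "z + s *\<^sub>R a"]
      by (simp add: mult.assoc algebra_simps)
    with le[of z] show ?thesis by simp
  qed
  then have "Lp_norm p u \<le> Lp_norm p (\<lambda>z. \<integral>\<^sup>+\<omega>. \<integral>\<^sup>+s. \<integral>\<^sup>+y. ?c \<omega> s y * H (z + (s *\<^sub>R a - y), \<omega>) \<partial>lborel \<partial>lborel \<partial>lborel)"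
    by (intro Lp_norm_mono p) auto
  also have "\<dots> \<le> (\<integral>\<^sup>+\<omega>. Lp_norm p (\<lambda>z. \<integral>\<^sup>+s. \<integral>\<^sup>+y. ?c \<omega> s y * H (z + (s *\<^sub>R a - y), \<omega>) \<partial>lborel \<partial>lborel) \<partial>lborel)"
    by (rule Lp) measurable
  also have "\<dots> \<le> (\<integral>\<^sup>+\<omega>. \<integral>\<^sup>+s. \<integral>\<^sup>+y. ?c \<omega> s y * Lp_norm p (\<lambda>x. H (x, \<omega>)) \<partial>lborel \<partial>lborel \<partial>lborel)"
  proof (rule nn_integral_mono)
    fix \<omega>
    have "Lp_norm p (\<lambda>z. \<integral>\<^sup>+s. \<integral>\<^sup>+y. ?c \<omega> s y * H (z + (s *\<^sub>R a - y), \<omega>) \<partial>lborel \<partial>lborel) \<le>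
        (\<integral>\<^sup>+s. Lp_norm p (\<lambda>z. \<integral>\<^sup>+y. ?c \<omega> s y * H (z + (s *\<^sub>R a - y), \<omega>) \<partial>lborel) \<partial>lborel)"
      by (rule Lp) measurable
    also have "\<dots> \<le> (\<integral>\<^sup>+s. \<integral>\<^sup>+y. ?c \<omega> s y * Lp_norm p (\<lambda>x. H (x, \<omega>)) \<partial>lborel \<partial>lborel)"
    proof (rule nn_integral_mono)
      fix s
      have "Lp_norm p (\<lambda>z. \<integral>\<^sup>+y. ?c \<omega> s y * H (z + (s *\<^sub>R a - y), \<omega>) \<partial>lborel) \<le>
          (\<integral>\<^sup>+y. Lp_norm p (\<lambda>z. ?c \<omega> s y * H (z + (s *\<^sub>R a - y), \<omega>)) \<partial>lborel)"
        by (rule Lp) measurable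
      also have "\<dots> = (\<integral>\<^sup>+y. ?c \<omega> s y * Lp_norm p (\<lambda>x. H (x, \<omega>)) \<partial>lborel)"
        by (subst Lp_norm_cmult_translate[OF p False, of "\<lambda>x. H (x, \<omega>)"]) simp_all
      finally show "Lp_norm p (\<lambda>z. \<integral>\<^sup>+y. ?c \<omega> s y * H (z + (s *\<^sub>R a - y), \<omega>) \<partial>lborel) \<le>
          (\<integral>\<^sup>+y. ?c \<omega> s y * Lp_norm p (\<lambda>x. H (x, \<omega>)) \<partial>lborel)" .
    qed
    finally show "Lp_norm p (\<lambda>z. \<integral>\<^sup>+s. \<integral>\<^sup>+y. ?c \<omega> s y * H (z + (s *\<^sub>R a - y), \<omega>) \<partial>lborel \<partial>lborel) \<le>
        (\<integral>\<^sup>+s. \<integral>\<^sup>+y. ?c \<omega> s y * Lp_norm p (\<lambda>x. H (x, \<omega>)) \<partial>lborel \<partial>lborel)" .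
  qed
  also have "\<dots> = (\<integral>\<^sup>+\<omega>. k1 (w - \<omega>) * (\<integral>\<^sup>+y. k2 y \<partial>lborel) * Lp_norm p (\<lambda>x. H (x, \<omega>)) \<partial>lborel)"
  proof (rule nn_integral_cong)
    fix \<omega>
    have "(\<integral>\<^sup>+y. ?c \<omega> s y * Lp_norm p (\<lambda>x. H (x, \<omega>)) \<partial>lborel) =
        indicator {-1/2..1/2::real} s * (k1 (w - \<omega>) * (\<integral>\<^sup>+y. k2 y \<partial>lborel) * Lp_norm p (\<lambda>x. H (x, \<omega>)))" for s
      by (simp add: nn_integral_multc nn_integral_cmult mult_ac)
    then show "(\<integral>\<^sup>+s. \<integral>\<^sup>+y. ?c \<omega> s y * Lp_norm p (\<lambda>x. H (x, \<omega>)) \<partial>lborel \<partial>lborel) =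
        k1 (w - \<omega>) * (\<integral>\<^sup>+y. k2 y \<partial>lborel) * Lp_norm p (\<lambda>x. H (x, \<omega>))"
      by (simp only: nn_integral_unit_interval)
  qed
  finally show ?thesis .
qed

section \<open>Boundedness on modulation spaces\<close>

text \<open>For each fixed output frequency \<open>Lp_norm_shear_bound\<close> reduces the kernel
  bound to a convolution of frequency profiles, and Young's inequality with exponent
  \<open>q\<close> finishes. The decay \<open>DIM('a \<times> 'a) + 2\<close> makes both kernels
  integrable.\<close>

lemma bj_dist_modulation_space:
  fixes g :: "'a::euclidean_space \<times> 'a \<Rightarrow> complex"
  assumes \<kappa>: "inversion_constant TYPE('a \<times> 'a) \<kappa>" and p: "1 \<le> p" and q: "1 \<le> q"
    and g: "g \<in> schwartz" "g \<noteq> (\<lambda>_. 0)" and T: "T \<in> modulation_space g p q"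
  shows "bj_dist \<kappa> T \<in> modulation_space g p q"
proof -
  have Tt: "T \<in> tempered_distributions" using T by (simp add: modulation_space_def)
  let ?Q = "bj_dist \<kappa> T"
  have Q: "?Q \<in> tempered_distributions" by (rule bj_dist_tempered[OF Tt])
  define \<gamma> where "\<gamma> y = cnj (g y)" for y
  have \<gamma>: "\<gamma> \<in> schwartz" "\<gamma> \<noteq> (\<lambda>_. 0)"
    using schwartz_cnj[OF g(1)] g(2) by (auto simp: \<gamma>_def[abs_def] fun_eq_iff)
  have stft: "stft g F x \<omega> = F (atom \<gamma> (x, \<omega>))" for F x \<omega>
    by (simp add: stft_eq_atom \<gamma>_def[abs_def])
  define H where "H t = ennreal (norm (T (atom \<gamma> t)))" for t
  define U where "U t = ennreal (norm (?Q (atom \<gamma> t)))" for t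
  have H_cont: "continuous_on UNIV H" and U_cont: "continuous_on UNIV U"
    unfolding H_def[abs_def] U_def[abs_def]
    by (intro continuous_on_ennreal continuous_on_norm continuous_tempered_atom Tt Q \<gamma>(1))+
  have [measurable]: "H \<in> borel_measurable (borel \<Otimes>\<^sub>M borel)" "U \<in> borel_measurable (borel \<Otimes>\<^sub>M borel)"
    unfolding borel_prod by (intro borel_measurable_continuous_onI H_cont U_cont)+
  let ?N = "DIM('a \<times> 'a) + 2"
  obtain C where C: "C \<ge> 0" "\<And>z w x \<omega>. ennreal (norm (stft_coeff \<gamma> (bj_op (atom \<gamma> (z, w))) (x, \<omega>))) \<le>
    (\<integral>\<^sup>+s. ennreal (indicator {-1/2..1/2} s * (C / (1 + norm (w - \<omega>)) ^ ?N / (1 + norm (z - x + s *\<^sub>R prod.swap w)) ^ ?N)) \<partial>lborel)"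
    using bj_kernel_bound[OF \<gamma>(1), of ?N] by blast
  define c0 where "c0 = \<kappa> * (\<integral>x. \<gamma> x * cnj (\<gamma> x) \<partial>lborel)"
  have \<kappa>0: "\<kappa> \<noteq> 0" using \<kappa> by (simp add: inversion_constant_def)
  have c0: "c0 \<noteq> 0" unfolding c0_def using \<kappa>0 schwartz_square_integral_nonzero[OF \<gamma>] by simp
  \<comment> \<open>One factor undoes the normalisation constant in \<open>bj_dist\<close>, the
    other the constant of the reproducing formula.\<close>
  define K where "K = inverse (norm \<kappa> * norm c0)"
  have K: "0 \<le> K" by (simp add: K_def)
  define k1 where "k1 u = ennreal (K * C) * ennreal (1 / (1 + norm u) ^ ?N)" for u :: "'a \<times> 'a"
  define k2 where "k2 u = ennreal (1 / (1 + norm u) ^ ?N)" for u :: "'a \<times> 'a"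
  have [measurable]: "k1 \<in> borel_measurable borel" "k2 \<in> borel_measurable borel"
    unfolding k1_def[abs_def] k2_def[abs_def] by measurable
  let ?\<Phi> = "\<lambda>z w \<omega> s x. k1 (w - \<omega>) * (indicator {-1/2..1/2::real} s * (k2 (z - x + s *\<^sub>R prod.swap w) * H (x, \<omega>)))"
  have U_le: "U (z, w) \<le> (\<integral>\<^sup>+\<omega>. \<integral>\<^sup>+s. \<integral>\<^sup>+x. ?\<Phi> z w \<omega> s x \<partial>lborel \<partial>lborel \<partial>lborel)" for z w
  proof -
    let ?d = "stft_coeff \<gamma> (bj_op (atom \<gamma> (z, w)))"
    have [measurable]: "?d \<in> borel_measurable (borel \<Otimes>\<^sub>M borel)"
      unfolding borel_prod
      using stft_coeff_rapidly_decreasing[OF \<gamma>(1) bj_op_schwartz[OF atom_schwartz[OF \<gamma>(1)]]]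
      by (simp add: rapidly_decreasing_def)
    have eq: "c0 * T (bj_op (atom \<gamma> (z, w))) = (\<integral>t. ?d t * T (atom \<gamma> t) \<partial>lborel)"
      unfolding c0_def by (rule tempered_stft_expansion[OF \<kappa> \<gamma> bj_op_schwartz[OF atom_schwartz[OF \<gamma>(1)]] Tt])
    have "?Q (atom \<gamma> (z, w)) = inverse \<kappa> * inverse c0 * (\<integral>t. ?d t * T (atom \<gamma> t) \<partial>lborel)"
      unfolding eq[symmetric] using c0 by (simp add: bj_dist_apply[OF Tt atom_schwartz[OF \<gamma>(1)]])
    then have "norm (?Q (atom \<gamma> (z, w))) = K * norm (\<integral>t. ?d t * T (atom \<gamma> t) \<partial>lborel)"
      by (simp add: norm_mult norm_inverse K_def)
    then have "U (z, w) = ennreal K * ennreal (norm (\<integral>t. ?d t * T (atom \<gamma> t) \<partial>lborel))"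
      using K by (simp add: U_def ennreal_mult)
    also have "\<dots> \<le> ennreal K * (\<integral>\<^sup>+t. ennreal (norm (?d t * T (atom \<gamma> t))) \<partial>lborel)"
      by (intro mult_left_mono norm_integral_le_nn_integral) simp
    also have "\<dots> = ennreal K * (\<integral>\<^sup>+t. ennreal (norm (?d t)) * H t \<partial>lborel)"
      by (simp add: norm_mult H_def ennreal_mult)
    also have "\<dots> = ennreal K * (\<integral>\<^sup>+x. \<integral>\<^sup>+\<omega>. ennreal (norm (?d (x, \<omega>))) * H (x, \<omega>) \<partial>lborel \<partial>lborel)"
    proof -
      have "(\<lambda>t. ennreal (norm (?d t)) * H t) \<in> borel_measurable (lborel \<Otimes>\<^sub>M lborel)" by measurable
      from lborel.nn_integral_fst[OF this] show ?thesis by (simp only: lborel_prod)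
    qed
    also have "\<dots> = (\<integral>\<^sup>+x. \<integral>\<^sup>+\<omega>. ennreal K * (ennreal (norm (?d (x, \<omega>))) * H (x, \<omega>)) \<partial>lborel \<partial>lborel)"
      by (simp add: nn_integral_cmult)
    also have "\<dots> \<le> (\<integral>\<^sup>+x. \<integral>\<^sup>+\<omega>. \<integral>\<^sup>+s. ?\<Phi> z w \<omega> s x \<partial>lborel \<partial>lborel \<partial>lborel)"
    proof (intro nn_integral_mono)
      fix x \<omega>
      let ?k = "\<lambda>s. indicator {-1/2..1/2} s * (C / (1 + norm (w - \<omega>)) ^ ?N / (1 + norm (z - x + s *\<^sub>R prod.swap w)) ^ ?N)"
      have k: "ennreal K * ennreal (?k s) * H (x, \<omega>) = ?\<Phi> z w \<omega> s x" for s
      proof -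
        have "ennreal K * ennreal (?k s) = ennreal (K * C * (1 / (1 + norm (w - \<omega>)) ^ ?N) *
            (indicator {-1/2..1/2} s * (1 / (1 + norm (z - x + s *\<^sub>R prod.swap w)) ^ ?N)))"
          using K C(1) by (subst ennreal_mult[symmetric]) (auto simp: indicator_def)
        also have "\<dots> = k1 (w - \<omega>) * (indicator {-1/2..1/2} s * k2 (z - x + s *\<^sub>R prod.swap w))"
        proof -
          have "ennreal (a * b * (indicator A s * c)) = ennreal a * ennreal b * (indicator A s * ennreal c)"
            if "0 \<le> a" "0 \<le> b" "0 \<le> c" for a b c and A :: "real set"
            using that by (cases "s \<in> A") (auto simp: ennreal_mult)
          from this[OF mult_nonneg_nonneg[OF K C(1)]] show ?thesis
            unfolding k1_def k2_def by (simp only: zero_le_divide_1_iff weight_nonneg)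
        qed
        finally show ?thesis by (simp only: mult.assoc)
      qed
      have "ennreal K * (ennreal (norm (?d (x, \<omega>))) * H (x, \<omega>)) \<le>
          ennreal K * ((\<integral>\<^sup>+s. ennreal (?k s) \<partial>lborel) * H (x, \<omega>))"
        by (intro mult_left_mono mult_right_mono C(2)) auto
      also have "\<dots> = (\<integral>\<^sup>+s. ennreal K * ennreal (?k s) * H (x, \<omega>) \<partial>lborel)"
        by (simp add: nn_integral_cmult nn_integral_multc mult.assoc del: power_Suc)
      also have "\<dots> = (\<integral>\<^sup>+s. ?\<Phi> z w \<omega> s x \<partial>lborel)" by (simp only: k)
      finally show "ennreal K * (ennreal (norm (?d (x, \<omega>))) * H (x, \<omega>)) \<le> (\<integral>\<^sup>+s. ?\<Phi> z w \<omega> s x \<partial>lborel)" .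
    qed
    \<comment> \<open>The frequency integral goes outermost and the position integral innermost, the
      order that \<open>Lp_norm_shear_bound\<close> expects.\<close>
    also have "\<dots> = (\<integral>\<^sup>+\<omega>. \<integral>\<^sup>+x. \<integral>\<^sup>+s. ?\<Phi> z w \<omega> s x \<partial>lborel \<partial>lborel \<partial>lborel)"
      by (rule lborel_pair.Fubini'[symmetric]) measurable
    also have "\<dots> = (\<integral>\<^sup>+\<omega>. \<integral>\<^sup>+s. \<integral>\<^sup>+x. ?\<Phi> z w \<omega> s x \<partial>lborel \<partial>lborel \<partial>lborel)"
      by (intro nn_integral_cong lborel_pair.Fubini'[symmetric]) measurable
    finally show ?thesis .
  qed
  define NH where "NH \<omega> = Lp_norm p (\<lambda>x. H (x, \<omega>))" for \<omega>
  define NU where "NU w = Lp_norm p (\<lambda>z. U (z, w))" for w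
  have [measurable]: "NH \<in> borel_measurable borel" "NU \<in> borel_measurable borel"
    unfolding NH_def[abs_def] NU_def[abs_def] by (intro Lp_norm_measurable H_cont U_cont)+
  let ?K2 = "\<integral>\<^sup>+y. k2 y \<partial>lborel"
  have "NU w \<le> (\<integral>\<^sup>+\<omega>. (\<lambda>y. k1 y * ?K2) (w - \<omega>) * NH \<omega> \<partial>lborel)" for w
    unfolding NU_def NH_def
    by (rule Lp_norm_shear_bound[OF p _ _ _ _ U_le]) measurable
  then have "Lp_norm q NU \<le> Lp_norm q (\<lambda>w. \<integral>\<^sup>+\<omega>. (\<lambda>y. k1 y * ?K2) (w - \<omega>) * NH \<omega> \<partial>lborel)"
    by (intro Lp_norm_mono q) auto
  also have "\<dots> \<le> (\<integral>\<^sup>+y. k1 y * ?K2 \<partial>lborel) * Lp_norm q NH"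
    by (rule Lp_norm_convolution[OF q]) measurable
  also have "\<dots> < \<infinity>"
  proof -
    have "?K2 < \<infinity>" unfolding k2_def by (rule nn_integral_weight_finite)
    moreover have "(\<integral>\<^sup>+y. k1 y \<partial>lborel) = ennreal (K * C) * ?K2"
      unfolding k1_def k2_def by (rule nn_integral_cmult) measurable
    ultimately have "(\<integral>\<^sup>+y. k1 y * ?K2 \<partial>lborel) < \<infinity>"
      by (simp add: nn_integral_multc ennreal_mult_less_top)
    moreover have "Lp_norm q NH < \<infinity>"
      using T by (simp add: modulation_space_def modulation_norm_def stft NH_def[abs_def] H_def)
    ultimately show ?thesis by (simp add: ennreal_mult_less_top)
  qed
  finally show ?thesis
    using Q by (simp add: modulation_space_def modulation_norm_def stft NU_def[abs_def] U_def)
qed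

theorem theorem1p2:
  fixes p q :: ennreal
    and f :: "(real ^ 'd) functional"
    and g :: "(real ^ 'd) \<times> (real ^ 'd) \<Rightarrow> complex"
    and n :: nat
  assumes "1 \<le> p" and "1 \<le> q"
    and "g \<in> schwartz" and "g \<noteq> (\<lambda>_. 0)"
    and "f \<in> tempered_distributions"
    and "wigner f \<in> modulation_space g p q"
    and "n \<ge> 1"
  shows "born_jordan n f \<in> modulation_space g p q"
proof -
  \<comment> \<open>The window itself serves as the nonzero Schwartz function from which the
    inversion constant is obtained.\<close>
  obtain \<kappa> where \<kappa>: "inversion_constant TYPE((real ^ 'd) \<times> (real ^ 'd)) \<kappa>"
    using fourier_inversion[OF assms(3,4)] unfolding inversion_constant_def by metis
  \<comment> \<open>The induction starts at 0, where the claim is the assumption on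
    \<open>wigner f\<close>.\<close>
  have "(bj_dist \<kappa> ^^ n) (wigner f) \<in> modulation_space g p q"
    by (induction n) (auto intro: bj_dist_modulation_space[OF \<kappa> assms(1-4)] assms(6))
  moreover have "wigner f \<in> tempered_distributions"
    using assms(6) by (simp add: modulation_space_def)
  ultimately show ?thesis by (simp add: born_jordan_eq[OF \<kappa>])
qed

end
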